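(* On any connected strongly conformally Einstein Kähler manifold $(M,g,J,\omega)$ of real dimension $2m\ge4$, with conformal factor $\tau$, there are constants $a,b$, not both zero, such that $\chi=(a\tau+b)\,d\tau\wedge Jd\tau/|d\tau|^2$ is a hamiltonian $2$-form on the open set where $d\tau$ is nonzero.
   Context: $\omega(X,Y)=g(JX,Y)$; $\nabla$ is the Levi-Civita connection; vectors and $1$-forms are identified via $g$; $J\alpha=-\alpha\circ J$ on $1$-forms and $d^cf=Jdf$; $\rho(X,Y)=\mathrm{Ric}(JX,Y)$ is the Ricci form. A Kähler manifold of real dimension $2m\ge4$ is conformally Einstein with conformal factor $\tau$ (a nonvanishing function) if $\tau^{-2}g$ is an Einstein metric, i.e. its Ricci tensor has zero traceless part. This holds if and only if $2(m-1)\nabla Jd\tau=-\tau\rho+\lambda\omega$ for some function $\lambda$, which is then uniquely determined. It is strongly conformally Einstein if in addition $d\tau\wedge d\lambda=0$ (this is automatic if $2m\ge6$). A real $J$-invariant $2$-form $\phi$ is hamiltonian if there is a function $\sigma$ with $\nabla_X\phi=\frac12(d\sigma\wedge JX-d^c\sigma\wedge X)$ for every vector field $X$. *)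

theory Defs
  imports "HOL-Analysis.Analysis"
begin

text \<open>A tangent space is identified, through a chart, with the model space 'e. The standard
  inner product and norm of 'e carry no geometric meaning.\<close>

definition linear_trace :: "('e::euclidean_space \<Rightarrow> 'e) \<Rightarrow> real" where
  "linear_trace A = (\<Sum>b\<in>Basis. A b \<bullet> b)"

definition inner_product_form :: "('e::euclidean_space \<Rightarrow> 'e \<Rightarrow> real) \<Rightarrow> bool" where
  "inner_product_form h \<longleftrightarrow>
     bilinear h \<and> (\<forall>u v. h u v = h v u) \<and> (\<forall>u. u \<noteq> 0 \<longrightarrow> h u u > 0)"

definition metric_trace :: "('e::euclidean_space \<Rightarrow> 'e \<Rightarrow> real) \<Rightarrow> ('e \<Rightarrow> 'e \<Rightarrow> real) \<Rightarrow> real" where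
  "metric_trace h B = linear_trace (THE A. linear A \<and> (\<forall>u v. h (A u) v = B u v))"

definition traceless_part ::
  "('e::euclidean_space \<Rightarrow> 'e \<Rightarrow> real) \<Rightarrow> ('e \<Rightarrow> 'e \<Rightarrow> real) \<Rightarrow> 'e \<Rightarrow> 'e \<Rightarrow> real" where
  "traceless_part h B u v = B u v - metric_trace h B / real DIM('e) * h u v"

definition flat_form :: "('e::euclidean_space \<Rightarrow> 'e \<Rightarrow> real) \<Rightarrow> 'e \<Rightarrow> 'e \<Rightarrow> real" where
  "flat_form h u = (\<lambda>v. h u v)"

definition sharp_vector :: "('e::euclidean_space \<Rightarrow> 'e \<Rightarrow> real) \<Rightarrow> ('e \<Rightarrow> real) \<Rightarrow> 'e" where
  "sharp_vector h \<alpha> = (THE u. flat_form h u = \<alpha>)"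

definition form_norm_sq :: "('e::euclidean_space \<Rightarrow> 'e \<Rightarrow> real) \<Rightarrow> ('e \<Rightarrow> real) \<Rightarrow> real" where
  "form_norm_sq h \<alpha> = h (sharp_vector h \<alpha>) (sharp_vector h \<alpha>)"

definition wedge :: "('e \<Rightarrow> real) \<Rightarrow> ('e \<Rightarrow> real) \<Rightarrow> 'e \<Rightarrow> 'e \<Rightarrow> real" where
  "wedge \<alpha> \<beta> u v = \<alpha> u * \<beta> v - \<alpha> v * \<beta> u"

definition J_form :: "('e \<Rightarrow> 'e) \<Rightarrow> ('e \<Rightarrow> real) \<Rightarrow> 'e \<Rightarrow> real" where
  "J_form J \<alpha> v = - \<alpha> (J v)"

text \<open>Here g, J, 1-forms and 2-forms are given by their values on vectors of the model space as
  functions of the coordinate point; a vector of the model space doubles as the constant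
  (coordinate) vector field.\<close>

definition form_d :: "('e::euclidean_space \<Rightarrow> real) \<Rightarrow> 'e \<Rightarrow> 'e \<Rightarrow> real" where
  "form_d f x = frechet_derivative f (at x)"

definition form_dc :: "('e::euclidean_space \<Rightarrow> 'e \<Rightarrow> 'e) \<Rightarrow> ('e \<Rightarrow> real) \<Rightarrow> 'e \<Rightarrow> 'e \<Rightarrow> real" where
  "form_dc J f x = J_form (J x) (form_d f x)"

text \<open>The Christoffel map of the Levi-Civita connection: the unique symmetric (torsion-free)
  bilinear map at x for which g is parallel.\<close>

definition levi_civita ::
  "('e::euclidean_space \<Rightarrow> 'e \<Rightarrow> 'e \<Rightarrow> real) \<Rightarrow> 'e \<Rightarrow> 'e \<Rightarrow> 'e \<Rightarrow> 'e" where
  "levi_civita g x = (THE G. bilinear G \<and> (\<forall>u v. G u v = G v u) \<and>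
     (\<forall>u v w. frechet_derivative (\<lambda>y. g y v w) (at x) u = g x (G u v) w + g x v (G u w)))"

definition nabla_vector ::
  "('e::euclidean_space \<Rightarrow> 'e \<Rightarrow> 'e \<Rightarrow> real) \<Rightarrow> 'e \<Rightarrow> ('e \<Rightarrow> 'e) \<Rightarrow> 'e \<Rightarrow> 'e" where
  "nabla_vector g u Y x = frechet_derivative Y (at x) u + levi_civita g x u (Y x)"

definition nabla_endo ::
  "('e::euclidean_space \<Rightarrow> 'e \<Rightarrow> 'e \<Rightarrow> real) \<Rightarrow> 'e \<Rightarrow> ('e \<Rightarrow> 'e \<Rightarrow> 'e) \<Rightarrow> 'e \<Rightarrow> 'e \<Rightarrow> 'e" where
  "nabla_endo g u A x v = nabla_vector g u (\<lambda>y. A y v) x - A x (nabla_vector g u (\<lambda>_. v) x)"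

definition nabla_form1 ::
  "('e::euclidean_space \<Rightarrow> 'e \<Rightarrow> 'e \<Rightarrow> real) \<Rightarrow> 'e \<Rightarrow> ('e \<Rightarrow> 'e \<Rightarrow> real) \<Rightarrow> 'e \<Rightarrow> 'e \<Rightarrow> real" where
  "nabla_form1 g u \<alpha> x v =
     frechet_derivative (\<lambda>y. \<alpha> y v) (at x) u - \<alpha> x (levi_civita g x u v)"

definition nabla_form2 ::
  "('e::euclidean_space \<Rightarrow> 'e \<Rightarrow> 'e \<Rightarrow> real) \<Rightarrow> 'e \<Rightarrow> ('e \<Rightarrow> 'e \<Rightarrow> 'e \<Rightarrow> real)
    \<Rightarrow> 'e \<Rightarrow> 'e \<Rightarrow> 'e \<Rightarrow> real" where
  "nabla_form2 g u \<phi> x v w =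
     frechet_derivative (\<lambda>y. \<phi> y v w) (at x) u
       - \<phi> x (levi_civita g x u v) w - \<phi> x v (levi_civita g x u w)"

text \<open>The bracket term of the curvature is absent because constant vector fields commute.\<close>

definition curvature ::
  "('e::euclidean_space \<Rightarrow> 'e \<Rightarrow> 'e \<Rightarrow> real) \<Rightarrow> 'e \<Rightarrow> 'e \<Rightarrow> 'e \<Rightarrow> 'e \<Rightarrow> 'e" where
  "curvature g x u v w =
     nabla_vector g u (nabla_vector g v (\<lambda>_. w)) x - nabla_vector g v (nabla_vector g u (\<lambda>_. w)) x"

definition ricci ::
  "('e::euclidean_space \<Rightarrow> 'e \<Rightarrow> 'e \<Rightarrow> real) \<Rightarrow> 'e \<Rightarrow> 'e \<Rightarrow> 'e \<Rightarrow> real" where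
  "ricci g x v w = linear_trace (\<lambda>u. curvature g x u v w)"

definition einstein_at :: "('e::euclidean_space \<Rightarrow> 'e \<Rightarrow> 'e \<Rightarrow> real) \<Rightarrow> 'e \<Rightarrow> bool" where
  "einstein_at g x \<longleftrightarrow> (\<forall>u v. traceless_part (g x) (ricci g x) u v = 0)"

definition kaehler_form ::
  "('e::euclidean_space \<Rightarrow> 'e \<Rightarrow> 'e \<Rightarrow> real) \<Rightarrow> ('e \<Rightarrow> 'e \<Rightarrow> 'e) \<Rightarrow> 'e \<Rightarrow> 'e \<Rightarrow> 'e \<Rightarrow> real" where
  "kaehler_form g J x u v = g x (J x u) v"

definition ricci_form ::
  "('e::euclidean_space \<Rightarrow> 'e \<Rightarrow> 'e \<Rightarrow> real) \<Rightarrow> ('e \<Rightarrow> 'e \<Rightarrow> 'e) \<Rightarrow> 'e \<Rightarrow> 'e \<Rightarrow> 'e \<Rightarrow> real" where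
  "ricci_form g J x u v = ricci g x (J x u) v"

text \<open>Intended for open S only, since the derivatives are two-sided.\<close>

primrec Ck_on :: "nat \<Rightarrow> 'a::real_normed_vector set \<Rightarrow> ('a \<Rightarrow> 'b::real_normed_vector) \<Rightarrow> bool" where
  "Ck_on 0 S f \<longleftrightarrow> continuous_on S f"
| "Ck_on (Suc k) S f \<longleftrightarrow> (\<forall>x\<in>S. f differentiable (at x)) \<and>
     (\<forall>v. Ck_on k S (\<lambda>x. frechet_derivative f (at x) v))"

definition smooth_on :: "'a::real_normed_vector set \<Rightarrow> ('a \<Rightarrow> 'b::real_normed_vector) \<Rightarrow> bool" where
  "smooth_on S f \<longleftrightarrow> (\<forall>k. Ck_on k S f)"

text \<open>A chart is a pair of its domain and its coordinate map. The manifold is the whole type 'a,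
  with its topology; any atlas, not necessarily maximal, determines the smooth structure.\<close>

type_synonym ('a, 'e) chart = "'a set \<times> ('a \<Rightarrow> 'e)"

definition chart_inv :: "('a, 'e) chart \<Rightarrow> 'e \<Rightarrow> 'a" where
  "chart_inv c = inv_into (fst c) (snd c)"

definition transition :: "('a, 'e) chart \<Rightarrow> ('a, 'e) chart \<Rightarrow> 'e \<Rightarrow> 'e" where
  "transition c d = snd d \<circ> chart_inv c"

definition smooth_atlas ::
  "('a::{t2_space, second_countable_topology}, 'e::euclidean_space) chart set \<Rightarrow> bool" where
  "smooth_atlas \<A> \<longleftrightarrow>
     (\<Union>c\<in>\<A>. fst c) = UNIV \<and>
     (\<forall>c\<in>\<A>. open (fst c) \<and> open (snd c ` fst c) \<and>
        homeomorphism (fst c) (snd c ` fst c) (snd c) (chart_inv c)) \<and>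
     (\<forall>c\<in>\<A>. \<forall>d\<in>\<A>. smooth_on (snd c ` (fst c \<inter> fst d)) (transition c d))"

definition local_rep :: "('a, 'e) chart \<Rightarrow> ('a \<Rightarrow> real) \<Rightarrow> 'e \<Rightarrow> real" where
  "local_rep c f = f \<circ> chart_inv c"

definition smooth_function_on ::
  "('a, 'e::euclidean_space) chart set \<Rightarrow> 'a set \<Rightarrow> ('a \<Rightarrow> real) \<Rightarrow> bool" where
  "smooth_function_on \<A> N f \<longleftrightarrow> (\<forall>c\<in>\<A>. smooth_on (snd c ` (fst c \<inter> N)) (local_rep c f))"

text \<open>A tensor field is the family of its coordinate expressions, one for each chart of the atlas,
  related on overlaps by the derivative of the coordinate change.\<close>

type_synonym ('a, 'e) bilinear_field = "('a, 'e) chart \<Rightarrow> 'e \<Rightarrow> 'e \<Rightarrow> 'e \<Rightarrow> real"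
type_synonym ('a, 'e) endo_field = "('a, 'e) chart \<Rightarrow> 'e \<Rightarrow> 'e \<Rightarrow> 'e"

definition smooth_bilinear_field_on ::
  "('a, 'e::euclidean_space) chart set \<Rightarrow> 'a set \<Rightarrow> ('a, 'e) bilinear_field \<Rightarrow> bool" where
  "smooth_bilinear_field_on \<A> N B \<longleftrightarrow>
     (\<forall>c\<in>\<A>. \<forall>x\<in>snd c ` (fst c \<inter> N). bilinear (B c x)) \<and>
     (\<forall>c\<in>\<A>. \<forall>u v. smooth_on (snd c ` (fst c \<inter> N)) (\<lambda>x. B c x u v)) \<and>
     (\<forall>c\<in>\<A>. \<forall>d\<in>\<A>. \<forall>p\<in>fst c \<inter> fst d \<inter> N. \<forall>u v.
        (let T = frechet_derivative (transition c d) (at (snd c p))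
         in B c (snd c p) u v = B d (snd d p) (T u) (T v)))"

definition smooth_endo_field ::
  "('a, 'e::euclidean_space) chart set \<Rightarrow> ('a, 'e) endo_field \<Rightarrow> bool" where
  "smooth_endo_field \<A> A \<longleftrightarrow>
     (\<forall>c\<in>\<A>. \<forall>x\<in>snd c ` fst c. linear (A c x)) \<and>
     (\<forall>c\<in>\<A>. \<forall>u. smooth_on (snd c ` fst c) (\<lambda>x. A c x u)) \<and>
     (\<forall>c\<in>\<A>. \<forall>d\<in>\<A>. \<forall>p\<in>fst c \<inter> fst d. \<forall>u.
        (let T = frechet_derivative (transition c d) (at (snd c p))
         in T (A c (snd c p) u) = A d (snd d p) (T u)))"

definition riemannian_metric ::
  "('a, 'e::euclidean_space) chart set \<Rightarrow> ('a, 'e) bilinear_field \<Rightarrow> bool" where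
  "riemannian_metric \<A> g \<longleftrightarrow> smooth_bilinear_field_on \<A> UNIV g \<and>
     (\<forall>c\<in>\<A>. \<forall>x\<in>snd c ` fst c. inner_product_form (g c x))"

definition two_form_on ::
  "('a, 'e::euclidean_space) chart set \<Rightarrow> 'a set \<Rightarrow> ('a, 'e) bilinear_field \<Rightarrow> bool" where
  "two_form_on \<A> N \<phi> \<longleftrightarrow> smooth_bilinear_field_on \<A> N \<phi> \<and>
     (\<forall>c\<in>\<A>. \<forall>x\<in>snd c ` (fst c \<inter> N). \<forall>u v. \<phi> c x u v = - \<phi> c x v u)"

definition kaehler_manifold ::
  "('a::{t2_space, second_countable_topology}, 'e::euclidean_space) chart set
    \<Rightarrow> ('a, 'e) bilinear_field \<Rightarrow> ('a, 'e) endo_field \<Rightarrow> bool" where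
  "kaehler_manifold \<A> g J \<longleftrightarrow>
     smooth_atlas \<A> \<and> riemannian_metric \<A> g \<and> smooth_endo_field \<A> J \<and>
     (\<forall>c\<in>\<A>. \<forall>x\<in>snd c ` fst c.
        (\<forall>u. J c x (J c x u) = - u) \<and>
        (\<forall>u v. g c x (J c x u) (J c x v) = g c x u v) \<and>
        (\<forall>u v. nabla_endo (g c) u (J c) x v = 0))"

definition conformally_einstein ::
  "('a, 'e::euclidean_space) chart set \<Rightarrow> ('a, 'e) bilinear_field \<Rightarrow> ('a \<Rightarrow> real) \<Rightarrow> bool" where
  "conformally_einstein \<A> g \<tau> \<longleftrightarrow>
     smooth_function_on \<A> UNIV \<tau> \<and> (\<forall>p. \<tau> p \<noteq> 0) \<and>
     (\<forall>c\<in>\<A>. \<forall>x\<in>snd c ` fst c.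
        einstein_at (\<lambda>y u v. g c y u v / (local_rep c \<tau> y)\<^sup>2) x)"

text \<open>For DIM('e) = 2m the factor DIM('e) - 2 below is 2(m - 1). The first argument of the
  covariant derivative, regarded as a bilinear form, is the direction of differentiation.\<close>

definition strongly_conformally_einstein ::
  "('a, 'e::euclidean_space) chart set \<Rightarrow> ('a, 'e) bilinear_field \<Rightarrow> ('a, 'e) endo_field
    \<Rightarrow> ('a \<Rightarrow> real) \<Rightarrow> bool" where
  "strongly_conformally_einstein \<A> g J \<tau> \<longleftrightarrow>
     conformally_einstein \<A> g \<tau> \<and>
     (\<exists>\<mu>. smooth_function_on \<A> UNIV \<mu> \<and>
        (\<forall>c\<in>\<A>. \<forall>x\<in>snd c ` fst c. \<forall>u v.
           (real DIM('e) - 2) * nabla_form1 (g c) u (form_dc (J c) (local_rep c \<tau>)) x v =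
             - local_rep c \<tau> x * ricci_form (g c) (J c) x u v
             + local_rep c \<mu> x * kaehler_form (g c) (J c) x u v) \<and>
        (\<forall>c\<in>\<A>. \<forall>x\<in>snd c ` fst c. \<forall>u v.
           wedge (form_d (local_rep c \<tau>) x) (form_d (local_rep c \<mu>) x) u v = 0))"

text \<open>The existentially quantified \<sigma> absorbs the normalisation of the wedge product.\<close>

definition hamiltonian_on ::
  "('a, 'e::euclidean_space) chart set \<Rightarrow> ('a, 'e) bilinear_field \<Rightarrow> ('a, 'e) endo_field
    \<Rightarrow> 'a set \<Rightarrow> ('a, 'e) bilinear_field \<Rightarrow> bool" where
  "hamiltonian_on \<A> g J N \<phi> \<longleftrightarrow>
     two_form_on \<A> N \<phi> \<and>
     (\<forall>c\<in>\<A>. \<forall>x\<in>snd c ` (fst c \<inter> N). \<forall>u v. \<phi> c x (J c x u) (J c x v) = \<phi> c x u v) \<and>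
     (\<exists>\<sigma>. smooth_function_on \<A> N \<sigma> \<and>
        (\<forall>c\<in>\<A>. \<forall>x\<in>snd c ` (fst c \<inter> N). \<forall>u v w.
           nabla_form2 (g c) u (\<phi> c) x v w =
             1/2 * (wedge (form_d (local_rep c \<sigma>) x) (flat_form (g c x) (J c x u)) v w
                    - wedge (form_dc (J c) (local_rep c \<sigma>) x) (flat_form (g c x) u) v w)))"

definition noncritical_set ::
  "('a, 'e::euclidean_space) chart set \<Rightarrow> ('a \<Rightarrow> real) \<Rightarrow> 'a set" where
  "noncritical_set \<A> \<tau> =
     {p. \<exists>c\<in>\<A>. p \<in> fst c \<and> form_d (local_rep c \<tau>) (snd c p) \<noteq> (\<lambda>_. 0)}"

definition chi_form ::
  "('a, 'e::euclidean_space) bilinear_field \<Rightarrow> ('a, 'e) endo_field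
    \<Rightarrow> ('a \<Rightarrow> real) \<Rightarrow> real \<Rightarrow> real \<Rightarrow> ('a, 'e) bilinear_field" where
  "chi_form g J \<tau> a b c x u v =
     (a * local_rep c \<tau> x + b)
       * wedge (form_d (local_rep c \<tau>) x) (form_dc (J c) (local_rep c \<tau>) x) u v
       / form_norm_sq (g c x) (form_d (local_rep c \<tau>) x)"

end

theory Submission
  imports Defs
begin

text \<open>Write \<open>H\<close> for the Hessian of \<open>\<tau>\<close>, \<open>\<theta> = d\<tau>\<close>, \<open>\<theta>c = d\<^sup>c\<tau>\<close>, and \<open>\<mu>\<close> for the function called \<open>\<lambda>\<close> in the
  definition of a strongly conformally Einstein manifold. The Einstein equation
  \<open>2(m-1) \<nabla>\<theta>c = -\<tau>\<rho> + \<mu>\<omega>\<close> makes \<open>H\<close> invariant under J. It is a relation, with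
  coefficients \<open>\<tau>\<close> and \<open>\<mu>\<close>, between the exact form \<open>d\<theta>c = 2\<nabla>\<theta>c\<close>, the Ricci form and the Kaehler form.
  All three are closed, the Ricci form by the second Bianchi identity, because it is half the trace of J composed with the
  curvature. The exterior derivative of the equation is therefore \<open>\<theta> \<and> \<rho> = d\<mu> \<and> \<omega>\<close>. Where
  \<open>\<theta>\<close> is nonzero, \<open>d\<mu> = \<mu>'\<theta>\<close>, so \<open>\<rho> = \<mu>'\<omega>\<close> on the kernel of \<open>\<theta>\<close>; hence
  \<open>H = \<psi> g + \<kappa> (\<theta>\<otimes>\<theta> + \<theta>c\<otimes>\<theta>c)\<close> with \<open>\<psi> = (\<mu> - \<tau>\<mu>')/(2m-2)\<close> (lemma hess_formula).

  Put \<open>Q = |\<theta>|\<^sup>2\<close>, \<open>f = \<psi>/Q\<close> and \<open>\<beta> = \<theta>c/Q\<close>. The formula for \<open>H\<close> amounts to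
  \<open>d\<beta> = 2f (\<omega> - \<theta> \<and> \<beta>)\<close>, and a further exterior derivative gives \<open>df = -2f\<^sup>2\<theta>\<close> (lemma f_pd). So, for
  constants a and b, the function \<open>F = 2f(a\<tau> + b) - a\<close> satisfies \<open>dF = -2fF\<theta>\<close>: if it vanishes at one
  regular point, it vanishes on the whole component of that point. The choice
  \<open>a = 2f(p)\<close>, \<open>b = 1 - a\<tau>(p)\<close> achieves this at p, and this pair is never zero. On the other hand the
  formula for \<open>H\<close> shows that \<open>(a\<tau> + b) \<theta> \<and> \<beta>\<close> is hamiltonian, with \<open>\<sigma> = a\<tau>\<close>, where \<open>F = 0\<close>
  (lemma nabla_chi).

  One pair of constants serves for all regular points because these form a connected set (lemma
  N_connected). The critical points are the zeros of the Killing field J grad \<open>\<tau>\<close>, and so they should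
  have codimension at least two. Two elementary facts replace the theory of Killing fields. First,
  the third derivatives of \<open>\<tau>\<close> are linear combinations of the lower ones, so a critical point at which
  \<open>H\<close> vanishes is interior to the critical set, and by connectedness \<open>\<tau>\<close> is constant (lemma
  unique_continuation). Secondly, at a critical point where \<open>H\<close> is nonzero its J-invariance provides two components of
  \<open>\<theta>\<close> with independent differentials, and in a small neighbourhood the complement of their
  common zeros is connected and dense (lemma complement_of_independent_zeros).

  The tensor calculus takes place in a chart. Smoothness of the Christoffel map and of the gradient
  reduces to the smoothness of raising an index (lemma smooth_on_sharp_vector).\<close>

section \<open>Calculus of smooth functions\<close>

abbreviation pd :: "('a::real_normed_vector \<Rightarrow> 'b::real_normed_vector) \<Rightarrow> 'a \<Rightarrow> 'a \<Rightarrow> 'b" where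
  "pd f x \<equiv> frechet_derivative f (at x)"

lemma pd_eqI: "(f has_derivative f') (at x) \<Longrightarrow> pd f x = f'"
  by (metis frechet_derivative_at)

lemma Ck_on_cong:
  assumes "open S" "\<And>x. x \<in> S \<Longrightarrow> f x = g x" "Ck_on k S f"
  shows "Ck_on k S g"
  using assms(2,3)
proof (induction k arbitrary: f g)
  case 0
  then show ?case using continuous_on_cong[OF refl, of S f g] by simp
next
  case (Suc k)
  have *: "(g has_derivative pd f x) (at x)" if "x \<in> S" for x
    using Suc.prems that
    by (intro has_derivative_transform_within_open[OF frechet_derivative_works[THEN iffD1] assms(1) that]) simp_all
  have 1: "pd f x = pd g x" if "x \<in> S" for x using pd_eqI[OF *[OF that]] by simp
  have 2: "g differentiable (at x)" if "x \<in> S" for x by (rule differentiableI[OF *[OF that]])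
  have "Ck_on k S (\<lambda>x. pd g x v)" for v
    by (rule Suc.IH[of "\<lambda>x. pd f x v"]) (use Suc.prems(2) 1 in auto)
  with 2 show ?case by simp
qed

lemma pd_cong:
  assumes "open S" "x \<in> S" "\<And>y. y \<in> S \<Longrightarrow> f y = g y"
  shows "pd f x = pd g x"
proof -
  have "(f has_derivative d) (at x) \<longleftrightarrow> (g has_derivative d) (at x)" for d
    by (rule iffI; erule has_derivative_transform_within_open[OF _ assms(1,2)]) (simp_all add: assms(3))
  then show ?thesis unfolding frechet_derivative_def by simp
qed

lemma Ck_on_subset: "Ck_on k S f \<Longrightarrow> T \<subseteq> S \<Longrightarrow> Ck_on k T f"
  by (induction k arbitrary: f) (auto intro: continuous_on_subset)

lemma Ck_on_SucD: "Ck_on (Suc k) S f \<Longrightarrow> Ck_on k S f"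
proof (induction k arbitrary: f)
  case 0
  then show ?case
    by (auto intro!: continuous_at_imp_continuous_on differentiable_imp_continuous_within)
next
  case (Suc k)
  then show ?case by simp
qed

lemma Ck_on_const: "Ck_on k S (\<lambda>x. c)"
  by (induction k arbitrary: c) auto

lemma Ck_on_add:
  assumes "open S"
  shows "Ck_on k S f \<Longrightarrow> Ck_on k S g \<Longrightarrow> Ck_on k S (\<lambda>x. f x + g x)"
proof (induction k arbitrary: f g)
  case (Suc k)
  have d: "((\<lambda>x. f x + g x) has_derivative (\<lambda>v. pd f x v + pd g x v)) (at x)" if "x \<in> S" for x
    using Suc.prems that by (intro has_derivative_add) (auto simp: frechet_derivative_works)
  have "Ck_on k S (\<lambda>x. pd (\<lambda>x. f x + g x) x v)" for v
    by (rule Ck_on_cong[OF assms _ Suc.IH[of "\<lambda>x. pd f x v" "\<lambda>x. pd g x v"]])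
       (use Suc.prems pd_eqI[OF d] in auto)
  then show ?case using d by (auto intro: differentiableI)
qed (simp add: continuous_on_add)

lemma Ck_on_bilinear:
  assumes "open S" "bounded_bilinear p"
  shows "Ck_on k S f \<Longrightarrow> Ck_on k S g \<Longrightarrow> Ck_on k S (\<lambda>x. p (f x) (g x))"
proof (induction k arbitrary: f g)
  case (Suc k)
  have d: "((\<lambda>x. p (f x) (g x)) has_derivative (\<lambda>v. p (f x) (pd g x v) + p (pd f x v) (g x))) (at x)"
    if "x \<in> S" for x
    using Suc.prems that
    by (intro bounded_bilinear.FDERIV[OF assms(2)]) (auto simp: frechet_derivative_works)
  have "Ck_on k S (\<lambda>x. pd (\<lambda>x. p (f x) (g x)) x v)" for v
    by (rule Ck_on_cong[OF assms(1) _ Ck_on_add[OF assms(1) Suc.IH[of f "\<lambda>x. pd g x v"] Suc.IH[of "\<lambda>x. pd f x v" g]]])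
       (use Suc.prems Ck_on_SucD[OF Suc.prems(1)] Ck_on_SucD[OF Suc.prems(2)] pd_eqI[OF d] in auto)
  then show ?case using d by (auto intro: differentiableI)
qed (simp add: bounded_bilinear.continuous_on[OF assms(2)])

lemma Ck_on_inverse:
  fixes f :: "'a::real_normed_vector \<Rightarrow> real"
  assumes "open S" and nz: "\<And>x. x \<in> S \<Longrightarrow> f x \<noteq> 0"
  shows "Ck_on k S f \<Longrightarrow> Ck_on k S (\<lambda>x. inverse (f x))"
proof (induction k)
  case (Suc k)
  have d: "((\<lambda>x. inverse (f x)) has_derivative
      (\<lambda>v. pd f x v * (- 1 * (inverse (f x) * inverse (f x))))) (at x)" if "x \<in> S" for x
    using Suc.prems that nz
    by (auto intro!: derivative_eq_intros simp: frechet_derivative_works)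
  note m = Ck_on_bilinear[OF assms(1) bounded_bilinear_mult]
  have i: "Ck_on k S (\<lambda>x. inverse (f x))" using Suc.IH Ck_on_SucD[OF Suc.prems] by auto
  have "Ck_on k S (\<lambda>x. pd (\<lambda>x. inverse (f x)) x v)" for v
    by (rule Ck_on_cong[OF assms(1) _ m[OF _ m[OF Ck_on_const[where c = "-1"] m[OF i i]], of "\<lambda>x. pd f x v"]])
       (use Suc.prems pd_eqI[OF d] in auto)
  then show ?case using d by (auto intro: differentiableI)
qed (simp add: nz continuous_on_inverse)

text \<open>This fixed-point property spares the later proofs any count of the order of differentiability.\<close>

lemma smooth_on_iff:
  "smooth_on S f \<longleftrightarrow> (\<forall>x\<in>S. f differentiable (at x)) \<and> (\<forall>v. smooth_on S (\<lambda>x. pd f x v))"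
proof
  assume "smooth_on S f"
  then have "Ck_on (Suc k) S f" for k unfolding smooth_on_def by blast
  then show "(\<forall>x\<in>S. f differentiable (at x)) \<and> (\<forall>v. smooth_on S (\<lambda>x. pd f x v))"
    unfolding smooth_on_def by simp
next
  assume "(\<forall>x\<in>S. f differentiable (at x)) \<and> (\<forall>v. smooth_on S (\<lambda>x. pd f x v))"
  then have "Ck_on (Suc k) S f" for k unfolding smooth_on_def by simp
  then show "smooth_on S f" unfolding smooth_on_def using Ck_on_SucD by blast
qed

lemma smooth_on_differentiable: "smooth_on S f \<Longrightarrow> x \<in> S \<Longrightarrow> f differentiable (at x)"
  and smooth_on_pd: "smooth_on S f \<Longrightarrow> smooth_on S (\<lambda>x. pd f x v)"
  using smooth_on_iff by blast+

lemma smooth_on_continuous: "smooth_on S f \<Longrightarrow> continuous_on S f"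
  unfolding smooth_on_def using Ck_on.simps(1) by blast

lemma smooth_on_has_derivative: "smooth_on S f \<Longrightarrow> x \<in> S \<Longrightarrow> (f has_derivative pd f x) (at x)"
  using smooth_on_differentiable frechet_derivative_works by blast

lemma linear_pd: "smooth_on S f \<Longrightarrow> x \<in> S \<Longrightarrow> linear (pd f x)"
  using smooth_on_differentiable linear_frechet_derivative by blast

lemma smooth_on_cong:
  "open S \<Longrightarrow> smooth_on S f \<Longrightarrow> (\<And>x. x \<in> S \<Longrightarrow> f x = g x) \<Longrightarrow> smooth_on S g"
  unfolding smooth_on_def using Ck_on_cong by blast

lemma smooth_on_subset: "smooth_on S f \<Longrightarrow> T \<subseteq> S \<Longrightarrow> smooth_on T f"
  unfolding smooth_on_def using Ck_on_subset by blast

lemma smooth_on_const: "smooth_on S (\<lambda>x. c)"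
  unfolding smooth_on_def using Ck_on_const by blast

lemma smooth_on_add:
  "open S \<Longrightarrow> smooth_on S f \<Longrightarrow> smooth_on S g \<Longrightarrow> smooth_on S (\<lambda>x. f x + g x)"
  unfolding smooth_on_def using Ck_on_add by blast

lemma smooth_on_bilinear:
  "bounded_bilinear p \<Longrightarrow> open S \<Longrightarrow> smooth_on S f \<Longrightarrow> smooth_on S g \<Longrightarrow> smooth_on S (\<lambda>x. p (f x) (g x))"
  unfolding smooth_on_def using Ck_on_bilinear by blast

lemmas smooth_on_mult = smooth_on_bilinear[OF bounded_bilinear_mult]
lemmas smooth_on_scaleR = smooth_on_bilinear[OF bounded_bilinear_scaleR]
lemmas smooth_on_inner = smooth_on_bilinear[OF bounded_bilinear_inner]

lemma smooth_on_minus: "open S \<Longrightarrow> smooth_on S f \<Longrightarrow> smooth_on S (\<lambda>x. - f x)"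
  using smooth_on_scaleR[OF _ smooth_on_const, of S f "-1"] by simp

lemma smooth_on_diff:
  "open S \<Longrightarrow> smooth_on S f \<Longrightarrow> smooth_on S g \<Longrightarrow> smooth_on S (\<lambda>x. f x - g x)"
  using smooth_on_add[OF _ _ smooth_on_minus, of S f g] by simp

lemma smooth_on_divide:
  fixes f g :: "'a::real_normed_vector \<Rightarrow> real"
  shows "open S \<Longrightarrow> (\<And>x. x \<in> S \<Longrightarrow> g x \<noteq> 0) \<Longrightarrow> smooth_on S f \<Longrightarrow> smooth_on S g \<Longrightarrow>
    smooth_on S (\<lambda>x. f x / g x)"
  using smooth_on_mult[of S f "\<lambda>x. inverse (g x)"] Ck_on_inverse[of S g]
  by (auto simp: smooth_on_def divide_inverse)

lemma smooth_on_sum: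
  assumes "open S" "\<And>i. i \<in> I \<Longrightarrow> smooth_on S (f i)"
  shows "smooth_on S (\<lambda>x. \<Sum>i\<in>I. f i x)"
proof (cases "finite I")
  case True
  then show ?thesis using assms(2)
    by (induction I) (auto intro: smooth_on_const smooth_on_add[OF assms(1)])
qed (simp add: smooth_on_const)

lemmas smooth_intros = smooth_on_const smooth_on_add smooth_on_diff smooth_on_minus smooth_on_mult
  smooth_on_scaleR smooth_on_inner smooth_on_divide smooth_on_sum smooth_on_pd

lemma pd_add: "f differentiable (at x) \<Longrightarrow> g differentiable (at x) \<Longrightarrow>
    pd (\<lambda>y. f y + g y) x u = pd f x u + pd g x u"
  and pd_diff: "f differentiable (at x) \<Longrightarrow> g differentiable (at x) \<Longrightarrow>
    pd (\<lambda>y. f y - g y) x u = pd f x u - pd g x u"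
  and pd_minus: "f differentiable (at x) \<Longrightarrow> pd (\<lambda>y. - f y) x u = - pd f x u"
  unfolding frechet_derivative_works
  by (rule fun_cong[OF pd_eqI], erule has_derivative_add has_derivative_diff has_derivative_minus, assumption?)+

lemma pd_bilinear: "bounded_bilinear p \<Longrightarrow> f differentiable (at x) \<Longrightarrow> g differentiable (at x) \<Longrightarrow>
    pd (\<lambda>y. p (f y) (g y)) x u = p (f x) (pd g x u) + p (pd f x u) (g x)"
  unfolding frechet_derivative_works
  by (rule fun_cong[OF pd_eqI]) (rule bounded_bilinear.FDERIV)

lemmas pd_mult = pd_bilinear[OF bounded_bilinear_mult]
lemmas pd_scaleR = pd_bilinear[OF bounded_bilinear_scaleR]

lemma pd_divide:
  fixes f g :: "'a::real_normed_vector \<Rightarrow> real"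
  shows "f differentiable (at x) \<Longrightarrow> g differentiable (at x) \<Longrightarrow> g x \<noteq> 0 \<Longrightarrow>
    pd (\<lambda>y. f y / g y) x u = pd f x u / g x - f x * pd g x u / (g x)\<^sup>2"
  unfolding frechet_derivative_works
  by (rule fun_cong[OF pd_eqI], rule derivative_eq_intros, assumption+)
     (auto simp: fun_eq_iff field_simps power2_eq_square)

lemma pd_sum:
  assumes "\<And>i. i \<in> I \<Longrightarrow> f i differentiable (at x)"
  shows "pd (\<lambda>y. \<Sum>i\<in>I. f i y) x u = (\<Sum>i\<in>I. pd (f i) x u)"
  using assms unfolding frechet_derivative_works
  by (intro fun_cong[OF pd_eqI] has_derivative_sum)

lemma pd_linear_comp: "bounded_linear l \<Longrightarrow> f differentiable (at x) \<Longrightarrow>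
    pd (\<lambda>y. l (f y)) x u = l (pd f x u)"
  unfolding frechet_derivative_works
  by (rule fun_cong[OF pd_eqI]) (rule bounded_linear.has_derivative)

lemma has_real_derivative_along_line:
  fixes k :: "'a::real_normed_vector \<Rightarrow> real"
  assumes "k differentiable (at (z + s *\<^sub>R u))"
  shows "((\<lambda>s. k (z + s *\<^sub>R u)) has_real_derivative pd k (z + s *\<^sub>R u) u) (at s)"
proof -
  have "(k has_derivative pd k (z + s *\<^sub>R u)) (at (z + s *\<^sub>R u))"
    using assms frechet_derivative_works by blast
  then have "((\<lambda>s. k (z + s *\<^sub>R u)) has_derivative (\<lambda>a. pd k (z + s *\<^sub>R u) (a *\<^sub>R u))) (at s)"
    by (rule has_derivative_compose[rotated]) (auto intro!: derivative_eq_intros)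
  then show ?thesis using linear_frechet_derivative[OF assms]
    by (simp add: has_field_derivative_def linear_cmul mult_commute_abs)
qed

text \<open>The second difference of f along u and v does not depend on their order, and the mean value
  theorem, applied twice, turns it into either mixed derivative at a nearby point.\<close>

lemma clairaut_real:
  fixes f :: "'a::real_normed_vector \<Rightarrow> real"
  assumes S: "open S" "x \<in> S" and f: "smooth_on S f"
  shows "pd (\<lambda>y. pd f y u) x v = pd (\<lambda>y. pd f y v) x u"
proof -
  define F where "F u v y = pd (\<lambda>y. pd f y u) y v" for u v y
  obtain r where r: "r > 0" "ball x r \<subseteq> S" using S open_contains_ball by blast
  define d where "d = r / (norm u + norm v + 1)"
  have d: "d > 0" using r unfolding d_def by (simp add: add_nonneg_pos)
  have inS: "x + s *\<^sub>R u + t *\<^sub>R v \<in> S" if "0 \<le> s" "s < d" "0 \<le> t" "t < d" for s t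
  proof -
    have "norm (s *\<^sub>R u + t *\<^sub>R v) \<le> s * norm u + t * norm v"
      using norm_triangle_ineq[of "s *\<^sub>R u" "t *\<^sub>R v"] that by simp
    also have "\<dots> \<le> d * norm u + d * norm v"
      using that by (intro add_mono mult_right_mono) auto
    also have "\<dots> < d * (norm u + norm v + 1)" using d by (simp add: algebra_simps)
    also have "\<dots> = r" unfolding d_def
      by (smt (verit) norm_ge_zero nonzero_eq_divide_eq)
    finally have "x + (s *\<^sub>R u + t *\<^sub>R v) \<in> ball x r"
      by (metis add_diff_cancel_left' dist_commute dist_norm mem_ball)
    then show ?thesis using r by (auto simp: add.assoc)
  qed
  have mvt: "\<exists>s t. 0 \<le> s \<and> s \<le> h \<and> 0 \<le> t \<and> t \<le> h \<and>
      f (x + h *\<^sub>R u' + h *\<^sub>R v') - f (x + h *\<^sub>R u') - (f (x + h *\<^sub>R v') - f x)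
        = h * h * F u' v' (x + s *\<^sub>R u' + t *\<^sub>R v')"
    if h: "0 < h" "h < d"
      and inS: "\<And>s t. 0 \<le> s \<Longrightarrow> s < d \<Longrightarrow> 0 \<le> t \<Longrightarrow> t < d \<Longrightarrow> x + s *\<^sub>R u' + t *\<^sub>R v' \<in> S"
    for h u' v'
  proof -
    define p where "p s = f (x + s *\<^sub>R u' + h *\<^sub>R v') - f (x + s *\<^sub>R u')" for s
    have diff: "k differentiable (at (x + s *\<^sub>R u' + t *\<^sub>R v'))"
      if "smooth_on S k" "0 \<le> s" "s \<le> h" "0 \<le> t" "t \<le> h" for s t and k :: "'a \<Rightarrow> real"
      using that h by (intro smooth_on_differentiable[of S] inS) auto
    have d2: "((\<lambda>t. k (x + s *\<^sub>R u' + t *\<^sub>R v')) has_real_derivative pd k (x + s *\<^sub>R u' + t *\<^sub>R v') v') (at t)"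
      if "smooth_on S k" "0 \<le> s" "s \<le> h" "0 \<le> t" "t \<le> h" for s t and k :: "'a \<Rightarrow> real"
      by (rule has_real_derivative_along_line[OF diff[OF that]])
    have d1: "((\<lambda>s. k (x + s *\<^sub>R u' + t *\<^sub>R v')) has_real_derivative pd k (x + s *\<^sub>R u' + t *\<^sub>R v') u') (at s)"
      if "smooth_on S k" "0 \<le> s" "s \<le> h" "0 \<le> t" "t \<le> h" for s t and k :: "'a \<Rightarrow> real"
    proof -
      have e: "x + s *\<^sub>R u' + t *\<^sub>R v' = (x + t *\<^sub>R v') + s *\<^sub>R u'" for s by (simp add: add.commute add.left_commute)
      show ?thesis using diff[OF that] unfolding e by (rule has_real_derivative_along_line)
    qed
    have "\<exists>s>0. s < h \<and> p h - p 0 =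
        (h - 0) * (pd f (x + s *\<^sub>R u' + h *\<^sub>R v') u' - pd f (x + s *\<^sub>R u') u')"
    proof (rule MVT2)
      show "(p has_real_derivative (pd f (x + s *\<^sub>R u' + h *\<^sub>R v') u' - pd f (x + s *\<^sub>R u') u')) (at s)"
        if "0 \<le> s" "s \<le> h" for s
        unfolding p_def using d1[OF f that, of h] d1[OF f that, of 0] h
        by (auto intro!: derivative_intros)
    qed (use h in auto)
    then obtain s where s: "0 < s" "s < h" "p h - p 0 =
        (h - 0) * (pd f (x + s *\<^sub>R u' + h *\<^sub>R v') u' - pd f (x + s *\<^sub>R u' + 0 *\<^sub>R v') u')"
      by auto
    have "\<exists>t>0. t < h \<and> pd f (x + s *\<^sub>R u' + h *\<^sub>R v') u' - pd f (x + s *\<^sub>R u' + 0 *\<^sub>R v') u' =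
        (h - 0) * F u' v' (x + s *\<^sub>R u' + t *\<^sub>R v')"
      unfolding F_def using d2[OF smooth_on_pd[OF f]] s h by (intro MVT2) auto
    then obtain t where t: "0 < t" "t < h"
      "pd f (x + s *\<^sub>R u' + h *\<^sub>R v') u' - pd f (x + s *\<^sub>R u' + 0 *\<^sub>R v') u' =
        (h - 0) * F u' v' (x + s *\<^sub>R u' + t *\<^sub>R v')" by blast
    show ?thesis using s t unfolding p_def
      by (intro exI[of _ s] exI[of _ t]) (auto simp: add.commute add.left_commute)
  qed
  have cont: "isCont (F u' v') x" for u' v'
    unfolding F_def using smooth_on_continuous[OF smooth_on_pd[OF smooth_on_pd[OF f]]] S
    by (simp add: continuous_on_eq_continuous_at)
  show ?thesis
  proof (rule ccontr)
    assume ne: "\<not> ?thesis"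
    define e where "e = \<bar>F u v x - F v u x\<bar> / 2"
    have e: "e > 0" using ne unfolding e_def F_def by (simp only: half_gt_zero_iff zero_less_abs_iff right_minus_eq not_False_eq_True)
    obtain d1 where d1: "d1 > 0" "\<And>y. dist y x < d1 \<Longrightarrow> dist (F u v y) (F u v x) < e"
      using cont[of u v] e unfolding continuous_at_eps_delta by blast
    obtain d2 where d2: "d2 > 0" "\<And>y. dist y x < d2 \<Longrightarrow> dist (F v u y) (F v u x) < e"
      using cont[of v u] e unfolding continuous_at_eps_delta by blast
    define q where "q = min d1 d2"
    define h where "h = min (d/2) (q / (2 * (norm u + norm v + 1)))"
    have n1: "norm u + norm v + 1 > 0" by (simp add: add_nonneg_pos)
    have half: "q / (2 * N) * N = q / 2" if "N > 0" for N using that by simp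
    have q: "q > 0" using d1 d2 unfolding q_def by auto
    have h: "0 < h" "h < d" using d q n1 unfolding h_def by auto
    have near: "norm (s *\<^sub>R u + t *\<^sub>R v) < q" if "0 \<le> s" "s \<le> h" "0 \<le> t" "t \<le> h" for s t
    proof -
      have "norm (s *\<^sub>R u + t *\<^sub>R v) \<le> s * norm u + t * norm v"
        using norm_triangle_ineq[of "s *\<^sub>R u" "t *\<^sub>R v"] that by simp
      also have "\<dots> \<le> h * norm u + h * norm v"
        using that by (intro add_mono mult_right_mono) auto
      also have "\<dots> \<le> h * (norm u + norm v + 1)" using h by (simp add: algebra_simps)
      also have "\<dots> \<le> q / (2 * (norm u + norm v + 1)) * (norm u + norm v + 1)"
        using n1 by (intro mult_right_mono) (auto simp: h_def)
      also have "\<dots> = q / 2" using half[OF n1] .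
      also have "\<dots> < q" using q by simp
      finally show ?thesis .
    qed
    obtain s t where 1: "0 \<le> s" "s \<le> h" "0 \<le> t" "t \<le> h"
      "f (x + h *\<^sub>R u + h *\<^sub>R v) - f (x + h *\<^sub>R u) - (f (x + h *\<^sub>R v) - f x)
        = h * h * F u v (x + s *\<^sub>R u + t *\<^sub>R v)" using mvt[of h u v, OF h inS] by blast
    have "x + s *\<^sub>R v + t *\<^sub>R u \<in> S" if "0 \<le> s" "s < d" "0 \<le> t" "t < d" for s t
      using inS[of t s] that by (simp add: algebra_simps)
    then obtain s' t' where 2: "0 \<le> s'" "s' \<le> h" "0 \<le> t'" "t' \<le> h"
      "f (x + h *\<^sub>R v + h *\<^sub>R u) - f (x + h *\<^sub>R v) - (f (x + h *\<^sub>R u) - f x)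
        = h * h * F v u (x + s' *\<^sub>R v + t' *\<^sub>R u)" using mvt[of h v u, OF h] by blast
    have "h * h * F u v (x + s *\<^sub>R u + t *\<^sub>R v) = h * h * F v u (x + s' *\<^sub>R v + t' *\<^sub>R u)"
      using 1(5) 2(5) by (simp add: algebra_simps)
    then have "F u v (x + s *\<^sub>R u + t *\<^sub>R v) = F v u (x + s' *\<^sub>R v + t' *\<^sub>R u)" using h by simp
    moreover have "dist (F u v (x + s *\<^sub>R u + t *\<^sub>R v)) (F u v x) < e"
      using near[OF 1(1-4)] by (intro d1) (auto simp: dist_norm q_def add.assoc)
    moreover have "dist (F v u (x + s' *\<^sub>R v + t' *\<^sub>R u)) (F v u x) < e"
      using near[OF 2(3,4,1,2)] by (intro d2) (auto simp: dist_norm q_def algebra_simps)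
    ultimately show False unfolding e_def dist_real_def by (auto simp: abs_if split: if_splits)
  qed
qed

lemma clairaut:
  fixes f :: "'a::real_normed_vector \<Rightarrow> 'b::euclidean_space"
  assumes S: "open S" "x \<in> S" and f: "smooth_on S f"
  shows "pd (\<lambda>y. pd f y u) x v = pd (\<lambda>y. pd f y v) x u"
proof (rule euclidean_eqI)
  fix b :: 'b assume "b \<in> Basis"
  have sm: "smooth_on S (\<lambda>y. h y \<bullet> b)" if "smooth_on S h" for h :: "'a \<Rightarrow> 'b"
    using that S by (intro smooth_intros)
  have 1: "pd (\<lambda>y. h y \<bullet> b) y w = pd h y w \<bullet> b" if "smooth_on S h" "y \<in> S" for h :: "'a \<Rightarrow> 'b" and y w
    using that by (intro pd_linear_comp bounded_linear_inner_left smooth_on_differentiable)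
  have 2: "pd (\<lambda>y. pd f y u) x v \<bullet> b = pd (\<lambda>y. pd (\<lambda>z. f z \<bullet> b) y u) x v" for u v
    using pd_cong[OF S, of "\<lambda>y. pd (\<lambda>z. f z \<bullet> b) y u" "\<lambda>y. pd f y u \<bullet> b"] 1[OF f]
      1[OF smooth_on_pd[OF f] S(2)] by simp
  show "pd (\<lambda>y. pd f y u) x v \<bullet> b = pd (\<lambda>y. pd f y v) x u \<bullet> b"
    unfolding 2 by (rule clairaut_real[OF S sm[OF f]])
qed

section \<open>Linear and bilinear fields\<close>

text \<open>Since a vector of the model space doubles as a constant vector field, a tensor field in a chart is
  smooth when its values on fixed vectors are.\<close>

definition linear_field ::
  "'e::euclidean_space set \<Rightarrow> ('e \<Rightarrow> 'v::euclidean_space \<Rightarrow> 'b::real_normed_vector) \<Rightarrow> bool" where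
  "linear_field S L \<longleftrightarrow> (\<forall>x\<in>S. linear (L x)) \<and> (\<forall>w. smooth_on S (\<lambda>x. L x w))"

definition bilinear_field ::
  "'e::euclidean_space set \<Rightarrow> ('e \<Rightarrow> 'v::euclidean_space \<Rightarrow> 'v \<Rightarrow> 'b::real_normed_vector) \<Rightarrow> bool" where
  "bilinear_field S B \<longleftrightarrow> (\<forall>x\<in>S. bilinear (B x)) \<and> (\<forall>v w. smooth_on S (\<lambda>x. B x v w))"

lemma linear_expand:
  fixes w :: "'v::euclidean_space"
  assumes "linear l"
  shows "l w = (\<Sum>b\<in>Basis. (w \<bullet> b) *\<^sub>R l b)"
  by (subst euclidean_representation[of w, symmetric])
     (simp add: linear_sum[OF assms] linear_cmul[OF assms])

lemma linear_field_linear: "linear_field S L \<Longrightarrow> x \<in> S \<Longrightarrow> linear (L x)"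
  and linear_field_smooth: "linear_field S L \<Longrightarrow> smooth_on S (\<lambda>x. L x w)"
  by (auto simp: linear_field_def)

lemma bilinear_field_bilinear: "bilinear_field S B \<Longrightarrow> x \<in> S \<Longrightarrow> bilinear (B x)"
  and bilinear_field_smooth: "bilinear_field S B \<Longrightarrow> smooth_on S (\<lambda>x. B x v w)"
  by (auto simp: bilinear_field_def)

text \<open>Expanding the argument in the standard basis reduces a field applied to a variable vector to
  finitely many products; the Leibniz rule below has the same proof.\<close>

lemma smooth_on_apply:
  assumes S: "open S" and L: "linear_field S L" and X: "smooth_on S X"
  shows "smooth_on S (\<lambda>x. L x (X x))"
proof (rule smooth_on_cong[OF S])
  show "smooth_on S (\<lambda>x. \<Sum>b\<in>Basis. (X x \<bullet> b) *\<^sub>R L x b)"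
    by (intro smooth_on_sum smooth_on_scaleR smooth_on_inner S X smooth_on_const
        linear_field_smooth[OF L])
  show "(\<Sum>b\<in>Basis. (X x \<bullet> b) *\<^sub>R L x b) = L x (X x)" if "x \<in> S" for x
    by (rule linear_expand[OF linear_field_linear[OF L that], symmetric])
qed

lemma pd_linear_field:
  assumes S: "open S" "x \<in> S" and L: "linear_field S L"
  shows "pd (\<lambda>y. L y w) x u = (\<Sum>b\<in>Basis. (w \<bullet> b) *\<^sub>R pd (\<lambda>y. L y b) x u)"
proof -
  note d = smooth_on_differentiable[OF linear_field_smooth[OF L] S(2)]
  have "pd (\<lambda>y. L y w) x u = pd (\<lambda>y. \<Sum>b\<in>Basis. (w \<bullet> b) *\<^sub>R L y b) x u"
    by (rule fun_cong[OF pd_cong[OF S]]) (rule linear_expand[OF linear_field_linear[OF L]])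
  also have "\<dots> = (\<Sum>b\<in>Basis. pd (\<lambda>y. (w \<bullet> b) *\<^sub>R L y b) x u)"
    by (rule pd_sum) (intro differentiable_scaleR differentiable_const d)
  also have "\<dots> = (\<Sum>b\<in>Basis. (w \<bullet> b) *\<^sub>R pd (\<lambda>y. L y b) x u)"
    by (intro sum.cong refl pd_linear_comp bounded_linear_scaleR_right d)
  finally show ?thesis .
qed

lemma pd_apply:
  fixes L :: "'e::euclidean_space \<Rightarrow> 'v::euclidean_space \<Rightarrow> 'b::real_normed_vector"
  assumes S: "open S" "x \<in> S" and L: "linear_field S L" and X: "smooth_on S X"
  shows "pd (\<lambda>y. L y (X y)) x u = pd (\<lambda>y. L y (X x)) x u + L x (pd X x u)"
proof -
  note d = smooth_on_differentiable[OF linear_field_smooth[OF L] S(2)]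
  note dX = smooth_on_differentiable[OF X S(2)]
  have dXb: "(\<lambda>y. X y \<bullet> b) differentiable (at x)" for b
    by (intro differentiable_inner dX differentiable_const)
  have "pd (\<lambda>y. L y (X y)) x u = pd (\<lambda>y. \<Sum>b\<in>Basis. (X y \<bullet> b) *\<^sub>R L y b) x u"
    by (rule fun_cong[OF pd_cong[OF S]]) (rule linear_expand[OF linear_field_linear[OF L]])
  also have "\<dots> = (\<Sum>b\<in>Basis. pd (\<lambda>y. (X y \<bullet> b) *\<^sub>R L y b) x u)"
    by (rule pd_sum) (intro differentiable_scaleR dXb d)
  also have "\<dots> = (\<Sum>b\<in>Basis. (X x \<bullet> b) *\<^sub>R pd (\<lambda>y. L y b) x u + (pd X x u \<bullet> b) *\<^sub>R L x b)"
  proof (intro sum.cong refl)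
    fix b :: 'v
    have "pd (\<lambda>y. X y \<bullet> b) x u = pd X x u \<bullet> b"
      by (intro pd_linear_comp bounded_linear_inner_left dX)
    then show "pd (\<lambda>y. (X y \<bullet> b) *\<^sub>R L y b) x u
        = (X x \<bullet> b) *\<^sub>R pd (\<lambda>y. L y b) x u + (pd X x u \<bullet> b) *\<^sub>R L x b"
      by (simp add: pd_scaleR[OF dXb d])
  qed
  also have "\<dots> = pd (\<lambda>y. L y (X x)) x u + L x (pd X x u)"
    using pd_linear_field[OF S L, of "X x" u] linear_expand[OF linear_field_linear[OF L S(2)], of "pd X x u"]
    by (simp add: sum.distrib)
  finally show ?thesis .
qed

lemma linear_field_pd:
  assumes S: "open S" and L: "linear_field S L"
  shows "linear_field S (\<lambda>x w. pd (\<lambda>y. L y w) x u)"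
  unfolding linear_field_def
proof (intro conjI ballI allI smooth_on_pd linear_field_smooth[OF L])
  fix x assume x: "x \<in> S"
  have "(\<lambda>w. pd (\<lambda>y. L y w) x u) = (\<lambda>w. \<Sum>b\<in>Basis. (w \<bullet> b) *\<^sub>R pd (\<lambda>y. L y b) x u)"
    by (rule ext) (rule pd_linear_field[OF S x L])
  moreover have "linear (\<lambda>w. \<Sum>b\<in>Basis. (w \<bullet> b) *\<^sub>R pd (\<lambda>y. L y b) x u)"
    by (rule linearI) (simp_all add: inner_add_left scaleR_add_left sum.distrib scaleR_sum_right)
  ultimately show "linear (\<lambda>w. pd (\<lambda>y. L y w) x u)" by simp
qed

lemma bilinear_field_left: "bilinear_field S B \<Longrightarrow> linear_field S (\<lambda>x v. B x v w)"
  and bilinear_field_right: "bilinear_field S B \<Longrightarrow> linear_field S (\<lambda>x w. B x v w)"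
  by (auto simp: bilinear_field_def linear_field_def bilinear_def)

lemma bilinear_field_apply_left:
  "open S \<Longrightarrow> bilinear_field S B \<Longrightarrow> smooth_on S X \<Longrightarrow> linear_field S (\<lambda>x w. B x (X x) w)"
  using smooth_on_apply[OF _ bilinear_field_left]
  by (auto simp: linear_field_def bilinear_field_def bilinear_def)

lemma smooth_on_apply2:
  "open S \<Longrightarrow> bilinear_field S B \<Longrightarrow> smooth_on S X \<Longrightarrow> smooth_on S Y \<Longrightarrow>
    smooth_on S (\<lambda>x. B x (X x) (Y x))"
  by (rule smooth_on_apply[OF _ bilinear_field_apply_left])

lemma pd_apply2:
  assumes S: "open S" "x \<in> S" and B: "bilinear_field S B" and X: "smooth_on S X" "smooth_on S Y"
  shows "pd (\<lambda>y. B y (X y) (Y y)) x u =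
    pd (\<lambda>y. B y (X x) (Y x)) x u + B x (pd X x u) (Y x) + B x (X x) (pd Y x u)"
  using pd_apply[OF S bilinear_field_apply_left[OF S(1) B X(1)] X(2), of u]
    pd_apply[OF S bilinear_field_left[OF B] X(1), of "Y x" u] by simp

lemma bilinear_pd_bilinear_field:
  assumes "open S" "x \<in> S" "bilinear_field S B"
  shows "bilinear (\<lambda>v w. pd (\<lambda>y. B y v w) x u)"
  using linear_field_linear[OF linear_field_pd[OF assms(1) bilinear_field_left[OF assms(3)]] assms(2)]
    linear_field_linear[OF linear_field_pd[OF assms(1) bilinear_field_right[OF assms(3)]] assms(2)]
  by (auto simp: bilinear_def)

lemma bilinear_field_pd:
  assumes S: "open S" and L: "linear_field S L"
  shows "bilinear_field S (\<lambda>x a b. pd (\<lambda>y. L y b) x a)"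
  unfolding bilinear_field_def bilinear_def
  using linear_pd[OF linear_field_smooth[OF L]] linear_field_linear[OF linear_field_pd[OF S L]]
    smooth_on_pd[OF linear_field_smooth[OF L]] by blast

section \<open>Raising an index\<close>

lemma inner_product_formD:
  assumes "inner_product_form h"
  shows "bilinear h" "h u v = h v u" "u \<noteq> 0 \<Longrightarrow> h u u > 0"
    "h (u + u') v = h u v + h u' v" "h u (v + v') = h u v + h u v'"
    "h (u - u') v = h u v - h u' v" "h u (v - v') = h u v - h u v'"
    "h (- u) v = - h u v" "h u (- v) = - h u v"
    "h (r *\<^sub>R u) v = r * h u v" "h u (r *\<^sub>R v) = r * h u v" "h 0 v = 0" "h u 0 = 0"
  using assms unfolding inner_product_form_def
  by (auto simp: bilinear_ladd bilinear_radd bilinear_lsub bilinear_rsub bilinear_lneg bilinear_rneg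
      bilinear_lmul bilinear_rmul bilinear_lzero bilinear_rzero)

lemma inner_product_form_eqI:
  assumes "inner_product_form h" "\<And>v. h u v = h u' v"
  shows "u = u'"
  using inner_product_formD(3)[OF assms(1), of "u - u'"] assms(2)[of "u - u'"]
    inner_product_formD(6)[OF assms(1)] by force

lemma sharp_vector_exists:
  fixes h :: "'e::euclidean_space \<Rightarrow> 'e \<Rightarrow> real"
  assumes h: "inner_product_form h" and \<alpha>: "linear \<alpha>"
  shows "\<exists>!u. flat_form h u = \<alpha>"
proof -
  note H = inner_product_formD[OF h]
  define G where "G u = (\<Sum>b\<in>Basis. h u b *\<^sub>R b)" for u
  have "linear G" unfolding G_def
    by (rule linearI) (simp_all add: H scaleR_add_left sum.distrib scaleR_sum_right)
  moreover have Gb: "G u \<bullet> b = h u b" if "b \<in> Basis" for u b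
    using that unfolding G_def by (simp add: inner_sum_left_Basis)
  have Gv: "G u \<bullet> v = h u v" for u v
    using linear_expand[of "\<lambda>v. h u v" v] linear_expand[of "\<lambda>v. G u \<bullet> v" v] Gb H(1)
    by (simp add: bilinear_def bounded_linear.linear[OF bounded_linear_inner_right])
  have "inj G"
  proof (rule injI)
    fix u u' assume "G u = G u'"
    then show "u = u'" using Gv by (intro inner_product_form_eqI[OF h]) metis
  qed
  ultimately have "surj G" using linear_injective_imp_surjective by blast
  then obtain u where u: "G u = (\<Sum>b\<in>Basis. \<alpha> b *\<^sub>R b)" by (metis surjD)
  have "h u v = \<alpha> v" for v
    using Gv[of u v, symmetric] linear_expand[OF \<alpha>, of v] unfolding u
    by (simp add: inner_sum_left inner_commute[of v] mult.commute)
  then have "flat_form h u = \<alpha>" unfolding flat_form_def by auto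
  moreover have "u' = u" if "flat_form h u' = \<alpha>" for u'
    using that \<open>flat_form h u = \<alpha>\<close> unfolding flat_form_def
    by (intro inner_product_form_eqI[OF h]) metis
  ultimately show ?thesis by blast
qed

lemma sharp_vector_eq:
  assumes "inner_product_form h" "linear \<alpha>"
  shows "h (sharp_vector h \<alpha>) v = \<alpha> v"
  using theI'[OF sharp_vector_exists[OF assms]]
  unfolding sharp_vector_def flat_form_def by metis

lemma sharp_vector_unique:
  assumes "inner_product_form h" "\<And>v. h u v = \<alpha> v"
  shows "sharp_vector h \<alpha> = u"
proof -
  have "linear \<alpha>" using inner_product_formD(5,11)[OF assms(1), of u] by (intro linearI) (auto simp: assms(2)[symmetric])
  then show ?thesis using sharp_vector_eq[OF assms(1)] assms(2)
    by (intro inner_product_form_eqI[OF assms(1)]) metis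
qed

text \<open>The minimum of the quadratic form on the unit sphere is positive by compactness.\<close>

lemma inner_product_form_coercive:
  fixes h :: "'e::euclidean_space \<Rightarrow> 'e \<Rightarrow> real"
  assumes h: "inner_product_form h"
  obtains c where "c > 0" "\<And>u. h u u \<ge> c * (norm u)\<^sup>2"
proof -
  note H = inner_product_formD[OF h]
  have bb: "bounded_bilinear h" using H(1) bilinear_conv_bounded_bilinear by blast
  have "continuous_on (sphere 0 1) (\<lambda>u. h u u)"
    by (intro bounded_bilinear.continuous_on[OF bb] continuous_intros)
  moreover have "sphere (0::'e) 1 \<noteq> {}"
  proof -
    obtain b :: 'e where "b \<in> Basis" using nonempty_Basis by blast
    then have "b \<in> sphere 0 1" by simp
    then show ?thesis by blast
  qed
  ultimately obtain u0 where u0: "u0 \<in> sphere 0 1" "\<And>u. u \<in> sphere 0 1 \<Longrightarrow> h u0 u0 \<le> h u u"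
    using continuous_attains_inf[OF compact_sphere, of 0 1 "\<lambda>u. h u u"] by blast
  show ?thesis
  proof
    show "h u0 u0 > 0" using u0(1) by (intro H) auto
    fix u show "h u0 u0 * (norm u)\<^sup>2 \<le> h u u"
    proof (cases "u = 0")
      case False
      have "h u0 u0 \<le> h ((1 / norm u) *\<^sub>R u) ((1 / norm u) *\<^sub>R u)" using False by (intro u0) simp
      also have "\<dots> = h u u / (norm u)\<^sup>2" by (simp add: H power2_eq_square)
      finally show ?thesis using False by (simp add: field_simps)
    qed (simp add: H)
  qed
qed

text \<open>A factor that is merely continuous does not spoil differentiability at a zero of the other
  factor. This is what gives the derivative of a solution of a linear system from its continuity.\<close>

lemma differentiable_continuous_mult_zero:
  fixes k f :: "'a::real_normed_vector \<Rightarrow> real"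
  assumes k: "isCont k x" and f: "f differentiable (at x)" and 0: "f x = 0"
  shows "(\<lambda>y. k y * f y) differentiable (at x)"
    and "pd (\<lambda>y. k y * f y) x u = k x * pd f x u"
proof -
  define f' where "f' = pd f x"
  have f': "(f has_derivative f') (at x)" using f frechet_derivative_works f'_def by blast
  have bl: "bounded_linear f'" using f' has_derivative_bounded_linear by blast
  obtain B where B: "B > 0" "\<And>v. norm (f' v) \<le> norm v * B" using bounded_linear.pos_bounded[OF bl] by blast
  obtain d1 where d1: "d1 > 0" "\<And>y. norm (y - x) < d1 \<Longrightarrow> norm (f y - f x - f' (y - x)) \<le> 1 * norm (y - x)"
    using f'[unfolded has_derivative_at_alt, THEN conjunct2, rule_format, of 1] by auto
  have fb: "\<bar>f y\<bar> \<le> (B + 1) * norm (y - x)" if "norm (y - x) < d1" for y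
    using d1(2)[OF that] B(2)[of "y - x"] 0 by (simp add: algebra_simps)
  have "((\<lambda>y. (k y - k x) * f y) has_derivative (\<lambda>h. 0)) (at x)"
    unfolding has_derivative_at_alt
  proof (intro conjI allI impI bounded_linear_zero)
    fix e :: real assume "e > 0"
    then have "e / (B + 1) > 0" using B by simp
    then obtain d2 where d2: "d2 > 0" "\<And>y. dist y x < d2 \<Longrightarrow> dist (k y) (k x) < e / (B + 1)"
      using k unfolding continuous_at_eps_delta by blast
    show "\<exists>d>0. \<forall>y. norm (y - x) < d \<longrightarrow>
        norm ((k y - k x) * f y - (k x - k x) * f x - 0) \<le> e * norm (y - x)"
    proof (intro exI[of _ "min d1 d2"] conjI allI impI)
      fix y assume y: "norm (y - x) < min d1 d2"
      have "\<bar>k y - k x\<bar> * \<bar>f y\<bar> \<le> e / (B + 1) * ((B + 1) * norm (y - x))"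
        using y d2(2)[of y] fb[of y] B by (intro mult_mono) (auto simp: dist_norm)
      then show "norm ((k y - k x) * f y - (k x - k x) * f x - 0) \<le> e * norm (y - x)"
        using B by (simp add: abs_mult)
    qed (use d1 d2 in auto)
  qed
  from has_derivative_add[OF this has_derivative_mult_right[OF f', of "k x"]]
  have "((\<lambda>y. k y * f y) has_derivative (\<lambda>h. k x * f' h)) (at x)"
    by (simp add: algebra_simps)
  then show "(\<lambda>y. k y * f y) differentiable (at x)" "pd (\<lambda>y. k y * f y) x u = k x * pd f x u"
    by (auto simp: f'_def differentiable_def dest: pd_eqI)
qed

text \<open>Coercivity of the form at the base point bounds the variation of the solution of the linear system
  by the variation of its coefficients.\<close>

lemma sharp_vector_isCont:
  fixes g :: "'e::euclidean_space \<Rightarrow> 'e \<Rightarrow> 'e \<Rightarrow> real"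
  assumes S: "open S" "x0 \<in> S" and ip: "\<And>x. x \<in> S \<Longrightarrow> inner_product_form (g x)"
    and g: "\<And>u v. isCont (\<lambda>x. g x u v) x0"
    and \<alpha>: "\<And>x. x \<in> S \<Longrightarrow> linear (\<alpha> x)" "\<And>w. isCont (\<lambda>x. \<alpha> x w) x0"
  shows "isCont (\<lambda>x. sharp_vector (g x) (\<alpha> x)) x0"
proof -
  define s where "s x = sharp_vector (g x) (\<alpha> x)" for x
  have s: "g x (s x) v = \<alpha> x v" if "x \<in> S" for x v
    unfolding s_def by (rule sharp_vector_eq[OF ip[OF that] \<alpha>(1)[OF that]])
  obtain c where c: "c > 0" "\<And>u. g x0 u u \<ge> c * (norm u)\<^sup>2"
    using inner_product_form_coercive[OF ip[OF S(2)]] by blast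
  define e where "e x = (\<Sum>b\<in>Basis. \<Sum>b'\<in>Basis. \<bar>g x b b' - g x0 b b'\<bar>)" for x
  define a where "a x = (\<Sum>b\<in>Basis. \<bar>\<alpha> x b - \<alpha> x0 b\<bar>)" for x
  have e: "\<bar>g x u v - g x0 u v\<bar> \<le> e x * norm u * norm v" if "x \<in> S" for x u v
  proof -
    have lu: "linear (\<lambda>u. g x u v - g x0 u v)" and lv: "linear (\<lambda>v. g x u v - g x0 u v)" for u v
      using inner_product_formD(1)[OF ip[OF that]] inner_product_formD(1)[OF ip[OF S(2)]]
      by (auto simp: bilinear_def intro: linear_compose_sub)
    have "g x u v - g x0 u v = (\<Sum>b\<in>Basis. (u \<bullet> b) * (g x b v - g x0 b v))"
      using linear_expand[OF lu, of u v] by simp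
    also have "\<dots> = (\<Sum>b\<in>Basis. (u \<bullet> b) * (\<Sum>b'\<in>Basis. (v \<bullet> b') * (g x b b' - g x0 b b')))"
    proof (intro sum.cong refl arg_cong2[where f = "(*)"])
      fix b :: 'e
      show "g x b v - g x0 b v = (\<Sum>b'\<in>Basis. (v \<bullet> b') * (g x b b' - g x0 b b'))"
        using linear_expand[OF lv, of b v] by simp
    qed
    also have "\<bar>\<dots>\<bar> \<le> (\<Sum>b\<in>Basis. norm u * (\<Sum>b'\<in>Basis. norm v * \<bar>g x b b' - g x0 b b'\<bar>))"
      by (intro order_trans[OF sum_abs] sum_mono)
        (auto simp: abs_mult intro!: mult_mono Basis_le_norm order_trans[OF sum_abs] sum_mono sum_nonneg)
    also have "\<dots> = e x * norm u * norm v"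
      by (simp add: e_def sum_distrib_left sum_distrib_right mult_ac)
    finally show ?thesis .
  qed
  have a: "\<bar>\<alpha> x v - \<alpha> x0 v\<bar> \<le> a x * norm v" if "x \<in> S" for x v
  proof -
    have "linear (\<lambda>v. \<alpha> x v - \<alpha> x0 v)" using \<alpha>(1) that S(2) by (intro linear_compose_sub) auto
    from linear_expand[OF this, of v]
    have "\<alpha> x v - \<alpha> x0 v = (\<Sum>b\<in>Basis. (v \<bullet> b) * (\<alpha> x b - \<alpha> x0 b))" by simp
    also have "\<bar>\<dots>\<bar> \<le> (\<Sum>b\<in>Basis. norm v * \<bar>\<alpha> x b - \<alpha> x0 b\<bar>)"
      by (intro order_trans[OF sum_abs] sum_mono)
        (auto simp: abs_mult intro!: mult_mono Basis_le_norm)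
    also have "\<dots> = a x * norm v" by (simp add: a_def sum_distrib_left mult_ac)
    finally show ?thesis .
  qed
  have bound: "norm (s x - s x0) \<le> 2 / c * (a x + e x * norm (s x0))" if x: "x \<in> S" "e x \<le> c / 2" for x
  proof -
    define d where "d = s x - s x0"
    note H = inner_product_formD[OF ip[OF S(2)]]
    have e0: "e x \<ge> 0" unfolding e_def by (intro sum_nonneg) auto
    have "c * (norm d)\<^sup>2 \<le> g x0 d d" by (rule c)
    also have "\<dots> = (\<alpha> x d - \<alpha> x0 d) - (g x (s x) d - g x0 (s x) d)"
      using s[OF x(1), of d] s[OF S(2), of d] unfolding d_def by (simp add: H)
    also have "\<dots> \<le> a x * norm d + e x * norm (s x) * norm d"
      using a[OF x(1), of d] e[OF x(1), of "s x" d] by linarith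
    also have "\<dots> = (a x + e x * norm (s x)) * norm d" by (simp add: algebra_simps)
    finally have 1: "c * norm d \<le> a x + e x * norm (s x)"
    proof (cases "d = 0")
      case True
      have "a x \<ge> 0" unfolding a_def by (intro sum_nonneg) auto
      then show ?thesis using True e0 by simp
    next
      case False
      assume "c * (norm d)\<^sup>2 \<le> (a x + e x * norm (s x)) * norm d"
      then have "(c * norm d) * norm d \<le> (a x + e x * norm (s x)) * norm d"
        by (simp add: power2_eq_square mult.assoc)
      then show ?thesis using False by simp
    qed
    have "norm (s x) \<le> norm d + norm (s x0)" unfolding d_def using norm_triangle_sub by (simp add: add.commute)
    then have "e x * norm (s x) \<le> e x * norm d + e x * norm (s x0)"
      using e0 by (metis mult_left_mono distrib_left)
    also have "\<dots> \<le> c / 2 * norm d + e x * norm (s x0)" using mult_right_mono[OF x(2), of "norm d"] by simp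
    finally have "c * norm d \<le> 2 * (a x + e x * norm (s x0))" using 1 by simp
    then show ?thesis using c(1) unfolding d_def by (simp add: field_simps)
  qed
  have "(e \<longlongrightarrow> (\<Sum>b\<in>Basis. \<Sum>b'\<in>Basis. \<bar>g x0 b b' - g x0 b b'\<bar>)) (at x0)"
    "(a \<longlongrightarrow> (\<Sum>b\<in>Basis. \<bar>\<alpha> x0 b - \<alpha> x0 b\<bar>)) (at x0)"
    unfolding e_def a_def using g \<alpha>(2) unfolding isCont_def
    by (intro tendsto_sum tendsto_rabs tendsto_diff tendsto_const; blast)+
  then have e': "(e \<longlongrightarrow> 0) (at x0)" and a': "(a \<longlongrightarrow> 0) (at x0)" by simp_all
  have "\<forall>\<^sub>F x in at x0. e x < c / 2" using c(1) by (intro order_tendstoD(2)[OF e']) simp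
  moreover have "\<forall>\<^sub>F x in at x0. x \<in> S" by (rule eventually_at_in_open'[OF S])
  ultimately have ev: "\<forall>\<^sub>F x in at x0. norm (s x - s x0) \<le> 2 / c * (a x + e x * norm (s x0))"
    by eventually_elim (intro bound less_imp_le)
  have "((\<lambda>x. 2 / c * (a x + e x * norm (s x0))) \<longlongrightarrow> 2 / c * (0 + 0 * norm (s x0))) (at x0)"
    by (intro tendsto_intros e' a')
  then have "((\<lambda>x. s x - s x0) \<longlongrightarrow> 0) (at x0)" using ev by (intro Lim_null_comparison[OF ev]) simp
  then show ?thesis unfolding isCont_def s_def using LIM_zero_iff by blast
qed

text \<open>With respect to the form at the base point, the solution s has the components r below. There s
  itself occurs only as a factor of coefficients that vanish at the base point, so its continuity
  makes r differentiable.\<close>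

lemma sharp_vector_derivative:
  fixes g :: "'e::euclidean_space \<Rightarrow> 'e \<Rightarrow> 'e \<Rightarrow> real"
  assumes S: "open S" "x0 \<in> S" and ip: "\<And>x. x \<in> S \<Longrightarrow> inner_product_form (g x)"
    and g: "\<And>u v. (\<lambda>x. g x u v) differentiable (at x0)"
    and \<alpha>: "\<And>x. x \<in> S \<Longrightarrow> linear (\<alpha> x)" "\<And>w. (\<lambda>x. \<alpha> x w) differentiable (at x0)"
  defines "s \<equiv> \<lambda>x. sharp_vector (g x) (\<alpha> x)"
  shows "s differentiable (at x0)"
    and "g x0 (pd s x0 u) w = pd (\<lambda>x. \<alpha> x w) x0 u - (\<Sum>b\<in>Basis. (s x0 \<bullet> b) * pd (\<lambda>x. g x b w) x0 u)"
proof -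
  have s: "g x (s x) v = \<alpha> x v" if "x \<in> S" for x v
    unfolding s_def by (rule sharp_vector_eq[OF ip[OF that] \<alpha>(1)[OF that]])
  have cont: "isCont s x0"
    unfolding s_def using g \<alpha> by (intro sharp_vector_isCont[OF S ip]) (auto intro: differentiable_imp_continuous_within)
  note H = inner_product_formD[OF ip[OF S(2)]]
  define r where "r w x = \<alpha> x w - (\<Sum>b\<in>Basis. (s x \<bullet> b) * (g x b w - g x0 b w))" for w x
  have r: "g x0 (s x) w = r w x" if "x \<in> S" for x w
  proof -
    have "linear (\<lambda>v. g x v w)" "linear (\<lambda>v. g x0 v w)"
      using inner_product_formD(1)[OF ip] that S(2) unfolding bilinear_def by auto
    from linear_expand[OF linear_compose_sub[OF this], of "s x"] s[OF that, of w]
    show ?thesis unfolding r_def by simp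
  qed
  have sb: "isCont (\<lambda>x. s x \<bullet> b) x0" for b using cont by (intro continuous_intros)
  have gd: "(\<lambda>x. g x b w - g x0 b w) differentiable (at x0)" for b w
    using g by (intro differentiable_diff) auto
  note m = differentiable_continuous_mult_zero[OF sb gd, simplified]
  have rd: "r w differentiable (at x0)" for w
    unfolding r_def by (intro differentiable_diff \<alpha>(2) differentiable_sum ballI m(1)) simp
  have rp: "pd (r w) x0 u = pd (\<lambda>x. \<alpha> x w) x0 u - (\<Sum>b\<in>Basis. (s x0 \<bullet> b) * pd (\<lambda>x. g x b w) x0 u)" for w u
  proof -
    have "pd (r w) x0 u = pd (\<lambda>x. \<alpha> x w) x0 u - (\<Sum>b\<in>Basis. pd (\<lambda>x. (s x \<bullet> b) * (g x b w - g x0 b w)) x0 u)"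
      unfolding r_def using m by (subst pd_diff) (auto intro!: \<alpha>(2) differentiable_sum simp: pd_sum)
    then show ?thesis by (simp add: m pd_diff g)
  qed
  define k where "k b = sharp_vector (g x0) (\<lambda>v. v \<bullet> b)" for b
  have k: "g x0 (k b) v = v \<bullet> b" for b v
    unfolding k_def using bounded_linear.linear[OF bounded_linear_inner_left]
    by (intro sharp_vector_eq[OF ip[OF S(2)]])
  have sr: "s x = (\<Sum>b\<in>Basis. r b x *\<^sub>R k b)" if "x \<in> S" for x
  proof (rule inner_product_form_eqI[OF ip[OF S(2)]])
    fix v
    have lin: "linear (\<lambda>u. g x0 u v)" "linear (\<lambda>v. g x0 (s x) v)" using H(1) unfolding bilinear_def by auto
    show "g x0 (s x) v = g x0 (\<Sum>b\<in>Basis. r b x *\<^sub>R k b) v"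
      using linear_expand[OF lin(2), of v] r[OF that]
      by (simp add: linear_sum[OF lin(1)] linear_cmul[OF lin(1)] k mult.commute)
  qed
  have "(\<lambda>x. \<Sum>b\<in>Basis. r b x *\<^sub>R k b) differentiable (at x0)"
    by (intro differentiable_sum ballI differentiable_scaleR rd differentiable_const) simp
  then obtain D where "((\<lambda>x. \<Sum>b\<in>Basis. r b x *\<^sub>R k b) has_derivative D) (at x0)"
    unfolding differentiable_def by blast
  then have "(s has_derivative D) (at x0)"
    by (rule has_derivative_transform_within_open[OF _ S]) (simp add: sr)
  then show sd: "s differentiable (at x0)" unfolding differentiable_def by blast
  have "bounded_linear (\<lambda>u. g x0 u w)"
    using H(1) unfolding bilinear_def by (auto intro: linear_conv_bounded_linear[THEN iffD1])
  from pd_linear_comp[OF this sd]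
  have "g x0 (pd s x0 u) w = pd (\<lambda>x. g x0 (s x) w) x0 u" by simp
  also have "\<dots> = pd (r w) x0 u" using pd_cong[OF S, of "\<lambda>x. g x0 (s x) w" "r w"] r by simp
  finally show "g x0 (pd s x0 u) w = pd (\<lambda>x. \<alpha> x w) x0 u - (\<Sum>b\<in>Basis. (s x0 \<bullet> b) * pd (\<lambda>x. g x b w) x0 u)"
    using rp by simp
qed

text \<open>The derivative of the solution solves a system with the same coefficients, whose right-hand side
  contains the solution undifferentiated; hence each order of smoothness gives the next.\<close>

lemma Ck_on_sharp_vector:
  fixes g :: "'e::euclidean_space \<Rightarrow> 'e \<Rightarrow> 'e \<Rightarrow> real"
  assumes S: "open S" and ip: "\<And>x. x \<in> S \<Longrightarrow> inner_product_form (g x)"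
    and g: "\<And>u v. smooth_on S (\<lambda>x. g x u v)"
  shows "(\<And>x. x \<in> S \<Longrightarrow> linear (\<alpha> x)) \<Longrightarrow> (\<And>w. Ck_on k S (\<lambda>x. \<alpha> x w)) \<Longrightarrow>
    Ck_on k S (\<lambda>x. sharp_vector (g x) (\<alpha> x))"
proof (induction k arbitrary: \<alpha>)
  case 0
  have "isCont (\<lambda>x. sharp_vector (g x) (\<alpha> x)) x" if "x \<in> S" for x
    using 0 smooth_on_continuous[OF g] that
    by (intro sharp_vector_isCont[OF S]) (auto simp: continuous_on_eq_continuous_at[OF S] ip)
  then show ?case by (simp add: continuous_at_imp_continuous_on)
next
  case (Suc k)
  define s where "s x = sharp_vector (g x) (\<alpha> x)" for x
  have sk: "Ck_on k S s" unfolding s_def[abs_def]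
    by (intro Suc.IH Suc.prems(1) Ck_on_SucD[OF Suc.prems(2)])
  have d: "(\<lambda>x. \<alpha> x w) differentiable (at x)" "(\<lambda>x. g x u v) differentiable (at x)" if "x \<in> S" for x u v w
    using Suc.prems(2) that smooth_on_differentiable[OF g] by auto
  note sd = sharp_vector_derivative[OF S _ ip d(2) Suc.prems(1) d(1), folded s_def]
  define \<beta> where "\<beta> v x w = pd (\<lambda>x. \<alpha> x w) x v + (- 1) * (\<Sum>b\<in>Basis. (s x \<bullet> b) * pd (\<lambda>x. g x b w) x v)" for v x w
  have \<beta>: "g x (pd s x v) w = \<beta> v x w" if "x \<in> S" for x v w
    using sd(2)[of x v w] that unfolding \<beta>_def by simp
  have "Ck_on k S (\<lambda>x. \<beta> v x w)" for v w
  proof -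
    have "Ck_on k S (\<lambda>x. \<Sum>b\<in>B. (s x \<bullet> b) * pd (\<lambda>x. g x b w) x v)" if "finite B" for B
      using that
    proof (induction B)
      case (insert b B)
      have "Ck_on k S (\<lambda>x. pd (\<lambda>x. g x b w) x v)" using smooth_on_pd[OF g] unfolding smooth_on_def by blast
      then have "Ck_on k S (\<lambda>x. (s x \<bullet> b) * pd (\<lambda>x. g x b w) x v)"
        by (intro Ck_on_bilinear[OF S bounded_bilinear_mult] Ck_on_bilinear[OF S bounded_bilinear_inner] sk Ck_on_const)
      then show ?case using insert Ck_on_add[OF S] by simp
    qed (simp add: Ck_on_const)
    then show ?thesis unfolding \<beta>_def using Suc.prems(2)
      by (intro Ck_on_add[OF S] Ck_on_bilinear[OF S bounded_bilinear_mult] Ck_on_const) auto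
  qed
  moreover have "linear (\<beta> v x)" if "x \<in> S" for v x
  proof -
    have "\<beta> v x = (\<lambda>w. g x (pd s x v) w)" using \<beta>[OF that] by auto
    then show ?thesis using inner_product_formD(1)[OF ip[OF that]] by (simp add: bilinear_def)
  qed
  ultimately have sv: "Ck_on k S (\<lambda>x. sharp_vector (g x) (\<beta> v x))" for v by (intro Suc.IH)
  have "Ck_on k S (\<lambda>x. pd s x v)" for v
  proof (rule Ck_on_cong[OF S _ sv[of v]])
    fix x assume "x \<in> S"
    then show "sharp_vector (g x) (\<beta> v x) = pd s x v" by (intro sharp_vector_unique ip \<beta>)
  qed
  then show ?case using sd(1) unfolding s_def[abs_def] by simp
qed

lemma smooth_on_sharp_vector:
  fixes g :: "'e::euclidean_space \<Rightarrow> 'e \<Rightarrow> 'e \<Rightarrow> real"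
  assumes "open S" "\<And>x. x \<in> S \<Longrightarrow> inner_product_form (g x)" "\<And>u v. smooth_on S (\<lambda>x. g x u v)"
    and "linear_field S \<alpha>"
  shows "smooth_on S (\<lambda>x. sharp_vector (g x) (\<alpha> x))"
  unfolding smooth_on_def
  using assms Ck_on_sharp_vector[OF assms(1-3)] by (auto simp: linear_field_def smooth_on_def)

section \<open>Linear differential inequalities\<close>

text \<open>The function \<open>exp (- L t) h t\<close> is nonincreasing.\<close>

lemma gronwall_zero:
  fixes h :: "real \<Rightarrow> real"
  assumes d: "\<And>t. 0 \<le> t \<Longrightarrow> t \<le> 1 \<Longrightarrow> (h has_real_derivative h' t) (at t)"
    and b: "\<And>t. 0 \<le> t \<Longrightarrow> t \<le> 1 \<Longrightarrow> h' t \<le> L * h t"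
    and h: "h 0 = 0" "h 1 \<ge> 0"
  shows "h 1 = 0"
proof -
  have "exp (- L * 1) * h 1 \<le> exp (- L * 0) * h 0"
  proof (rule DERIV_nonpos_imp_nonincreasing[of 0 1])
    fix t :: real assume t: "0 \<le> t" "t \<le> 1"
    have "((\<lambda>t. exp (- L * t) * h t) has_real_derivative exp (- L * t) * (h' t - L * h t)) (at t)"
      by (auto intro!: derivative_eq_intros d t simp: algebra_simps)
    moreover have "exp (- L * t) * (h' t - L * h t) \<le> 0"
      using b[OF t] by (simp add: mult_le_0_iff)
    ultimately show "\<exists>y. ((\<lambda>t. exp (- L * t) * h t) has_real_derivative y) (at t) \<and> y \<le> 0" by blast
  qed simp
  then show ?thesis using h by (simp add: mult_le_0_iff)
qed

text \<open>The Gronwall inequality for the sum of the squares along the segments from a common zero. The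
  lemma serves both for the unique continuation of \<open>\<tau>\<close> and for the propagation of the constants.\<close>

lemma common_zeros_spread:
  fixes \<phi> :: "'i \<Rightarrow> 'e::euclidean_space \<Rightarrow> real"
  assumes I: "finite I" and S: "open S" "x0 \<in> S"
    and d: "\<And>i x. i \<in> I \<Longrightarrow> x \<in> S \<Longrightarrow> \<phi> i differentiable (at x)"
    and k: "\<And>i b. i \<in> I \<Longrightarrow> b \<in> Basis \<Longrightarrow> continuous_on S (k i b)"
    and le: "\<And>i b x. i \<in> I \<Longrightarrow> b \<in> Basis \<Longrightarrow> x \<in> S \<Longrightarrow> \<bar>pd (\<phi> i) x b\<bar> \<le> k i b x * (\<Sum>j\<in>I. \<bar>\<phi> j x\<bar>)"
    and z: "\<And>i. i \<in> I \<Longrightarrow> \<phi> i x0 = 0"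
  obtains r where "r > 0" "ball x0 r \<subseteq> S" "\<And>i y. i \<in> I \<Longrightarrow> y \<in> ball x0 r \<Longrightarrow> \<phi> i y = 0"
proof -
  obtain r where r: "r > 0" "cball x0 r \<subseteq> S" using S open_contains_cball by blast
  have "\<exists>K. \<forall>y\<in>cball x0 r. k i b y \<le> K" if "i \<in> I" "b \<in> Basis" for i b
  proof -
    have "compact (k i b ` cball x0 r)"
      by (intro compact_continuous_image continuous_on_subset[OF k[OF that]] r compact_cball)
    then obtain a where "\<forall>x\<in>k i b ` cball x0 r. \<bar>x\<bar> \<le> a" using compact_imp_bounded bounded_real by metis
    then show ?thesis by (intro exI[of _ a]) (auto dest: abs_le_D1)
  qed
  then obtain K where K: "\<And>i b y. i \<in> I \<Longrightarrow> b \<in> Basis \<Longrightarrow> y \<in> cball x0 r \<Longrightarrow> k i b y \<le> K i b" by metis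
  define C where "C = (\<Sum>i\<in>I. \<Sum>b\<in>Basis. \<bar>K i b\<bar>)"
  have KC: "\<bar>K i b\<bar> \<le> C" if "i \<in> I" "b \<in> Basis" for i b
  proof -
    have "\<bar>K i b\<bar> \<le> (\<Sum>b\<in>Basis. \<bar>K i b\<bar>)" using that by (intro member_le_sum) auto
    also have "\<dots> \<le> C" unfolding C_def
      by (rule member_le_sum[of i I "\<lambda>i. \<Sum>b\<in>Basis. \<bar>K i b\<bar>"]) (use that I in \<open>auto intro: sum_nonneg\<close>)
    finally show ?thesis .
  qed
  have C0: "C \<ge> 0" unfolding C_def by (intro sum_nonneg) auto
  define M where "M x = (\<Sum>j\<in>I. \<bar>\<phi> j x\<bar>)" for x
  have M0: "M x \<ge> 0" for x unfolding M_def by (intro sum_nonneg) auto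
  show ?thesis
  proof
    show "r > 0" "ball x0 r \<subseteq> S" using r by auto
    fix i y assume i: "i \<in> I" and y: "y \<in> ball x0 r"
    define u where "u = y - x0"
    define n where "n = (\<Sum>b\<in>Basis. \<bar>u \<bullet> b\<bar>)"
    have n0: "n \<ge> 0" unfolding n_def by (intro sum_nonneg) auto
    have seg: "x0 + t *\<^sub>R u \<in> cball x0 r" if "0 \<le> t" "t \<le> 1" for t
    proof -
      have "norm (t *\<^sub>R u) \<le> 1 * norm u" using that by (simp add: mult_left_le_one_le)
      also have "\<dots> \<le> r" using y by (simp add: u_def dist_norm norm_minus_commute)
      finally show ?thesis by (simp add: dist_norm)
    qed
    define h where "h t = (\<Sum>j\<in>I. (\<phi> j (x0 + t *\<^sub>R u))\<^sup>2)" for t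
    define h' where "h' t = (\<Sum>j\<in>I. 2 * \<phi> j (x0 + t *\<^sub>R u) * pd (\<phi> j) (x0 + t *\<^sub>R u) u)" for t
    have "h 1 = 0"
    proof (rule gronwall_zero)
      fix t :: real assume t: "0 \<le> t" "t \<le> 1"
      let ?x = "x0 + t *\<^sub>R u"
      have x: "?x \<in> S" using seg[OF t] r by blast
      have "((\<lambda>t. \<phi> j (x0 + t *\<^sub>R u)) has_real_derivative pd (\<phi> j) ?x u) (at t)" if "j \<in> I" for j
        by (rule has_real_derivative_along_line[OF d[OF that x]])
      then show "(h has_real_derivative h' t) (at t)"
        unfolding h_def h'_def by (auto intro!: derivative_eq_intros simp: algebra_simps)
      have p: "\<bar>pd (\<phi> j) ?x u\<bar> \<le> n * (C * M ?x)" if j: "j \<in> I" for j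
      proof -
        have "pd (\<phi> j) ?x u = (\<Sum>b\<in>Basis. (u \<bullet> b) * pd (\<phi> j) ?x b)"
          using linear_expand[OF linear_frechet_derivative[OF d[OF j x]], of u] by simp
        also have "\<bar>\<dots>\<bar> \<le> (\<Sum>b\<in>Basis. \<bar>u \<bullet> b\<bar> * (C * M ?x))"
        proof (intro order_trans[OF sum_abs] sum_mono)
          fix b :: 'e assume b: "b \<in> Basis"
          have "\<bar>pd (\<phi> j) ?x b\<bar> \<le> k j b ?x * M ?x" using le[OF j b x] unfolding M_def .
          also have "\<dots> \<le> C * M ?x"
            using K[OF j b seg[OF t]] KC[OF j b] M0 by (intro mult_right_mono) auto
          finally show "\<bar>(u \<bullet> b) * pd (\<phi> j) ?x b\<bar> \<le> \<bar>u \<bullet> b\<bar> * (C * M ?x)"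
            by (simp add: abs_mult mult_left_mono)
        qed
        finally show ?thesis unfolding n_def by (simp add: sum_distrib_right)
      qed
      have "h' t \<le> (\<Sum>j\<in>I. 2 * \<bar>\<phi> j ?x\<bar> * (n * (C * M ?x)))"
        unfolding h'_def
      proof (rule sum_mono)
        fix j assume "j \<in> I"
        have "2 * \<phi> j ?x * pd (\<phi> j) ?x u \<le> 2 * (\<bar>\<phi> j ?x\<bar> * \<bar>pd (\<phi> j) ?x u\<bar>)"
          by (metis abs_ge_self abs_mult mult.assoc mult_left_mono zero_le_numeral)
        also have "\<dots> \<le> 2 * (\<bar>\<phi> j ?x\<bar> * (n * (C * M ?x)))"
          by (intro mult_left_mono p \<open>j \<in> I\<close>) auto
        finally show "2 * \<phi> j ?x * pd (\<phi> j) ?x u \<le> 2 * \<bar>\<phi> j ?x\<bar> * (n * (C * M ?x))" by simp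
      qed
      also have "\<dots> = 2 * n * C * (M ?x)\<^sup>2"
        by (simp add: M_def sum_distrib_left[symmetric] sum_distrib_right[symmetric] power2_eq_square)
      also have "\<dots> \<le> 2 * n * C * (h t * real (card I))"
      proof (intro mult_left_mono)
        show "(M ?x)\<^sup>2 \<le> h t * real (card I)"
          using sum_squared_le_sum_of_squares[of "\<lambda>j. \<bar>\<phi> j ?x\<bar>" I] unfolding M_def h_def by simp
      qed (use n0 C0 in auto)
      also have "\<dots> = (2 * n * C * real (card I)) * h t" by simp
      finally show "h' t \<le> (2 * n * C * real (card I)) * h t" .
    qed (auto simp: h_def z intro: sum_nonneg)
    then show "\<phi> i y = 0"
      unfolding h_def using i I by (simp add: sum_nonneg_eq_0_iff u_def)
  qed
qed

section \<open>The Levi-Civita connection in a chart\<close>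

locale metric_domain =
  fixes S :: "'e::euclidean_space set" and g :: "'e \<Rightarrow> 'e \<Rightarrow> 'e \<Rightarrow> real"
  assumes open_S: "open S"
    and g_field: "bilinear_field S g"
    and g_ip: "\<And>x. x \<in> S \<Longrightarrow> inner_product_form (g x)"
begin

abbreviation \<Gamma> where "\<Gamma> \<equiv> levi_civita g"
abbreviation R where "R \<equiv> curvature g"

lemmas g_simps = inner_product_formD(4-)[OF g_ip]

lemma g_sym: "x \<in> S \<Longrightarrow> g x u v = g x v u"
  using inner_product_formD(2)[OF g_ip] by blast

lemma g_smooth: "smooth_on S (\<lambda>x. g x u v)"
  by (rule bilinear_field_smooth[OF g_field])

text \<open>The Koszul expression for \<open>g(\<nabla>\<^sub>u v, w)\<close> on constant vector fields.\<close>

definition koszul :: "'e \<Rightarrow> 'e \<Rightarrow> 'e \<Rightarrow> 'e \<Rightarrow> real" where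
  "koszul x u v w = (pd (\<lambda>y. g y v w) x u + pd (\<lambda>y. g y u w) x v - pd (\<lambda>y. g y u v) x w) / 2"

lemma linear_pd_g:
  assumes "x \<in> S"
  shows "linear (\<lambda>u. pd (\<lambda>y. g y v w) x u)" "linear (\<lambda>v. pd (\<lambda>y. g y v w) x u)"
    "linear (\<lambda>w. pd (\<lambda>y. g y v w) x u)"
  using linear_pd[OF g_smooth assms] bilinear_pd_bilinear_field[OF open_S assms g_field]
  by (auto simp: bilinear_def)

lemma koszul_linear:
  assumes "x \<in> S"
  shows "linear (koszul x u v)" "linear (\<lambda>v. koszul x u v w)" "linear (\<lambda>u. koszul x u v w)"
  unfolding koszul_def
  by (rule linearI; simp add: linear_pd_g[THEN linear_add, OF assms] linear_pd_g[THEN linear_cmul, OF assms]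
      algebra_simps diff_divide_distrib add_divide_distrib)+

lemma koszul_field: "linear_field S (\<lambda>x. koszul x u v)"
  unfolding linear_field_def
proof (intro conjI ballI allI koszul_linear)
  fix w
  have "smooth_on S (\<lambda>x. (pd (\<lambda>y. g y v w) x u + pd (\<lambda>y. g y u w) x v - pd (\<lambda>y. g y u v) x w) * (1/2))"
    by (intro smooth_on_mult smooth_on_diff smooth_on_add smooth_on_pd g_smooth open_S smooth_on_const)
  then show "smooth_on S (\<lambda>x. koszul x u v w)" by (simp add: koszul_def)
qed

text \<open>Summing the three cyclic instances of metric compatibility with signs determines the connection,
  so that the definite description in its definition is legitimate.\<close>

lemma levi_civita_eq:
  assumes x: "x \<in> S"
  shows "\<Gamma> x = (\<lambda>u v. sharp_vector (g x) (koszul x u v))"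
    and "bilinear (\<Gamma> x)" and "\<Gamma> x u v = \<Gamma> x v u"
    and "pd (\<lambda>y. g y v w) x u = g x (\<Gamma> x u v) w + g x v (\<Gamma> x u w)"
proof -
  note H = g_simps[OF x]
  define G where "G u v = sharp_vector (g x) (koszul x u v)" for u v
  have G: "g x (G u v) w = koszul x u v w" for u v w
    unfolding G_def by (rule sharp_vector_eq[OF g_ip[OF x] koszul_linear(1)[OF x]])
  have gs: "pd (\<lambda>y. g y v w) x u = pd (\<lambda>y. g y w v) x u" for u v w
    by (rule fun_cong[OF pd_cong[OF open_S x]]) (rule g_sym)
  have sym: "G u v = G v u" for u v
    unfolding G_def koszul_def by (simp add: gs[of v u] add.commute)
  have bil: "bilinear G"
    unfolding bilinear_def
    by (intro conjI allI linearI inner_product_form_eqI[OF g_ip[OF x]])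
      (simp_all add: G H linear_add[OF koszul_linear(2)[OF x]] linear_add[OF koszul_linear(3)[OF x]]
        linear_cmul[OF koszul_linear(2)[OF x]] linear_cmul[OF koszul_linear(3)[OF x]])
  have half: "a = a' \<Longrightarrow> a = (a + b - c) / 2 + (a' + c - b) / 2" for a a' b c :: real
    by (simp add: field_simps)
  have met: "pd (\<lambda>y. g y v w) x u = g x (G u v) w + g x v (G u w)" for u v w
    unfolding g_sym[OF x, of v "G u w"] G koszul_def by (rule half) (rule gs)
  have "\<Gamma> x = G"
    unfolding levi_civita_def
  proof (rule the_equality)
    fix G' assume G': "bilinear G' \<and> (\<forall>u v. G' u v = G' v u) \<and>
      (\<forall>u v w. pd (\<lambda>y. g y v w) x u = g x (G' u v) w + g x v (G' u w))"
    have "G u v = G' u v" for u v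
      unfolding G_def
    proof (rule sharp_vector_unique[OF g_ip[OF x]])
      fix w
      have "g x (G' u w) v = g x v (G' u w)" "g x (G' v w) u = g x u (G' v w)" "g x (G' w u) v = g x v (G' w u)"
        by (rule g_sym[OF x])+
      moreover have "G' v u = G' u v" "G' w u = G' u w" "G' w v = G' v w" using G' by auto
      ultimately show "g x (G' u v) w = koszul x u v w"
        unfolding koszul_def using G' by simp
    qed
    then show "G' = G" by (simp add: fun_eq_iff)
  qed (use bil sym met in auto)
  then show "\<Gamma> x = (\<lambda>u v. sharp_vector (g x) (koszul x u v))" "bilinear (\<Gamma> x)" "\<Gamma> x u v = \<Gamma> x v u"
    "pd (\<lambda>y. g y v w) x u = g x (\<Gamma> x u v) w + g x v (\<Gamma> x u w)"
    using bil sym met by (simp_all add: G_def[abs_def])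
qed

lemmas \<Gamma>_bilinear = levi_civita_eq(2)
lemmas \<Gamma>_sym = levi_civita_eq(3)
lemmas \<Gamma>_metric = levi_civita_eq(4)

lemmas \<Gamma>_simps = bilinear_ladd[OF \<Gamma>_bilinear] bilinear_radd[OF \<Gamma>_bilinear]
  bilinear_lsub[OF \<Gamma>_bilinear] bilinear_rsub[OF \<Gamma>_bilinear]
  bilinear_lneg[OF \<Gamma>_bilinear] bilinear_rneg[OF \<Gamma>_bilinear]
  bilinear_lmul[OF \<Gamma>_bilinear] bilinear_rmul[OF \<Gamma>_bilinear]

lemma \<Gamma>_field: "bilinear_field S \<Gamma>"
  unfolding bilinear_field_def
proof (intro conjI ballI allI \<Gamma>_bilinear)
  fix u v
  show "smooth_on S (\<lambda>x. \<Gamma> x u v)"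
    by (rule smooth_on_cong[OF open_S smooth_on_sharp_vector[OF open_S g_ip g_smooth koszul_field]])
      (simp_all add: levi_civita_eq(1))
qed

lemmas \<Gamma>_smooth = bilinear_field_smooth[OF \<Gamma>_field]

lemma nabla_vector_const: "nabla_vector g u (\<lambda>_. v) x = \<Gamma> x u v"
  by (simp add: nabla_vector_def)

section \<open>Symmetries of the curvature\<close>

lemma curvature_eq:
  "R x u v w = pd (\<lambda>y. \<Gamma> y v w) x u + \<Gamma> x u (\<Gamma> x v w) - pd (\<lambda>y. \<Gamma> y u w) x v - \<Gamma> x v (\<Gamma> x u w)"
proof -
  have "nabla_vector g v (\<lambda>_. w) = (\<lambda>y. \<Gamma> y v w)" for v w by (rule ext) (rule nabla_vector_const)
  then show ?thesis unfolding curvature_def by (simp add: nabla_vector_def)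
qed

lemma linear_pd_\<Gamma>:
  assumes "x \<in> S"
  shows "linear (\<lambda>u. pd (\<lambda>y. \<Gamma> y v w) x u)" "linear (\<lambda>v. pd (\<lambda>y. \<Gamma> y v w) x u)"
    "linear (\<lambda>w. pd (\<lambda>y. \<Gamma> y v w) x u)"
  using linear_pd[OF \<Gamma>_smooth assms] bilinear_pd_bilinear_field[OF open_S assms \<Gamma>_field]
  by (auto simp: bilinear_def)

lemma curvature_linear:
  assumes "x \<in> S"
  shows "linear (\<lambda>u. R x u v w)" "linear (\<lambda>v. R x u v w)" "linear (R x u v)"
  unfolding curvature_eq
  by (rule linearI; simp add: linear_pd_\<Gamma>[THEN linear_add, OF assms] linear_pd_\<Gamma>[THEN linear_cmul, OF assms]
      \<Gamma>_simps[OF assms] algebra_simps)+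

lemma curvature_skew: "R x u v w = - R x v u w"
  by (simp add: curvature_eq)

lemma first_bianchi:
  assumes x: "x \<in> S"
  shows "R x u v w + R x v w u + R x w u v = 0"
proof -
  have "pd (\<lambda>y. \<Gamma> y v w) x u = pd (\<lambda>y. \<Gamma> y w v) x u" for u v w
    by (rule fun_cong[OF pd_cong[OF open_S x]]) (rule \<Gamma>_sym)
  from this[of v w u] this[of w u v] this[of u v w] show ?thesis
    using \<Gamma>_sym[OF x, of v w] \<Gamma>_sym[OF x, of w u] \<Gamma>_sym[OF x, of u v]
    by (simp add: curvature_eq)
qed

text \<open>Differentiate metric compatibility once more: the second coordinate derivatives of g commute, and
  the products of first-order terms are symmetric in u and v.\<close>

lemma curvature_g_skew:
  assumes x: "x \<in> S"
  shows "g x (R x u v w) z = - g x w (R x u v z)"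
proof -
  have 1: "pd (\<lambda>y. pd (\<lambda>y. g y w z) y v) x u =
      g x (\<Gamma> x u (\<Gamma> x v w)) z + g x (\<Gamma> x v w) (\<Gamma> x u z) + g x (pd (\<lambda>y. \<Gamma> y v w) x u) z
      + (g x (\<Gamma> x u w) (\<Gamma> x v z) + g x w (\<Gamma> x u (\<Gamma> x v z)) + g x w (pd (\<lambda>y. \<Gamma> y v z) x u))" for u v
  proof -
    have "pd (\<lambda>y. pd (\<lambda>y. g y w z) y v) x u = pd (\<lambda>y. g y (\<Gamma> y v w) z + g y w (\<Gamma> y v z)) x u"
      by (rule fun_cong[OF pd_cong[OF open_S x]]) (rule \<Gamma>_metric)
    also have "\<dots> = pd (\<lambda>y. g y (\<Gamma> y v w) z) x u + pd (\<lambda>y. g y w (\<Gamma> y v z)) x u"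
      by (intro pd_add smooth_on_differentiable[OF smooth_on_apply2[OF open_S g_field]] \<Gamma>_smooth smooth_on_const x)
    also have "pd (\<lambda>y. g y (\<Gamma> y v w) z) x u = pd (\<lambda>y. g y (\<Gamma> x v w) z) x u + g x (pd (\<lambda>y. \<Gamma> y v w) x u) z"
      by (rule pd_apply[OF open_S x bilinear_field_left[OF g_field] \<Gamma>_smooth])
    also have "pd (\<lambda>y. g y w (\<Gamma> y v z)) x u = pd (\<lambda>y. g y w (\<Gamma> x v z)) x u + g x w (pd (\<lambda>y. \<Gamma> y v z) x u)"
      by (rule pd_apply[OF open_S x bilinear_field_right[OF g_field] \<Gamma>_smooth])
    finally show ?thesis by (simp add: \<Gamma>_metric[OF x])
  qed
  have "pd (\<lambda>y. pd (\<lambda>y. g y w z) y v) x u = pd (\<lambda>y. pd (\<lambda>y. g y w z) y u) x v"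
    by (rule clairaut_real[OF open_S x g_smooth])
  then show ?thesis unfolding 1 by (simp add: curvature_eq g_simps[OF x])
qed

end

text \<open>The octahedron argument: the cyclic identities for the four choices of the fixed argument add up,
  after use of the skew symmetries, to twice the claim.\<close>

lemma curvature_tensor_pair_symmetry:
  fixes Q :: "'a \<Rightarrow> 'a \<Rightarrow> 'a \<Rightarrow> 'a \<Rightarrow> real"
  assumes 1: "\<And>u v w z. Q u v w z = - Q v u w z" and 2: "\<And>u v w z. Q u v w z = - Q u v z w"
    and 3: "\<And>u v w z. Q u v w z + Q v w u z + Q w u v z = 0"
  shows "Q u v w z = Q w z u v"
  using 3[of u v w z] 3[of v w z u] 3[of w z u v] 3[of z u v w]
    1[of u w v z] 1[of v z w u] 1[of u z v w]  1[of v w u z] 1[of w z u v] 1[of u v w z]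
    1[of z u w v] 1[of v z u w] 1[of w u z v] 1[of w u v z]
    2[of u v w z] 2[of v w u z] 2[of w u v z] 2[of w z u v] 2[of z u v w] 2[of v z w u] 2[of u w v z]
  by linarith

lemma linear_trace_comp:
  assumes A: "linear A" and B: "linear (B :: 'e::euclidean_space \<Rightarrow> 'e)"
  shows "linear_trace (\<lambda>u. A (B u)) = linear_trace (\<lambda>u. B (A u))"
proof -
  have *: "linear_trace (\<lambda>u. A (B u)) = (\<Sum>b\<in>Basis. \<Sum>c\<in>Basis. (B b \<bullet> c) * (A c \<bullet> b))"
    if "linear A" for A B :: "'e \<Rightarrow> 'e"
    unfolding linear_trace_def
  proof (intro sum.cong refl)
    fix b :: 'e
    show "A (B b) \<bullet> b = (\<Sum>c\<in>Basis. (B b \<bullet> c) * (A c \<bullet> b))"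
      using arg_cong[OF linear_expand[OF that, of "B b"], of "\<lambda>z. z \<bullet> b"] by (simp add: inner_sum_left)
  qed
  show ?thesis unfolding *[OF A] *[OF B] by (subst sum.swap) (simp add: mult.commute)
qed

lemma linear_trace_add: "linear_trace (\<lambda>u. A u + B u) = linear_trace A + linear_trace B"
  and linear_trace_diff: "linear_trace (\<lambda>u. A u - B u) = linear_trace A - linear_trace B"
  and linear_trace_minus: "linear_trace (\<lambda>u. - A u) = - linear_trace A"
  by (simp_all add: linear_trace_def inner_add_left inner_diff_left sum.distrib sum_subtractf sum_negf)

text \<open>A skew endomorphism contracted with the symmetric inverse of the form gives zero.\<close>

lemma linear_trace_skew:
  assumes h: "inner_product_form h" and A: "linear A" and skew: "\<And>u v. h (A u) v = - h u (A v)"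
  shows "linear_trace A = 0"
proof -
  define k where "k b = sharp_vector h (\<lambda>v. v \<bullet> b)" for b :: 'a
  have k: "h (k b) v = v \<bullet> b" for b v
    unfolding k_def using bounded_linear.linear[OF bounded_linear_inner_left]
    by (intro sharp_vector_eq[OF h])
  note H = inner_product_formD[OF h]
  have lin: "linear (h u)" for u using H(1) by (simp add: bilinear_def)
  \<comment> \<open>The trace is the contraction of h(A u, v) with the inverse of h.\<close>
  have tr: "linear_trace A = (\<Sum>b\<in>Basis. \<Sum>c\<in>Basis. (k b \<bullet> c) * h (A b) c)"
    unfolding linear_trace_def
  proof (intro sum.cong refl)
    fix b :: 'a
    show "A b \<bullet> b = (\<Sum>c\<in>Basis. (k b \<bullet> c) * h (A b) c)"
      using linear_expand[OF lin, of "A b" "k b"] k[of b "A b"] H(2)[of "A b" "k b"] by simp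
  qed
  have ks: "k b \<bullet> c = k c \<bullet> b" for b c
    using k[of c "k b"] k[of b "k c"] H(2)[of "k b" "k c"] by simp
  have "(\<Sum>b\<in>Basis. \<Sum>c\<in>Basis. (k b \<bullet> c) * h (A b) c) = (\<Sum>c\<in>Basis. \<Sum>b\<in>Basis. (k b \<bullet> c) * h (A b) c)"
    by (rule sum.swap)
  also have "\<dots> = (\<Sum>c\<in>Basis. \<Sum>b\<in>Basis. - ((k c \<bullet> b) * h (A c) b))"
  proof (intro sum.cong refl)
    fix b c
    show "(k b \<bullet> c) * h (A b) c = - ((k c \<bullet> b) * h (A c) b)"
      using skew[of b c] H(2)[of b "A c"] ks[of b c] by simp
  qed
  also have "\<dots> = - (\<Sum>c\<in>Basis. \<Sum>b\<in>Basis. (k c \<bullet> b) * h (A c) b)" by (simp add: sum_negf)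
  finally show ?thesis using tr by simp
qed

section \<open>The Ricci form of a Kaehler metric\<close>

locale kaehler_domain = metric_domain S g
  for S :: "'e::euclidean_space set" and g +
  fixes J :: "'e \<Rightarrow> 'e \<Rightarrow> 'e"
  assumes J_field: "linear_field S J"
    and J_sq: "\<And>x u. x \<in> S \<Longrightarrow> J x (J x u) = - u"
    and J_iso: "\<And>x u v. x \<in> S \<Longrightarrow> g x (J x u) (J x v) = g x u v"
    and J_parallel: "\<And>x u v. x \<in> S \<Longrightarrow> nabla_endo g u J x v = 0"
begin

lemmas J_linear = linear_field_linear[OF J_field]
lemmas J_smooth = linear_field_smooth[OF J_field]

lemmas J_simps = linear_add[OF J_linear] linear_diff[OF J_linear] linear_neg[OF J_linear]
  linear_cmul[OF J_linear] linear_0[OF J_linear]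

lemma J_pd: "x \<in> S \<Longrightarrow> pd (\<lambda>y. J y v) x u = J x (\<Gamma> x u v) - \<Gamma> x u (J x v)"
  using J_parallel[of x u v] by (simp add: nabla_endo_def nabla_vector_def algebra_simps)

lemma J_skew: "x \<in> S \<Longrightarrow> g x (J x u) v = - g x u (J x v)"
  using J_iso[of x u "J x v"] J_sq[of x v] by (simp add: g_simps)

lemma g_J_self: "x \<in> S \<Longrightarrow> g x (J x u) u = 0"
  using J_skew[of x u u] g_sym[of x u "J x u"] by simp

text \<open>As for the metric, the second coordinate derivatives of the parallel tensor J commute.\<close>

lemma curvature_J:
  assumes x: "x \<in> S"
  shows "R x u v (J x w) = J x (R x u v w)"
proof -
  have 1: "pd (\<lambda>y. pd (\<lambda>y. J y w) y v) x u =
      (J x (\<Gamma> x u (\<Gamma> x v w)) - \<Gamma> x u (J x (\<Gamma> x v w)) + J x (pd (\<lambda>y. \<Gamma> y v w) x u))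
      - (pd (\<lambda>y. \<Gamma> y v (J x w)) x u + \<Gamma> x v (J x (\<Gamma> x u w) - \<Gamma> x u (J x w)))" for u v
  proof -
    have "pd (\<lambda>y. pd (\<lambda>y. J y w) y v) x u = pd (\<lambda>y. J y (\<Gamma> y v w) - \<Gamma> y v (J y w)) x u"
      by (rule fun_cong[OF pd_cong[OF open_S x]]) (rule J_pd)
    also have "\<dots> = pd (\<lambda>y. J y (\<Gamma> y v w)) x u - pd (\<lambda>y. \<Gamma> y v (J y w)) x u"
      by (intro pd_diff smooth_on_differentiable[OF smooth_on_apply[OF open_S J_field \<Gamma>_smooth]]
          smooth_on_differentiable[OF smooth_on_apply2[OF open_S \<Gamma>_field smooth_on_const J_smooth]] x)
    also have "pd (\<lambda>y. J y (\<Gamma> y v w)) x u = pd (\<lambda>y. J y (\<Gamma> x v w)) x u + J x (pd (\<lambda>y. \<Gamma> y v w) x u)"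
      by (rule pd_apply[OF open_S x J_field \<Gamma>_smooth])
    also have "pd (\<lambda>y. \<Gamma> y v (J y w)) x u = pd (\<lambda>y. \<Gamma> y v (J x w)) x u + \<Gamma> x v (pd (\<lambda>y. J y w) x u)"
      by (rule pd_apply[OF open_S x bilinear_field_right[OF \<Gamma>_field] J_smooth])
    finally show ?thesis by (simp add: J_pd[OF x])
  qed
  have "pd (\<lambda>y. pd (\<lambda>y. J y w) y v) x u = pd (\<lambda>y. pd (\<lambda>y. J y w) y u) x v"
    by (rule clairaut[OF open_S x J_smooth])
  then show ?thesis unfolding 1
    by (simp add: curvature_eq J_simps[OF x] \<Gamma>_simps[OF x] algebra_simps)
qed

lemma curvature_pair_sym:
  assumes x: "x \<in> S"
  shows "g x (R x u v w) z = g x (R x w z u) v"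
proof (rule curvature_tensor_pair_symmetry[of "\<lambda>u v w z. g x (R x u v w) z"])
  fix u v w z
  show "g x (R x u v w) z = - g x (R x v u w) z"
    using curvature_skew[of x u v w] by (simp add: g_simps[OF x])
  show "g x (R x u v w) z = - g x (R x u v z) w"
    using curvature_g_skew[OF x, of u v w z] g_sym[OF x, of w "R x u v z"] by simp
  show "g x (R x u v w) z + g x (R x v w u) z + g x (R x w u v) z = 0"
    using arg_cong[OF first_bianchi[OF x, of u v w], of "\<lambda>a. g x a z"] by (simp add: g_simps[OF x])
qed

text \<open>Pair symmetry moves J from the first two arguments to the last two, where it is an isometry that
  commutes with the curvature.\<close>

lemma curvature_J_J:
  assumes x: "x \<in> S"
  shows "R x (J x u) (J x v) w = R x u v w"
proof (rule inner_product_form_eqI[OF g_ip[OF x]])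
  fix z
  have "g x (R x (J x u) (J x v) w) z = g x (J x (R x w z u)) (J x v)"
    by (simp only: curvature_pair_sym[OF x, of "J x u"] curvature_J[OF x])
  also have "\<dots> = g x (R x u v w) z"
    by (simp only: J_iso[OF x] curvature_pair_sym[OF x, of w])
  finally show "g x (R x (J x u) (J x v) w) z = g x (R x u v w) z" .
qed

lemma ricci_sym:
  assumes x: "x \<in> S"
  shows "ricci g x u v = ricci g x v u"
proof -
  have "0 = linear_trace (R x u v)"
    using curvature_linear(3)[OF x] curvature_g_skew[OF x]
    by (intro linear_trace_skew[OF g_ip[OF x], symmetric])
  also have "R x u v = (\<lambda>w. R x w v u - R x w u v)"
  proof
    fix w show "R x u v w = R x w v u - R x w u v"
      using first_bianchi[OF x, of u v w] curvature_skew[of x v w u] by (simp add: algebra_simps eq_neg_iff_add_eq_0)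
  qed
  also have "linear_trace \<dots> = ricci g x v u - ricci g x u v"
    unfolding ricci_def by (rule linear_trace_diff)
  finally show ?thesis by simp
qed

lemma ricci_J:
  assumes x: "x \<in> S"
  shows "ricci g x (J x u) (J x v) = ricci g x u v"
proof -
  have "R x w (J x u) v = - R x (J x w) u v" for w
    using curvature_J_J[OF x, of w "J x u" v] by (simp add: J_sq[OF x] linear_neg[OF curvature_linear(2)[OF x]])
  then have "R x w (J x u) (J x v) = - J x (R x (J x w) u v)" for w
    by (simp add: curvature_J[OF x] J_simps[OF x])
  then have "ricci g x (J x u) (J x v) = - linear_trace (\<lambda>w. J x (R x (J x w) u v))"
    unfolding ricci_def by (simp add: linear_trace_minus)
  also have "linear_trace (\<lambda>w. J x (R x (J x w) u v)) = linear_trace (\<lambda>w. R x (J x (J x w)) u v)"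
    by (rule linear_trace_comp[OF J_linear[OF x] linear_compose[OF J_linear[OF x] curvature_linear(1)[OF x], unfolded comp_def]])
  finally show ?thesis
    by (simp add: J_sq[OF x] linear_neg[OF curvature_linear(1)[OF x]] linear_trace_minus ricci_def)
qed

lemma ricci_linear: "x \<in> S \<Longrightarrow> linear (\<lambda>u. ricci g x u v)" "x \<in> S \<Longrightarrow> linear (ricci g x u)"
  unfolding ricci_def linear_trace_def
  by (rule linearI; simp add: curvature_linear[THEN linear_add] curvature_linear[THEN linear_cmul]
      inner_add_left sum.distrib sum_distrib_left)+

text \<open>The first Bianchi identity turns the trace of \<open>J \<circ> R(u,v)\<close> into the difference of two Ricci
  contractions, which are equal up to sign by the J-invariance of the Ricci tensor. This expression,
  unlike the definition of the Ricci form, is a trace of a curvature form and so accessible to the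
  second Bianchi identity.\<close>

lemma ricci_form_trace:
  assumes x: "x \<in> S"
  shows "ricci_form g J x u v = linear_trace (\<lambda>w. J x (R x u v w)) / 2"
proof -
  have "(\<lambda>w. J x (R x u v w)) = (\<lambda>w. R x w v (J x u) - R x w u (J x v))"
  proof
    fix w
    have "R x u v w = R x w v u - R x w u v"
      using first_bianchi[OF x, of u v w] curvature_skew[of x v w u] by (simp add: algebra_simps eq_neg_iff_add_eq_0)
    then show "J x (R x u v w) = R x w v (J x u) - R x w u (J x v)"
      by (simp add: J_simps[OF x] curvature_J[OF x])
  qed
  then have "linear_trace (\<lambda>w. J x (R x u v w)) = ricci g x v (J x u) - ricci g x u (J x v)"
    unfolding ricci_def by (simp add: linear_trace_diff)
  also have "ricci g x u (J x v) = - ricci g x (J x u) v"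
    using ricci_J[OF x, of u "J x v"] linear_neg[OF ricci_linear(2)[OF x]] by (simp add: J_sq[OF x])
  also have "ricci g x v (J x u) = ricci g x (J x u) v" by (rule ricci_sym[OF x])
  finally show ?thesis by (simp add: ricci_form_def)
qed

lemma ricci_form_J: "x \<in> S \<Longrightarrow> ricci_form g J x (J x u) (J x v) = ricci_form g J x u v"
  unfolding ricci_form_def by (rule ricci_J)

lemma curvature_smooth: "smooth_on S (\<lambda>x. R x u v w)"
  unfolding curvature_eq
  by (intro smooth_on_diff smooth_on_add smooth_on_pd \<Gamma>_smooth open_S smooth_on_const
      smooth_on_apply2[OF open_S \<Gamma>_field])

lemma curvature_pd:
  assumes x: "x \<in> S"
  shows "pd (\<lambda>y. R y u v w) x z =
    pd (\<lambda>y. pd (\<lambda>y. \<Gamma> y v w) y u) x z + (pd (\<lambda>y. \<Gamma> y u (\<Gamma> x v w)) x z + \<Gamma> x u (pd (\<lambda>y. \<Gamma> y v w) x z))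
    - pd (\<lambda>y. pd (\<lambda>y. \<Gamma> y u w) y v) x z - (pd (\<lambda>y. \<Gamma> y v (\<Gamma> x u w)) x z + \<Gamma> x v (pd (\<lambda>y. \<Gamma> y u w) x z))"
proof -
  note sm = smooth_on_differentiable[OF smooth_on_pd[OF \<Gamma>_smooth] x]
    smooth_on_differentiable[OF smooth_on_apply2[OF open_S \<Gamma>_field smooth_on_const \<Gamma>_smooth] x]
  have "pd (\<lambda>y. \<Gamma> y u (\<Gamma> y v w)) x z = pd (\<lambda>y. \<Gamma> y u (\<Gamma> x v w)) x z + \<Gamma> x u (pd (\<lambda>y. \<Gamma> y v w) x z)" for u v
    by (rule pd_apply[OF open_S x bilinear_field_right[OF \<Gamma>_field] \<Gamma>_smooth])
  then show ?thesis
    unfolding curvature_eq by (simp add: pd_diff pd_add differentiable_diff differentiable_add sm)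
qed

text \<open>E is the covariant derivative of the curvature endomorphism, as if R(u,v) were a scalar in u and v:
  the Christoffel terms in these two arguments cancel in the cyclic sum.\<close>

lemma second_bianchi:
  assumes x: "x \<in> S"
  defines "E \<equiv> \<lambda>z u v w. pd (\<lambda>y. R y u v w) x z + \<Gamma> x z (R x u v w) - R x u v (\<Gamma> x z w)"
  shows "E z u v w + E u v z w + E v z u w = 0"
proof -
  have "pd (\<lambda>y. pd (\<lambda>y. \<Gamma> y v w) y u) x z = pd (\<lambda>y. pd (\<lambda>y. \<Gamma> y v w) y z) x u" for z u v
    by (rule clairaut[OF open_S x \<Gamma>_smooth])
  from this[of v u z] this[of u z v] this[of z v u] show ?thesis
    unfolding E_def curvature_pd[OF x] unfolding curvature_eq by (simp add: \<Gamma>_simps[OF x])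
qed

lemma ricci_form_smooth: "smooth_on S (\<lambda>x. ricci_form g J x u v)"
proof (rule smooth_on_cong[OF open_S])
  show "smooth_on S (\<lambda>x. (\<Sum>b\<in>Basis. J x (R x u v b) \<bullet> b) * (1/2))"
    by (intro smooth_on_mult smooth_on_sum smooth_on_inner smooth_on_const open_S
        smooth_on_apply[OF open_S J_field] curvature_smooth)
qed (simp add: ricci_form_trace linear_trace_def)

text \<open>Traces of commutators vanish, and J is parallel, so under the trace the coordinate derivative may
  be replaced by the covariant one.\<close>

lemma ricci_form_pd:
  assumes x: "x \<in> S"
  shows "pd (\<lambda>y. ricci_form g J y u v) x z =
    linear_trace (\<lambda>w. J x (pd (\<lambda>y. R y u v w) x z + \<Gamma> x z (R x u v w) - R x u v (\<Gamma> x z w))) / 2"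
proof -
  have sm: "smooth_on S (\<lambda>y. J y (R y u v b))" for b
    by (intro smooth_on_apply[OF open_S J_field] curvature_smooth)
  have sb: "(\<lambda>y. J y (R y u v b) \<bullet> b) differentiable (at x)" for b
    by (rule differentiable_inner[OF smooth_on_differentiable[OF sm x] differentiable_const])
  have "pd (\<lambda>y. ricci_form g J y u v) x z = pd (\<lambda>y. (\<Sum>b\<in>Basis. J y (R y u v b) \<bullet> b) / 2) x z"
    by (rule fun_cong[OF pd_cong[OF open_S x]]) (simp add: ricci_form_trace linear_trace_def)
  also have "\<dots> = pd (\<lambda>y. \<Sum>b\<in>Basis. J y (R y u v b) \<bullet> b) x z / 2"
    by (rule pd_linear_comp[OF bounded_linear_divide differentiable_sum]) (simp_all add: sb)
  also have "pd (\<lambda>y. \<Sum>b\<in>Basis. J y (R y u v b) \<bullet> b) x z = (\<Sum>b\<in>Basis. pd (\<lambda>y. J y (R y u v b)) x z \<bullet> b)"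
    by (simp add: pd_sum sb pd_linear_comp[OF bounded_linear_inner_left smooth_on_differentiable[OF sm x]])
  also have "\<dots> = linear_trace (\<lambda>w. J x (\<Gamma> x z (R x u v w)) - \<Gamma> x z (J x (R x u v w)) + J x (pd (\<lambda>y. R y u v w) x z))"
    unfolding linear_trace_def
    by (intro sum.cong refl)
      (simp add: pd_apply[OF open_S x J_field curvature_smooth] J_pd[OF x])
  also have "\<dots> = linear_trace (\<lambda>w. J x (\<Gamma> x z (R x u v w))) - linear_trace (\<lambda>w. \<Gamma> x z (J x (R x u v w)))
      + linear_trace (\<lambda>w. J x (pd (\<lambda>y. R y u v w) x z))"
    by (simp add: linear_trace_add linear_trace_diff)
  also have "linear_trace (\<lambda>w. \<Gamma> x z (J x (R x u v w))) = linear_trace (\<lambda>w. J x (R x u v (\<Gamma> x z w)))"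
    using \<Gamma>_bilinear[OF x] linear_compose[OF curvature_linear(3)[OF x] J_linear[OF x], unfolded comp_def]
    by (intro linear_trace_comp) (auto simp: bilinear_def)
  finally show ?thesis
    by (simp add: J_simps[OF x] linear_trace_add linear_trace_diff)
qed

lemma ricci_form_closed:
  assumes x: "x \<in> S"
  shows "pd (\<lambda>y. ricci_form g J y u v) x z + pd (\<lambda>y. ricci_form g J y v z) x u
    + pd (\<lambda>y. ricci_form g J y z u) x v = 0"
proof -
  define E where "E z u v w = pd (\<lambda>y. R y u v w) x z + \<Gamma> x z (R x u v w) - R x u v (\<Gamma> x z w)" for z u v w
  have p: "pd (\<lambda>y. ricci_form g J y u v) x z = linear_trace (\<lambda>w. J x (E z u v w)) / 2" for z u v
    unfolding E_def by (rule ricci_form_pd[OF x])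
  have "E z u v w + E u v z w + E v z u w = 0" for w
    unfolding E_def by (rule second_bianchi[OF x])
  then have "J x (E z u v w) + J x (E u v z w) + J x (E v z u w) = 0" for w
    by (metis linear_add[OF J_linear[OF x]] linear_0[OF J_linear[OF x]])
  then have "linear_trace (\<lambda>w. J x (E z u v w) + J x (E u v z w) + J x (E v z u w)) = 0"
    by (simp add: linear_trace_def)
  then show ?thesis by (simp add: p linear_trace_add)
qed

lemma kaehler_form_smooth: "smooth_on S (\<lambda>x. kaehler_form g J x u v)"
  unfolding kaehler_form_def
  by (intro smooth_on_apply2[OF open_S g_field] J_smooth smooth_on_const)

lemma kaehler_form_skew: "x \<in> S \<Longrightarrow> kaehler_form g J x u v = - kaehler_form g J x v u"
  unfolding kaehler_form_def using J_skew[of x u v] g_sym[of x u "J x v"] by simp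

lemma kaehler_form_J: "x \<in> S \<Longrightarrow> kaehler_form g J x (J x u) (J x v) = kaehler_form g J x u v"
  unfolding kaehler_form_def by (rule J_iso)

lemma kaehler_form_pd:
  assumes x: "x \<in> S"
  shows "pd (\<lambda>y. kaehler_form g J y v w) x u =
    kaehler_form g J x (\<Gamma> x u v) w + kaehler_form g J x v (\<Gamma> x u w)"
  unfolding kaehler_form_def pd_apply[OF open_S x bilinear_field_left[OF g_field] J_smooth]
  by (simp add: J_pd[OF x] \<Gamma>_metric[OF x] g_simps[OF x])

lemma kaehler_form_closed:
  assumes x: "x \<in> S"
  shows "pd (\<lambda>y. kaehler_form g J y u v) x z + pd (\<lambda>y. kaehler_form g J y v z) x u
    + pd (\<lambda>y. kaehler_form g J y z u) x v = 0"
  unfolding kaehler_form_pd[OF x]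
  using kaehler_form_skew[OF x, of u "\<Gamma> x z v"] kaehler_form_skew[OF x, of v "\<Gamma> x u z"]
    kaehler_form_skew[OF x, of z "\<Gamma> x v u"]
    \<Gamma>_sym[OF x, of z u] \<Gamma>_sym[OF x, of z v] \<Gamma>_sym[OF x, of u v]
  by simp

end

section \<open>The Einstein equation in a chart\<close>

text \<open>Here V and j V span a plane with dual coordinates \<open>a/q\<close> and \<open>c/q\<close>. Symmetry lets the orthogonality
  hypothesis remove the components of either argument outside this plane, and then the mixed terms
  in it.\<close>

lemma invariant_form_two_plane:
  fixes B :: "'e::real_vector \<Rightarrow> 'e \<Rightarrow> real"
  assumes B: "bilinear B" and sym: "\<And>u z. B u z = B z u" and inv: "B (j V) (j V) = B V V"
    and l: "linear a" "linear c" and v: "a V = q" "c V = 0" "a (j V) = 0" "c (j V) = q" and q: "q \<noteq> 0"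
    and z: "\<And>u z. a u = 0 \<Longrightarrow> c z = 0 \<Longrightarrow> B u z = 0"
  shows "B u z = B V V / q\<^sup>2 * (a u * a z + c u * c z)"
proof -
  note Bs = bilinear_ladd[OF B] bilinear_radd[OF B] bilinear_lsub[OF B] bilinear_rsub[OF B]
    bilinear_lmul[OF B] bilinear_rmul[OF B]
  note ls = linear_diff[OF l(1)] linear_diff[OF l(2)] linear_cmul[OF l(1)] linear_cmul[OF l(2)]
  have 1: "B V z = a z / q * B V V" for z
  proof -
    have "B (z - (a z / q) *\<^sub>R V) V = 0" using q by (intro z) (simp_all add: ls v)
    then show ?thesis using sym[of V z] by (simp add: Bs)
  qed
  define u' where "u' = u - (a u / q) *\<^sub>R V"
  have u': "a u' = 0" "c u' = c u" using q by (simp_all add: u'_def ls v)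
  have "B (j V) (u' - (c u' / q) *\<^sub>R j V) = 0" using q by (intro z) (simp_all add: ls v)
  then have 2: "B u' (j V) = c u / q * B V V" using sym[of u' "j V"] by (simp add: Bs u' inv)
  have "B u' (z - (c z / q) *\<^sub>R j V) = 0" using q by (intro z) (simp_all add: ls v u')
  then have 3: "B u' z = c z / q * (c u / q * B V V)" by (simp add: Bs 2)
  have "B u z = a u / q * B V z + B u' z" by (simp add: u'_def Bs)
  also have "\<dots> = a u / q * (a z / q * B V V) + c z / q * (c u / q * B V V)" by (simp only: 1[of z] 3)
  finally show ?thesis by (simp add: algebra_simps power2_eq_square)
qed

locale einstein_domain = kaehler_domain S g J
  for S :: "'e::euclidean_space set" and g J +
  fixes t :: "'e \<Rightarrow> real" and \<mu> :: "'e \<Rightarrow> real"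
  assumes dim_ge_4: "DIM('e) \<ge> 4"
    and t_smooth: "smooth_on S t" and \<mu>_smooth: "smooth_on S \<mu>"
    and einstein_eq: "\<And>x u v. x \<in> S \<Longrightarrow> (real DIM('e) - 2) * nabla_form1 g u (form_dc J t) x v =
      - t x * ricci_form g J x u v + \<mu> x * kaehler_form g J x u v"
    and strong: "\<And>x u v. x \<in> S \<Longrightarrow> wedge (form_d t x) (form_d \<mu> x) u v = 0"
begin

abbreviation \<theta> where "\<theta> \<equiv> form_d t"
abbreviation \<theta>c where "\<theta>c \<equiv> form_dc J t"
abbreviation \<omega> where "\<omega> \<equiv> kaehler_form g J"
abbreviation \<rho> where "\<rho> \<equiv> ricci_form g J"

definition hess where "hess x u v = pd (\<lambda>y. \<theta> y v) x u - \<theta> x (\<Gamma> x u v)"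

lemma \<theta>_field: "linear_field S \<theta>"
  unfolding linear_field_def form_d_def using linear_pd[OF t_smooth] smooth_on_pd[OF t_smooth] by blast

lemmas \<theta>_smooth = linear_field_smooth[OF \<theta>_field]
lemmas \<theta>_linear = linear_field_linear[OF \<theta>_field]
lemmas \<theta>_simps = linear_add[OF \<theta>_linear] linear_diff[OF \<theta>_linear] linear_neg[OF \<theta>_linear]
  linear_cmul[OF \<theta>_linear] linear_0[OF \<theta>_linear]

lemma \<theta>c_eq: "\<theta>c x v = - \<theta> x (J x v)"
  by (simp add: form_dc_def J_form_def)

lemma \<theta>c_J: "x \<in> S \<Longrightarrow> \<theta>c x (J x v) = \<theta> x v"
  by (simp add: \<theta>c_eq J_sq \<theta>_simps)

lemma \<theta>c_linear: "x \<in> S \<Longrightarrow> linear (\<theta>c x)"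
  by (rule linearI) (simp_all add: \<theta>c_eq \<theta>_simps J_simps)

lemma \<theta>c_smooth: "smooth_on S (\<lambda>x. \<theta>c x v)"
  unfolding \<theta>c_eq by (intro smooth_on_minus open_S smooth_on_apply[OF open_S \<theta>_field] J_smooth)

lemma pd_\<theta>_sym: "x \<in> S \<Longrightarrow> pd (\<lambda>y. \<theta> y v) x u = pd (\<lambda>y. \<theta> y u) x v"
  unfolding form_d_def by (rule clairaut_real[OF open_S _ t_smooth])

lemma hess_sym: "x \<in> S \<Longrightarrow> hess x u v = hess x v u"
  unfolding hess_def using pd_\<theta>_sym \<Gamma>_sym by simp

lemma pd_\<theta>_bilinear: "x \<in> S \<Longrightarrow> bilinear (\<lambda>u v. pd (\<lambda>y. \<theta> y v) x u)"
  using linear_pd[OF \<theta>_smooth] linear_field_linear[OF linear_field_pd[OF open_S \<theta>_field]]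
  by (simp add: bilinear_def)

lemma hess_bilinear:
  assumes x: "x \<in> S"
  shows "bilinear (hess x)"
proof -
  note b = pd_\<theta>_bilinear[OF x]
  show ?thesis
    unfolding bilinear_def hess_def
    using bilinear_ladd[OF b] bilinear_radd[OF b] bilinear_lmul[OF b] bilinear_rmul[OF b]
    by (intro conjI allI linearI) (simp_all add: \<Gamma>_simps[OF x] \<theta>_simps[OF x] algebra_simps)
qed

lemma pd_\<theta>c:
  assumes x: "x \<in> S"
  shows "pd (\<lambda>y. \<theta>c y v) x u = - hess x u (J x v) + \<theta>c x (\<Gamma> x u v)"
proof -
  have "pd (\<lambda>y. \<theta>c y v) x u = - pd (\<lambda>y. \<theta> y (J y v)) x u"
    unfolding \<theta>c_eq
    by (rule pd_minus[OF smooth_on_differentiable[OF smooth_on_apply[OF open_S \<theta>_field J_smooth] x]])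
  also have "pd (\<lambda>y. \<theta> y (J y v)) x u = pd (\<lambda>y. \<theta> y (J x v)) x u + \<theta> x (pd (\<lambda>y. J y v) x u)"
    by (rule pd_apply[OF open_S x \<theta>_field J_smooth])
  finally show ?thesis by (simp add: hess_def J_pd[OF x] \<theta>c_eq \<theta>_simps[OF x])
qed

lemma hess_eq:
  "x \<in> S \<Longrightarrow> (real DIM('e) - 2) * hess x u (J x v) = t x * \<rho> x u v - \<mu> x * \<omega> x u v"
  using einstein_eq[of x u v] by (simp add: nabla_form1_def pd_\<theta>c)

text \<open>In the Einstein equation the Ricci form and the Kaehler form are J-invariant, hence so is
  \<open>H(u, Jv)\<close>.\<close>

lemma hess_J:
  assumes x: "x \<in> S"
  shows "hess x (J x u) (J x v) = hess x u v"
proof -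
  have 1: "hess x (J x u) (J x (J x w)) = hess x u (J x w)" for w
  proof -
    have "(real DIM('e) - 2) * hess x (J x u) (J x (J x w)) = (real DIM('e) - 2) * hess x u (J x w)"
      unfolding hess_eq[OF x] by (simp add: ricci_form_J[OF x] kaehler_form_J[OF x])
    then show ?thesis using dim_ge_4 by simp
  qed
  show ?thesis using 1[of "J x v"]
    by (simp add: J_sq[OF x] J_simps[OF x] bilinear_rneg[OF hess_bilinear[OF x]])
qed

lemma ddc:
  assumes x: "x \<in> S"
  shows "pd (\<lambda>y. \<theta>c y v) x u - pd (\<lambda>y. \<theta>c y u) x v = - 2 * hess x u (J x v)"
proof -
  have "hess x v (J x u) = - hess x u (J x v)"
    using hess_J[OF x, of v "J x u"] hess_sym[OF x, of "J x v" u]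
    by (simp add: J_sq[OF x] bilinear_rneg[OF hess_bilinear[OF x]])
  then show ?thesis using \<Gamma>_sym[OF x, of u v] by (simp add: pd_\<theta>c[OF x])
qed

text \<open>The exterior derivative of the Einstein equation, in which the Ricci form, the Kaehler form and
  \<open>dd\<^sup>c t\<close> are closed.\<close>

lemma d\<theta>_\<rho>_eq_d\<mu>_\<omega>:
  assumes x: "x \<in> S"
  shows "\<theta> x w * \<rho> x u v + \<theta> x u * \<rho> x v w + \<theta> x v * \<rho> x w u =
    pd \<mu> x w * \<omega> x u v + pd \<mu> x u * \<omega> x v w + pd \<mu> x v * \<omega> x w u"
proof -
  define h where "h = real DIM('e) - 2"
  have d: "pd (\<lambda>y. (pd (\<lambda>z. \<theta>c z v) y u - pd (\<lambda>z. \<theta>c z u) y v) * (h / 2)) x w =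
      \<mu> x * pd (\<lambda>y. \<omega> y u v) x w + pd \<mu> x w * \<omega> x u v
      - (t x * pd (\<lambda>y. \<rho> y u v) x w + \<theta> x w * \<rho> x u v)" for u v w
  proof -
    have "pd (\<lambda>y. (pd (\<lambda>z. \<theta>c z v) y u - pd (\<lambda>z. \<theta>c z u) y v) * (h / 2)) x w =
        pd (\<lambda>y. \<mu> y * \<omega> y u v - t y * \<rho> y u v) x w"
    proof (rule fun_cong[OF pd_cong[OF open_S x]])
      fix y assume y: "y \<in> S"
      show "(pd (\<lambda>z. \<theta>c z v) y u - pd (\<lambda>z. \<theta>c z u) y v) * (h / 2) = \<mu> y * \<omega> y u v - t y * \<rho> y u v"
        unfolding ddc[OF y] using hess_eq[OF y, of u v] unfolding h_def by (simp add: mult.commute)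
    qed
    then show ?thesis
      by (simp add: pd_diff pd_mult differentiable_mult smooth_on_differentiable[OF _ x] t_smooth \<mu>_smooth
          kaehler_form_smooth ricci_form_smooth form_d_def)
  qed
  have e: "pd (\<lambda>y. (pd (\<lambda>z. \<theta>c z v) y u - pd (\<lambda>z. \<theta>c z u) y v) * (h / 2)) x w =
      (pd (\<lambda>y. pd (\<lambda>z. \<theta>c z v) y u) x w - pd (\<lambda>y. pd (\<lambda>z. \<theta>c z u) y v) x w) * (h / 2)" for u v w
  proof -
    have "(\<lambda>y. pd (\<lambda>z. \<theta>c z v) y u - pd (\<lambda>z. \<theta>c z u) y v) differentiable (at x)"
      by (intro differentiable_diff smooth_on_differentiable[OF smooth_on_pd[OF \<theta>c_smooth] x])
    from pd_linear_comp[OF bounded_linear_mult_left this, of "h / 2" w] show ?thesis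
      by (simp only: pd_diff[OF smooth_on_differentiable[OF smooth_on_pd[OF \<theta>c_smooth] x]
            smooth_on_differentiable[OF smooth_on_pd[OF \<theta>c_smooth] x]])
  qed
  define D where "D u v w = pd (\<lambda>y. pd (\<lambda>z. \<theta>c z v) y u) x w" for u v w
  have c: "D u v w = D w v u" for u v w unfolding D_def by (rule clairaut_real[OF open_S x \<theta>c_smooth])
  have "(D u v w - D v u w) * (h / 2) + (D v w u - D w v u) * (h / 2) + (D w u v - D u w v) * (h / 2) = 0"
    using c[of u v w] c[of v u w] c[of v w u] by (simp add: algebra_simps)
  moreover have "t x * pd (\<lambda>y. \<rho> y u v) x w + t x * pd (\<lambda>y. \<rho> y v w) x u + t x * pd (\<lambda>y. \<rho> y w u) x v = 0"
    using ricci_form_closed[OF x, of u v w] by (simp add: distrib_left[symmetric])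
  moreover have "\<mu> x * pd (\<lambda>y. \<omega> y u v) x w + \<mu> x * pd (\<lambda>y. \<omega> y v w) x u + \<mu> x * pd (\<lambda>y. \<omega> y w u) x v = 0"
    using kaehler_form_closed[OF x, of u v w] by (simp add: distrib_left[symmetric])
  ultimately show ?thesis
    using d[of v u w, unfolded e] d[of w v u, unfolded e] d[of u w v, unfolded e] unfolding D_def by linarith
qed

section \<open>The gradient and the regular points\<close>

definition V where "V x = sharp_vector (g x) (\<theta> x)"
definition Q where "Q x = form_norm_sq (g x) (\<theta> x)"
definition N where "N = {x \<in> S. \<theta> x \<noteq> (\<lambda>_. 0)}"

lemma g_V: "x \<in> S \<Longrightarrow> g x (V x) w = \<theta> x w"
  unfolding V_def by (rule sharp_vector_eq[OF g_ip \<theta>_linear])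

lemma V_smooth: "smooth_on S V"
  unfolding V_def[abs_def] by (rule smooth_on_sharp_vector[OF open_S g_ip g_smooth \<theta>_field])

lemma Q_eq: "Q x = g x (V x) (V x)"
  by (simp add: Q_def form_norm_sq_def V_def)

lemma Q_smooth: "smooth_on S Q"
  unfolding Q_eq[abs_def] by (intro smooth_on_apply2[OF open_S g_field] V_smooth)

lemma \<theta>_V: "x \<in> S \<Longrightarrow> \<theta> x (V x) = Q x"
  by (simp add: Q_eq g_V)

lemma \<theta>c_eq_g: "x \<in> S \<Longrightarrow> \<theta>c x w = g x (J x (V x)) w"
  using J_skew[of x "V x" w] by (simp add: \<theta>c_eq g_V)

lemma \<theta>c_V: "x \<in> S \<Longrightarrow> \<theta>c x (V x) = 0"
  by (simp add: \<theta>c_eq_g g_J_self)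

lemma \<theta>_JV: "x \<in> S \<Longrightarrow> \<theta> x (J x (V x)) = 0"
  using \<theta>c_V by (simp add: \<theta>c_eq)

lemma \<theta>c_JV: "x \<in> S \<Longrightarrow> \<theta>c x (J x (V x)) = Q x"
  by (simp add: \<theta>c_J \<theta>_V)

lemma N_subset: "N \<subseteq> S"
  by (auto simp: N_def)

lemma Q_pos: "x \<in> N \<Longrightarrow> Q x > 0"
proof -
  assume "x \<in> N"
  then have x: "x \<in> S" and "\<theta> x \<noteq> (\<lambda>_. 0)" by (auto simp: N_def)
  then obtain w where "\<theta> x w \<noteq> 0" by auto
  then have "V x \<noteq> 0" using g_V[OF x, of w] g_simps[OF x] by auto
  then show ?thesis unfolding Q_eq using inner_product_formD(3)[OF g_ip[OF x]] by blast
qed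

lemma Q_ne_0: "x \<in> N \<Longrightarrow> Q x \<noteq> 0"
  using Q_pos by force

lemma N_eq: "N = {x \<in> S. Q x \<noteq> 0}"
proof -
  have "Q x = 0" if "x \<in> S" "\<theta> x = (\<lambda>_. 0)" for x using \<theta>_V[OF that(1)] that(2) by simp
  then show ?thesis using Q_pos unfolding N_def by force
qed

lemma open_N: "open N"
proof -
  have "open (S \<inter> Q -` (- {0}))"
    by (rule continuous_open_preimage[OF smooth_on_continuous[OF Q_smooth] open_S]) auto
  moreover have "N = S \<inter> Q -` (- {0})" unfolding N_eq by auto
  ultimately show ?thesis by simp
qed

lemmas on_N = smooth_on_subset[OF _ N_subset]

text \<open>The covariant derivative of the gradient represents the Hessian.\<close>

lemma Q_pd:
  assumes x: "x \<in> S"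
  shows "pd Q x u = 2 * hess x u (V x)"
proof -
  have "pd (\<lambda>y. \<theta> y w) x u = pd (\<lambda>y. g y (V y) w) x u" for w
    by (rule fun_cong[OF pd_cong[OF open_S x]]) (simp add: g_V)
  also have "\<dots> w = pd (\<lambda>y. g y (V x) w) x u + g x (pd V x u) w" for w
    by (rule pd_apply[OF open_S x bilinear_field_left[OF g_field] V_smooth])
  finally have 1: "hess x u w = g x (pd V x u) w + g x (\<Gamma> x u (V x)) w" for w
    by (simp add: hess_def \<Gamma>_metric[OF x] g_V[OF x])
  have "pd Q x u = pd (\<lambda>y. g y (V x) (V x)) x u + g x (pd V x u) (V x) + g x (V x) (pd V x u)"
    unfolding Q_eq[abs_def] by (rule pd_apply2[OF open_S x g_field V_smooth V_smooth])
  then show ?thesis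
    unfolding 1 \<Gamma>_metric[OF x] using g_sym[OF x, of "V x"] by simp
qed

text \<open>On N, \<open>\<mu>'\<close> is the derivative of \<open>\<mu>\<close> with respect to t, while \<open>\<psi>\<close> is the eigenvalue of the Hessian
  orthogonally to V and J V, and \<open>\<psi> + \<kappa> Q\<close> the one on their span. In the end f is either zero or
  \<open>1/(2(t + const))\<close>.\<close>

definition \<mu>' where "\<mu>' x = pd \<mu> x (V x) / Q x"
definition \<psi> where "\<psi> x = (\<mu> x - t x * \<mu>' x) / (real DIM('e) - 2)"
definition \<kappa> where "\<kappa> x = (hess x (V x) (V x) - \<psi> x * Q x) / (Q x)\<^sup>2"
definition f where "f x = \<psi> x / Q x"
definition \<beta> where "\<beta> x w = \<theta>c x w / Q x"

lemma pd_\<mu>: "x \<in> N \<Longrightarrow> pd \<mu> x u = \<mu>' x * \<theta> x u"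
  using strong[of x "V x" u] \<theta>_V[of x] Q_pos[of x] N_subset
  by (auto simp: wedge_def \<mu>'_def form_d_def field_simps)

lemma \<mu>'_smooth: "smooth_on N \<mu>'"
proof -
  have "linear_field S (pd \<mu>)"
    unfolding linear_field_def using linear_pd[OF \<mu>_smooth] smooth_on_pd[OF \<mu>_smooth] by blast
  from smooth_on_apply[OF open_S this V_smooth] show ?thesis
    unfolding \<mu>'_def[abs_def] using Q_ne_0
    by (intro smooth_on_divide open_N on_N[OF Q_smooth] on_N) auto
qed

lemma \<psi>_smooth: "smooth_on N \<psi>"
  unfolding \<psi>_def[abs_def]
  using dim_ge_4 by (intro smooth_on_divide smooth_on_diff smooth_on_mult open_N on_N[OF t_smooth] on_N[OF \<mu>_smooth]
      \<mu>'_smooth smooth_on_const) auto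

lemma f_smooth: "smooth_on N f"
  unfolding f_def[abs_def] using Q_ne_0
  by (intro smooth_on_divide open_N \<psi>_smooth on_N[OF Q_smooth]) auto

lemma \<beta>_smooth: "smooth_on N (\<lambda>x. \<beta> x w)"
  unfolding \<beta>_def using Q_ne_0
  by (intro smooth_on_divide open_N on_N[OF \<theta>c_smooth] on_N[OF Q_smooth]) auto

text \<open>On vectors killed by \<open>dt\<close> the Ricci form is \<open>d\<mu>/dt\<close> times the Kaehler form, so that the Hessian
  is a multiple of the metric transversally to the gradient and its image under J.\<close>

lemma hess_transversal:
  assumes x: "x \<in> N" and u: "\<theta> x u = 0" and z: "\<theta>c x z = 0"
  shows "hess x u z = \<psi> x * g x u z"
proof -
  have S: "x \<in> S" using x N_subset by blast
  define w where "w = - J x z"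
  have w: "\<theta> x w = 0" "J x w = z" using z by (simp_all add: w_def \<theta>_simps[OF S] \<theta>c_eq J_simps[OF S] J_sq[OF S])
  have "Q x * \<rho> x u w = Q x * (\<mu>' x * \<omega> x u w)"
    using d\<theta>_\<rho>_eq_d\<mu>_\<omega>[OF S, of "V x" u w] by (simp add: \<theta>_V[OF S] pd_\<mu>[OF x] u w)
  then have r: "\<rho> x u w = \<mu>' x * \<omega> x u w" using Q_pos[OF x] by simp
  have "\<omega> x u w = - g x u z"
    using J_skew[OF S, of u w] by (simp add: kaehler_form_def w)
  then have "(real DIM('e) - 2) * hess x u z = (\<mu> x - t x * \<mu>' x) * g x u z"
    using hess_eq[OF S, of u w] by (simp add: r w algebra_simps)
  then show ?thesis using dim_ge_4 by (simp add: \<psi>_def field_simps)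
qed

text \<open>The Hessian minus \<open>\<psi> g\<close> is J-invariant and vanishes transversally.\<close>

lemma hess_formula:
  assumes x: "x \<in> N"
  shows "hess x u z = \<psi> x * g x u z + \<kappa> x * (\<theta> x u * \<theta> x z + \<theta>c x u * \<theta>c x z)"
proof -
  have S: "x \<in> S" using x N_subset by blast
  note h = hess_bilinear[OF S] inner_product_formD(1)[OF g_ip[OF S]]
  define B where "B u z = hess x u z - \<psi> x * g x u z" for u z
  have bil: "bilinear B"
    unfolding bilinear_def B_def
    by (intro conjI allI linearI)
      (simp_all add: bilinear_ladd[OF h(1)] bilinear_radd[OF h(1)] bilinear_lmul[OF h(1)]
        bilinear_rmul[OF h(1)] g_simps[OF S] algebra_simps)
  have "B u z = B (V x) (V x) / (Q x)\<^sup>2 * (\<theta> x u * \<theta> x z + \<theta>c x u * \<theta>c x z)"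
  proof (rule invariant_form_two_plane[OF bil, of "J x"])
    show "B u z = B z u" for u z unfolding B_def using hess_sym[OF S] g_sym[OF S] by metis
    show "B (J x (V x)) (J x (V x)) = B (V x) (V x)" unfolding B_def by (simp add: hess_J[OF S] J_iso[OF S])
    show "B u z = 0" if "\<theta> x u = 0" "\<theta>c x z = 0" for u z
      using hess_transversal[OF x that] by (simp add: B_def)
  qed (use \<theta>_linear[OF S] \<theta>c_linear[OF S] \<theta>_V[OF S] \<theta>c_V[OF S] \<theta>_JV[OF S] \<theta>c_JV[OF S] Q_pos[OF x] in auto)
  then show ?thesis unfolding \<kappa>_def B_def by (simp add: Q_eq)
qed

text \<open>V is an eigenvector of the Hessian, so dQ is proportional to dt.\<close>

lemma Q_pd_N:
  assumes x: "x \<in> N"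
  shows "pd Q x u = 2 * (\<psi> x + \<kappa> x * Q x) * \<theta> x u"
proof -
  have S: "x \<in> S" using x N_subset by blast
  show ?thesis
    using g_sym[OF S, of u "V x"] g_V[OF S, of u]
    by (simp add: Q_pd[OF S] hess_formula[OF x] \<theta>_V[OF S] \<theta>c_V[OF S] algebra_simps)
qed

lemma \<beta>_pd:
  assumes x: "x \<in> N"
  shows "pd (\<lambda>y. \<beta> y w) x u = (\<theta>c x (\<Gamma> x u w) - hess x u (J x w)) / Q x
    - 2 * \<theta>c x w * (\<psi> x + \<kappa> x * Q x) * \<theta> x u / (Q x)\<^sup>2"
proof -
  have S: "x \<in> S" using x N_subset by blast
  show ?thesis
    unfolding \<beta>_def using Q_pos[OF x]
    by (subst pd_divide)
      (simp_all add: smooth_on_differentiable[OF \<theta>c_smooth S] smooth_on_differentiable[OF Q_smooth S]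
        pd_\<theta>c[OF S] Q_pd_N[OF x])
qed

lemma hess_formula_J:
  assumes x: "x \<in> N"
  shows "hess x u (J x w) = - \<psi> x * \<omega> x u w + \<kappa> x * (\<theta>c x u * \<theta> x w - \<theta> x u * \<theta>c x w)"
proof -
  have S: "x \<in> S" using x N_subset by blast
  show ?thesis
    using J_skew[OF S, of u w]
    by (simp add: hess_formula[OF x] \<theta>c_J[OF S] kaehler_form_def \<theta>c_eq[of x w] algebra_simps)
qed

text \<open>The part of the Kaehler form orthogonal to V and J V.\<close>

definition transversal where "transversal x u w = \<omega> x u w - (\<theta> x u * \<beta> x w - \<theta> x w * \<beta> x u)"

text \<open>The term of the Hessian along the plane of V and J V is compensated by the derivative of the
  denominator, up to the multiple \<open>\<psi>\<close>.\<close>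

lemma d\<beta>:
  assumes x: "x \<in> N"
  shows "pd (\<lambda>y. \<beta> y w) x u - pd (\<lambda>y. \<beta> y u) x w = 2 * f x * transversal x u w"
proof -
  have S: "x \<in> S" using x N_subset by blast
  have Q: "Q x \<noteq> 0" using Q_pos[OF x] by simp
  have "\<omega> x w u = - \<omega> x u w" by (rule kaehler_form_skew[OF S])
  then show ?thesis
    unfolding \<beta>_pd[OF x] hess_formula_J[OF x] unfolding f_def transversal_def \<beta>_def using \<Gamma>_sym[OF S, of u w] Q
    by (simp add: field_simps power2_eq_square)
qed

lemma transversal_smooth: "smooth_on N (\<lambda>x. transversal x u w)"
  unfolding transversal_def
  by (intro smooth_on_diff smooth_on_mult open_N \<beta>_smooth on_N[OF kaehler_form_smooth] on_N[OF \<theta>_smooth])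

lemma transversal_pd_cyclic:
  assumes x: "x \<in> N"
  shows "pd (\<lambda>y. transversal y u v) x w + pd (\<lambda>y. transversal y v w) x u + pd (\<lambda>y. transversal y w u) x v =
    2 * f x * (\<theta> x w * transversal x u v + \<theta> x u * transversal x v w + \<theta> x v * transversal x w u)"
proof -
  have S: "x \<in> S" using x N_subset by blast
  define T where "T a b = pd (\<lambda>y. \<theta> y b) x a" for a b
  define b where "b a c = pd (\<lambda>y. \<beta> y c) x a" for a c
  have T: "T a c = T c a" for a c unfolding T_def by (rule pd_\<theta>_sym[OF S])
  have d: "(\<lambda>y. \<theta> y c) differentiable (at x)" "(\<lambda>y. \<beta> y c) differentiable (at x)"
    "(\<lambda>y. \<omega> y c c') differentiable (at x)" for c c'
    using smooth_on_differentiable[OF \<theta>_smooth S] smooth_on_differentiable[OF \<beta>_smooth x]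
      smooth_on_differentiable[OF kaehler_form_smooth S] by auto
  have p: "pd (\<lambda>y. transversal y u v) x w = pd (\<lambda>y. \<omega> y u v) x w
      - (\<theta> x u * b w v + T w u * \<beta> x v - (\<theta> x v * b w u + T w v * \<beta> x u))" for u v w
    unfolding transversal_def T_def b_def
    by (simp add: pd_diff pd_mult differentiable_diff differentiable_mult d)
  have b: "b a c - b c a = 2 * f x * transversal x a c" for a c
    unfolding b_def by (rule d\<beta>[OF x])
  have As: "transversal x a c = - transversal x c a" for a c
    unfolding transversal_def using kaehler_form_skew[OF S, of a c] by simp
  have "pd (\<lambda>y. transversal y u v) x w + pd (\<lambda>y. transversal y v w) x u + pd (\<lambda>y. transversal y w u) x v =
      - (\<theta> x u * (b w v - b v w) + \<theta> x v * (b u w - b w u) + \<theta> x w * (b v u - b u v))"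
    unfolding p using kaehler_form_closed[OF S, of u v w] T[of w u] T[of w v] T[of u v]
    by (simp add: algebra_simps)
  also have "\<dots> = 2 * f x * (\<theta> x w * transversal x u v + \<theta> x u * transversal x v w + \<theta> x v * transversal x w u)"
    unfolding b As[of w v] As[of u w] As[of v u] by (simp add: algebra_simps)
  finally show ?thesis .
qed

text \<open>This is \<open>d(d\<beta>) = 0\<close>.\<close>

lemma df_transversal_cyclic:
  assumes x: "x \<in> N"
  defines "\<gamma> \<equiv> \<lambda>w. pd f x w + 2 * (f x)\<^sup>2 * \<theta> x w"
  shows "\<gamma> w * transversal x u v + \<gamma> u * transversal x v w + \<gamma> v * transversal x w u = 0"
proof -
  have d: "f differentiable (at x)" "(\<lambda>y. transversal y u v) differentiable (at x)" for u v
    using smooth_on_differentiable[OF f_smooth x] smooth_on_differentiable[OF transversal_smooth x] by auto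
  have db: "(\<lambda>y. pd (\<lambda>z. \<beta> z v) y u) differentiable (at x)" for u v
    by (rule smooth_on_differentiable[OF smooth_on_pd[OF \<beta>_smooth] x])
  define D where "D u v w = pd (\<lambda>y. pd (\<lambda>z. \<beta> z v) y u) x w" for u v w
  have c: "D u v w = D w v u" for u v w unfolding D_def by (rule clairaut_real[OF open_N x \<beta>_smooth])
  have e: "D u v w - D v u w = 2 * (f x * pd (\<lambda>y. transversal y u v) x w + pd f x w * transversal x u v)" for u v w
  proof -
    have "D u v w - D v u w = pd (\<lambda>y. pd (\<lambda>z. \<beta> z v) y u - pd (\<lambda>z. \<beta> z u) y v) x w"
      unfolding D_def by (rule pd_diff[OF db db, symmetric])
    also have "\<dots> = pd (\<lambda>y. 2 * (f y * transversal y u v)) x w"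
      by (rule fun_cong[OF pd_cong[OF open_N x]]) (simp add: d\<beta>)
    also have "\<dots> = 2 * pd (\<lambda>y. f y * transversal y u v) x w"
      by (rule pd_linear_comp[OF bounded_linear_mult_right differentiable_mult[OF d]])
    finally show ?thesis by (simp only: pd_mult[OF d])
  qed
  have "f x * (pd (\<lambda>y. transversal y u v) x w + pd (\<lambda>y. transversal y v w) x u + pd (\<lambda>y. transversal y w u) x v)
      + (pd f x w * transversal x u v + pd f x u * transversal x v w + pd f x v * transversal x w u) = 0"
    using e[of u v w] e[of v w u] e[of w u v] c[of u v w] c[of v u w] c[of v w u]
    by (simp add: algebra_simps)
  then show ?thesis unfolding transversal_pd_cyclic[OF x] \<gamma>_def by (simp add: algebra_simps power2_eq_square)
qed

text \<open>The equation \<open>d\<mu> = \<mu>' dt\<close> implies \<open>d\<mu>' \<and> dt = 0\<close>.\<close>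

lemma pd_\<mu>':
  assumes x: "x \<in> N"
  shows "pd \<mu>' x u * Q x = pd \<mu>' x (V x) * \<theta> x u"
proof -
  have S: "x \<in> S" using x N_subset by blast
  have e: "pd (\<lambda>y. pd \<mu> y u) x w = \<mu>' x * pd (\<lambda>y. \<theta> y u) x w + pd \<mu>' x w * \<theta> x u" for u w
  proof -
    have "pd (\<lambda>y. pd \<mu> y u) x w = pd (\<lambda>y. \<mu>' y * \<theta> y u) x w"
      by (rule fun_cong[OF pd_cong[OF open_N x]]) (rule pd_\<mu>)
    also have "\<dots> = \<mu>' x * pd (\<lambda>y. \<theta> y u) x w + pd \<mu>' x w * \<theta> x u"
      by (rule pd_mult[OF smooth_on_differentiable[OF \<mu>'_smooth x] smooth_on_differentiable[OF \<theta>_smooth S]])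
    finally show ?thesis .
  qed
  have "pd (\<lambda>y. pd \<mu> y u) x w = pd (\<lambda>y. pd \<mu> y w) x u" for w
    by (rule clairaut_real[OF open_S S \<mu>_smooth])
  from this[of "V x"] show ?thesis
    unfolding e using pd_\<theta>_sym[OF S, of u "V x"] by (simp add: \<theta>_V[OF S])
qed

text \<open>Two linear conditions have a nonzero solution as the dimension is at least four.\<close>

lemma transversal_vector:
  assumes x: "x \<in> S"
  obtains e where "e \<noteq> 0" "\<theta> x e = 0" "\<theta> x (J x e) = 0"
proof -
  have rep: "\<exists>a. \<forall>e. l e = a \<bullet> e" if "linear l" for l :: "'e \<Rightarrow> real"
  proof (intro exI[of _ "\<Sum>b\<in>Basis. l b *\<^sub>R b"] allI)
    fix e
    have "l e = (\<Sum>b\<in>Basis. (e \<bullet> b) *\<^sub>R l b)" by (rule linear_expand[OF that])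
    then show "l e = (\<Sum>b\<in>Basis. l b *\<^sub>R b) \<bullet> e"
      by (simp add: inner_sum_left inner_commute[of e] mult.commute)
  qed
  obtain a where a: "\<And>e. \<theta> x e = a \<bullet> e" using rep[OF \<theta>_linear[OF x]] by blast
  obtain b where b: "\<And>e. \<theta>c x e = b \<bullet> e" using rep[OF \<theta>c_linear[OF x]] by blast
  have "dim {a, b} \<le> card {a, b}" by (rule dim_le_card') simp
  also have "\<dots> \<le> 2" by (simp add: card_insert_if)
  finally have "dim {a, b} < DIM('e)" using dim_ge_4 by linarith
  then obtain e where e: "e \<noteq> 0" "\<And>y. y \<in> span {a, b} \<Longrightarrow> orthogonal e y"
    using orthogonal_to_subspace_exists by blast
  have "\<theta> x e = 0" "\<theta>c x e = 0"
    using e(2)[of a] e(2)[of b] by (simp_all add: a b span_base orthogonal_def inner_commute)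
  then show ?thesis using e(1) that by (simp add: \<theta>c_eq)
qed

text \<open>Evaluating \<open>d(d\<beta>) = 0\<close> on V and a transversal complex line gives the derivative along V. The other derivatives vanish since \<open>\<psi>\<close> and Q have differentials proportional to dt.\<close>

lemma f_pd:
  assumes x: "x \<in> N"
  shows "pd f x u = - 2 * (f x)\<^sup>2 * \<theta> x u"
proof -
  have S: "x \<in> S" using x N_subset by blast
  have Q: "Q x \<noteq> 0" using Q_pos[OF x] by simp
  obtain e where e: "e \<noteq> 0" "\<theta> x e = 0" "\<theta> x (J x e) = 0" by (rule transversal_vector[OF S])
  have \<beta>J: "\<beta> x (J x e) = 0" by (simp add: \<beta>_def \<theta>c_J[OF S] e)
  have \<beta>e: "\<beta> x e = 0" by (simp add: \<beta>_def \<theta>c_eq e)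
  have "transversal x e (J x e) = g x e e" "transversal x (J x e) (V x) = 0" "transversal x (V x) e = 0"
    using g_sym[OF S, of e "V x"] g_V[OF S, of "J x e"] J_skew[OF S, of "V x" e] g_V[OF S, of e]
    by (simp_all add: transversal_def \<beta>J \<beta>e e kaehler_form_def J_iso[OF S] J_sq[OF S] g_simps[OF S])
  with df_transversal_cyclic[OF x, of "V x" e "J x e"] have "(pd f x (V x) + 2 * (f x)\<^sup>2 * Q x) * g x e e = 0"
    by (simp add: \<theta>_V[OF S])
  then have 1: "pd f x (V x) = - 2 * (f x)\<^sup>2 * Q x"
    using inner_product_formD(3)[OF g_ip[OF S] e(1)] by simp
  have d\<psi>: "pd \<psi> x u = pd \<psi> x (V x) / Q x * \<theta> x u" for u
  proof -
    have p: "pd \<psi> x u = - (t x * pd \<mu>' x u) / (real DIM('e) - 2)" for u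
    proof -
      have d: "\<mu> differentiable (at x)" "t differentiable (at x)" "\<mu>' differentiable (at x)"
        using smooth_on_differentiable[OF \<mu>_smooth S] smooth_on_differentiable[OF t_smooth S]
          smooth_on_differentiable[OF \<mu>'_smooth x] by auto
      have "pd \<psi> x u = pd (\<lambda>x. \<mu> x - t x * \<mu>' x) x u / (real DIM('e) - 2)"
        unfolding \<psi>_def[abs_def]
        by (rule pd_linear_comp[OF bounded_linear_divide differentiable_diff[OF d(1) differentiable_mult[OF d(2,3)]]])
      then show ?thesis
        by (simp add: pd_diff[OF d(1) differentiable_mult[OF d(2,3)]] pd_mult[OF d(2,3)] pd_\<mu>[OF x] form_d_def)
    qed
    have "pd \<mu>' x u = pd \<mu>' x (V x) / Q x * \<theta> x u" using pd_\<mu>'[OF x, of u] Q by (simp add: field_simps)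
    then show ?thesis unfolding p by (simp add: mult_ac)
  qed
  have df: "pd f x u = pd \<psi> x u / Q x - \<psi> x * pd Q x u / (Q x)\<^sup>2" for u
    unfolding f_def[abs_def] using Q
    by (intro pd_divide smooth_on_differentiable[OF \<psi>_smooth x] smooth_on_differentiable[OF Q_smooth S])
  have "pd f x u = pd f x (V x) / Q x * \<theta> x u"
    unfolding df d\<psi>[of u] Q_pd_N[OF x] \<theta>_V[OF S] using Q by (simp add: field_simps)
  then show ?thesis unfolding 1 using Q by simp
qed

text \<open>The right-hand side is a multiple of the function itself, as the Gronwall argument requires.\<close>

lemma first_integral_pd:
  assumes x: "x \<in> N"
  shows "pd (\<lambda>y. 2 * f y * (a * t y + b) - a) x u = (- 2 * f x * \<theta> x u) * (2 * f x * (a * t x + b) - a)"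
proof -
  have S: "x \<in> S" using x N_subset by blast
  have df: "(f has_derivative pd f x) (at x)" and dt: "(t has_derivative \<theta> x) (at x)"
    using smooth_on_has_derivative[OF f_smooth x] smooth_on_has_derivative[OF t_smooth S] by (auto simp: form_d_def)
  have "((\<lambda>y. 2 * f y * (a * t y + b) - a) has_derivative
      (\<lambda>u. 2 * f x * (a * \<theta> x u) + 2 * pd f x u * (a * t x + b))) (at x)"
    by (auto intro!: derivative_eq_intros df dt)
  then show ?thesis by (simp add: pd_eqI f_pd[OF x] algebra_simps power2_eq_square)
qed

text \<open>The covariant derivative of \<open>\<theta> \<and> \<beta>\<close> along u is
  \<open>f (\<theta> \<and> Ju + u \<and> \<theta>c) - 2f \<theta>(u) \<theta> \<and> \<beta>\<close>. By the relation between a, b and f the derivative of the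
  factor \<open>a t + b\<close> cancels the last term.\<close>

lemma nabla_chi:
  assumes x: "x \<in> N" and ab: "2 * f x * (a * t x + b) = a"
  defines "\<phi> \<equiv> \<lambda>y v w. (a * t y + b) * wedge (\<theta> y) (\<theta>c y) v w / form_norm_sq (g y) (\<theta> y)"
  shows "nabla_form2 g u \<phi> x v w =
    1/2 * (wedge (form_d (\<lambda>y. a * t y) x) (flat_form (g x) (J x u)) v w
      - wedge (form_dc J (\<lambda>y. a * t y) x) (flat_form (g x) u) v w)"
proof -
  have S: "x \<in> S" using x N_subset by blast
  have Q: "Q x \<noteq> 0" using Q_pos[OF x] by simp
  have \<phi>: "\<phi> y v w = (a * t y + b) * (\<theta> y v * \<beta> y w - \<theta> y w * \<beta> y v)" for y v w
    unfolding \<phi>_def wedge_def \<beta>_def Q_def by (simp add: diff_divide_distrib right_diff_distrib)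
  have dt: "t differentiable (at x)" by (rule smooth_on_differentiable[OF t_smooth S])
  have d: "(\<lambda>y. a * t y + b) differentiable (at x)" "(\<lambda>y. \<theta> y v) differentiable (at x)"
    "(\<lambda>y. \<beta> y v) differentiable (at x)" for v
    using smooth_on_differentiable[OF \<theta>_smooth S] smooth_on_differentiable[OF \<beta>_smooth x] dt by auto
  have dat: "pd (\<lambda>y. a * t y + b) x u = a * \<theta> x u"
    using pd_add[OF differentiable_mult[OF differentiable_const dt] differentiable_const, of a b]
      pd_linear_comp[OF bounded_linear_mult_right dt] by (simp add: form_d_def)
  have "pd (\<lambda>y. \<phi> y v w) x u =
      (a * t x + b) * (\<theta> x v * pd (\<lambda>y. \<beta> y w) x u + pd (\<lambda>y. \<theta> y v) x u * \<beta> x w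
        - (\<theta> x w * pd (\<lambda>y. \<beta> y v) x u + pd (\<lambda>y. \<theta> y w) x u * \<beta> x v))
      + a * \<theta> x u * (\<theta> x v * \<beta> x w - \<theta> x w * \<beta> x v)"
    unfolding \<phi> by (simp add: pd_mult pd_diff differentiable_mult differentiable_diff d dat)
  then have n: "nabla_form2 g u \<phi> x v w =
      (a * t x + b) * (\<theta> x v * (pd (\<lambda>y. \<beta> y w) x u - \<beta> x (\<Gamma> x u w)) + hess x u v * \<beta> x w
        - (\<theta> x w * (pd (\<lambda>y. \<beta> y v) x u - \<beta> x (\<Gamma> x u v)) + hess x u w * \<beta> x v))
      + a * \<theta> x u * (\<theta> x v * \<beta> x w - \<theta> x w * \<beta> x v)"
    unfolding nabla_form2_def \<phi> hess_def by (simp add: algebra_simps)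
  have \<beta>n: "pd (\<lambda>y. \<beta> y w) x u - \<beta> x (\<Gamma> x u w) =
      f x * \<omega> x u w - \<kappa> x * \<theta>c x u * \<theta> x w / Q x - (2 * f x + \<kappa> x) * \<theta> x u * \<beta> x w" for w
    unfolding \<beta>_pd[OF x] hess_formula_J[OF x] unfolding \<beta>_def f_def using Q
    by (simp add: field_simps power2_eq_square)
  have hn: "hess x u v * \<beta> x w = f x * g x u v * \<theta>c x w + \<kappa> x * (\<theta> x u * \<theta> x v * \<beta> x w + \<theta>c x u * \<theta>c x v * \<beta> x w)" for v w
    unfolding hess_formula[OF x] \<beta>_def f_def by (simp add: algebra_simps)
  have "nabla_form2 g u \<phi> x v w =
      (f x * (a * t x + b)) * (\<theta> x v * \<omega> x u w - \<theta> x w * \<omega> x u v + g x u v * \<theta>c x w - g x u w * \<theta>c x v)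
      + (a - 2 * f x * (a * t x + b)) * \<theta> x u * (\<theta> x v * \<beta> x w - \<theta> x w * \<beta> x v)"
    unfolding n \<beta>n hn unfolding \<beta>_def by (simp add: algebra_simps add_divide_distrib)
  also have "\<dots> = a / 2 * (\<theta> x v * \<omega> x u w - \<theta> x w * \<omega> x u v + g x u v * \<theta>c x w - g x u w * \<theta>c x v)"
  proof -
    have 1: "f x * (a * t x + b) = a / 2" "a - 2 * f x * (a * t x + b) = 0" using ab by simp_all
    show ?thesis unfolding 1 by simp
  qed
  finally show ?thesis
    using pd_linear_comp[OF bounded_linear_mult_right dt, of a]
    by (simp add: wedge_def flat_form_def kaehler_form_def form_dc_def J_form_def form_d_def algebra_simps)
qed

section \<open>Unique continuation\<close>

definition D2 where "D2 x a b = pd (\<lambda>y. \<theta> y b) x a"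

lemma D2_field: "bilinear_field S D2"
  unfolding D2_def[abs_def] by (rule bilinear_field_pd[OF open_S \<theta>_field])

text \<open>J-invariance of the Hessian, written with second coordinate derivatives, holds up to the value of
  dt on this vector.\<close>

definition christoffel_defect where "christoffel_defect x b z = \<Gamma> x (J x b) (J x z) - \<Gamma> x b z"

lemma christoffel_defect_field: "linear_field S (\<lambda>x b. christoffel_defect x b z)"
  unfolding linear_field_def
proof (intro conjI ballI allI)
  fix x assume x: "x \<in> S"
  show "linear (\<lambda>b. christoffel_defect x b z)"
    unfolding christoffel_defect_def by (rule linearI) (simp_all add: J_simps[OF x] \<Gamma>_simps[OF x] algebra_simps)
next
  fix w show "smooth_on S (\<lambda>x. christoffel_defect x w z)"
    unfolding christoffel_defect_def by (intro smooth_on_diff open_S smooth_on_apply2[OF open_S \<Gamma>_field] J_smooth \<Gamma>_smooth)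
qed

text \<open>The terms of lower order that appear when J-invariance of the Hessian is differentiated; they are
  linear in the first and second derivatives of t.\<close>

definition D3_defect where "D3_defect x u w z = D2 x u (christoffel_defect x w z) + \<theta> x (pd (\<lambda>y. christoffel_defect y w z) x u)
  - D2 x (pd (\<lambda>y. J y w) x u) (J x z) - D2 x (J x w) (pd (\<lambda>y. J y z) x u)"

definition D3 where "D3 x u w z = pd (\<lambda>y. D2 y w z) x u"

lemma D3_sym:
  assumes x: "x \<in> S"
  shows "D3 x u w z = D3 x w u z" "D3 x u w z = D3 x u z w"
proof -
  show "D3 x u w z = D3 x w u z"
    unfolding D3_def D2_def by (rule clairaut_real[OF open_S x \<theta>_smooth])
  show "D3 x u w z = D3 x u z w"
    unfolding D3_def by (rule fun_cong[OF pd_cong[OF open_S x]]) (simp add: D2_def pd_\<theta>_sym)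
qed

lemma D3_J:
  assumes x: "x \<in> S"
  shows "D3 x u (J x w) (J x z) = D3 x u w z + D3_defect x u w z"
proof -
  have h: "D2 y (J y w) (J y z) = D2 y w z + \<theta> y (christoffel_defect y w z)" if "y \<in> S" for y
    using hess_J[OF that, of w z] unfolding hess_def D2_def christoffel_defect_def by (simp add: \<theta>_simps[OF that])
  have "pd (\<lambda>y. D2 y (J y w) (J y z)) x u = pd (\<lambda>y. D2 y w z + \<theta> y (christoffel_defect y w z)) x u"
    by (rule fun_cong[OF pd_cong[OF open_S x h]])
  also have "\<dots> = pd (\<lambda>y. D2 y w z) x u + pd (\<lambda>y. \<theta> y (christoffel_defect y w z)) x u"
    by (intro pd_add smooth_on_differentiable[OF bilinear_field_smooth[OF D2_field] x]
        smooth_on_differentiable[OF smooth_on_apply[OF open_S \<theta>_field linear_field_smooth[OF christoffel_defect_field]] x])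
  also have "pd (\<lambda>y. \<theta> y (christoffel_defect y w z)) x u = D2 x u (christoffel_defect x w z) + \<theta> x (pd (\<lambda>y. christoffel_defect y w z) x u)"
    unfolding D2_def by (rule pd_apply[OF open_S x \<theta>_field linear_field_smooth[OF christoffel_defect_field]])
  finally show ?thesis
    unfolding pd_apply2[OF open_S x D2_field J_smooth J_smooth] by (simp add: D3_def D3_defect_def)
qed

text \<open>A totally symmetric trilinear form that is invariant under J in two arguments vanishes. Here the
  invariance holds up to lower order, so the third derivatives of t are expressed by the lower ones.
  This is the counterpart of the fact that a Killing field is determined by its 1-jet.\<close>

lemma D3_eq:
  assumes x: "x \<in> S"
  shows "2 * D3 x u w z = - D3_defect x u w z - D3_defect x z u w - D3_defect x (J x w) (J x u) z"
proof -
  have "bilinear (D3 x (J x w))"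
    unfolding D3_def[abs_def] by (rule bilinear_pd_bilinear_field[OF open_S x D2_field])
  then have n: "D3 x (J x w) (J x (J x u)) (J x z) = - D3 x (J x w) u (J x z)"
    by (simp add: J_sq[OF x] bilinear_lneg)
  have "D3 x (J x w) (J x u) z = D3 x z (J x u) (J x w)"
    using D3_sym(2)[OF x, of "J x w" "J x u" z] D3_sym(1)[OF x, of "J x w" z "J x u"]
      D3_sym(2)[OF x, of z "J x w" "J x u"] by (rule trans[OF trans])
  moreover have "D3 x u (J x w) (J x z) = D3 x (J x w) u (J x z)" by (rule D3_sym[OF x])
  moreover have "D3 x z u w = D3 x u w z"
    using D3_sym(1)[OF x, of z u w] D3_sym(2)[OF x, of u z w] by (rule trans)
  ultimately show ?thesis
    using D3_J[OF x, of u w z] D3_J[OF x, of "J x w" "J x u" z] D3_J[OF x, of z u w] n by linarith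
qed

text \<open>The first and second partial derivatives of t form one finite family of functions, as the lemma
  on common zeros requires: \<open>None\<close> marks the first ones.\<close>

definition jet_index :: "('e option \<times> 'e) set" where
  "jet_index = insert None (Some ` Basis) \<times> Basis"

definition jet :: "'e option \<times> 'e \<Rightarrow> 'e \<Rightarrow> real" where
  "jet i x = (case fst i of None \<Rightarrow> \<theta> x (snd i) | Some a \<Rightarrow> D2 x a (snd i))"

definition jet_size where "jet_size x = (\<Sum>i\<in>jet_index. \<bar>jet i x\<bar>)"

lemma jet_le_size: "i \<in> jet_index \<Longrightarrow> \<bar>jet i x\<bar> \<le> jet_size x"
  unfolding jet_size_def by (rule member_le_sum) (auto simp: jet_index_def)

lemma sum_Basis_le:
  fixes l :: "'e \<Rightarrow> real"
  assumes "linear l" "\<And>b. b \<in> Basis \<Longrightarrow> \<bar>l b\<bar> \<le> C"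
  shows "\<bar>l a\<bar> \<le> real DIM('e) * norm a * C"
proof -
  have "\<bar>l a\<bar> = \<bar>\<Sum>b\<in>Basis. (a \<bullet> b) * l b\<bar>" using linear_expand[OF assms(1), of a] by simp
  also have "\<dots> \<le> (\<Sum>b\<in>(Basis::'e set). norm a * C)"
    by (intro order_trans[OF sum_abs] sum_mono) (auto simp: abs_mult intro!: mult_mono Basis_le_norm assms(2))
  finally show ?thesis by simp
qed

lemma \<theta>_le_jet_size: "x \<in> S \<Longrightarrow> \<bar>\<theta> x a\<bar> \<le> real DIM('e) * norm a * jet_size x"
  using jet_le_size[of "(None, b)" x for b]
  by (intro sum_Basis_le \<theta>_linear) (auto simp: jet_index_def jet_def)

lemma D2_le_jet_size:
  assumes x: "x \<in> S"
  shows "\<bar>D2 x a b\<bar> \<le> (real DIM('e))\<^sup>2 * norm a * norm b * jet_size x"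
proof -
  note bil = bilinear_field_bilinear[OF D2_field x]
  have 1: "\<bar>D2 x c d\<bar> \<le> jet_size x" if "c \<in> Basis" "d \<in> Basis" for c d
    using jet_le_size[of "(Some c, d)" x] that by (auto simp: jet_index_def jet_def)
  have "\<bar>D2 x c b\<bar> \<le> real DIM('e) * norm b * jet_size x" if "c \<in> Basis" for c
    using bil 1[OF that] by (intro sum_Basis_le[of "D2 x c"]) (auto simp: bilinear_def)
  then have "\<bar>D2 x a b\<bar> \<le> real DIM('e) * norm a * (real DIM('e) * norm b * jet_size x)"
    using bil by (intro sum_Basis_le[of "\<lambda>a. D2 x a b"]) (auto simp: bilinear_def)
  then show ?thesis by (simp add: power2_eq_square mult_ac)
qed

text \<open>The factor in the estimate of the defect by the size of the 2-jet; its continuity in x matters.\<close>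

definition defect_bound where
  "defect_bound x u w z = (real DIM('e))\<^sup>2 * norm u * norm (christoffel_defect x w z)
    + real DIM('e) * norm (pd (\<lambda>y. christoffel_defect y w z) x u)
    + (real DIM('e))\<^sup>2 * norm (pd (\<lambda>y. J y w) x u) * norm (J x z)
    + (real DIM('e))\<^sup>2 * norm (J x w) * norm (pd (\<lambda>y. J y z) x u)"

lemma D3_defect_le: "x \<in> S \<Longrightarrow> \<bar>D3_defect x u w z\<bar> \<le> defect_bound x u w z * jet_size x"
  using D2_le_jet_size[of x u "christoffel_defect x w z"] \<theta>_le_jet_size[of x "pd (\<lambda>y. christoffel_defect y w z) x u"]
    D2_le_jet_size[of x "pd (\<lambda>y. J y w) x u" "J x z"] D2_le_jet_size[of x "J x w" "pd (\<lambda>y. J y z) x u"]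
  unfolding D3_defect_def defect_bound_def distrib_right by linarith

lemma defect_bound_continuous:
  assumes Y: "smooth_on S Y" and Z: "smooth_on S Z"
  shows "continuous_on S (\<lambda>x. defect_bound x (Y x) (Z x) z)"
proof -
  have "smooth_on S (\<lambda>x. christoffel_defect x (Z x) z)" "smooth_on S (\<lambda>x. pd (\<lambda>y. christoffel_defect y (Z x) z) x (Y x))"
    "smooth_on S (\<lambda>x. pd (\<lambda>y. J y (Z x)) x (Y x))" "smooth_on S (\<lambda>x. J x z)" "smooth_on S (\<lambda>x. J x (Z x))"
    "smooth_on S (\<lambda>x. pd (\<lambda>y. J y z) x (Y x))"
    using smooth_on_apply[OF open_S christoffel_defect_field Z]
      smooth_on_apply2[OF open_S bilinear_field_pd[OF open_S christoffel_defect_field] Y Z]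
      smooth_on_apply2[OF open_S bilinear_field_pd[OF open_S J_field] Y Z] J_smooth
      smooth_on_apply[OF open_S J_field Z]
      smooth_on_apply2[OF open_S bilinear_field_pd[OF open_S J_field] Y smooth_on_const] by blast+
  note c = this[THEN smooth_on_continuous] smooth_on_continuous[OF Y]
  show ?thesis
    unfolding defect_bound_def by (intro continuous_on_add continuous_on_mult continuous_on_const continuous_on_norm c)
qed

lemma unique_continuation:
  assumes x0: "x0 \<in> S" and 1: "\<And>u. \<theta> x0 u = 0" and 2: "\<And>u v. D2 x0 u v = 0"
  obtains r where "r > 0" "ball x0 r \<subseteq> S" "\<And>y. y \<in> ball x0 r \<Longrightarrow> \<theta> y = (\<lambda>_. 0)"
proof -
  define n where "n = (real DIM('e))\<^sup>2"
  define k :: "'e option \<times> 'e \<Rightarrow> 'e \<Rightarrow> 'e \<Rightarrow> real" where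
    "k i b x = (case fst i of None \<Rightarrow> n
      | Some a \<Rightarrow> defect_bound x b a (snd i) + defect_bound x (snd i) b a + defect_bound x (J x a) (J x b) (snd i))" for i b x
  obtain r where r: "r > 0" "ball x0 r \<subseteq> S" "\<And>i y. i \<in> jet_index \<Longrightarrow> y \<in> ball x0 r \<Longrightarrow> jet i y = 0"
  proof (rule common_zeros_spread[of jet_index S x0 jet k])
    show "finite jet_index" by (simp add: jet_index_def)
    show "open S" "x0 \<in> S" using open_S x0 by auto
    fix i assume i: "i \<in> jet_index"
    have sm: "smooth_on S (jet i)"
      unfolding jet_def[abs_def]
      using \<theta>_smooth bilinear_field_smooth[OF D2_field] by (cases "fst i") auto
    show "jet i differentiable (at x)" if "x \<in> S" for x by (rule smooth_on_differentiable[OF sm that])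
    show "jet i x0 = 0" using 1 2 by (simp add: jet_def split: option.split)
    fix b :: 'e assume b: "b \<in> Basis"
    show "continuous_on S (k i b)"
    proof (cases "fst i")
      case None
      then show ?thesis by (simp add: k_def[abs_def])
    next
      case (Some a)
      have "continuous_on S (\<lambda>x. defect_bound x b a (snd i) + defect_bound x (snd i) b a + defect_bound x (J x a) (J x b) (snd i))"
        by (intro continuous_on_add defect_bound_continuous smooth_on_const J_smooth)
      then show ?thesis using Some by (simp add: k_def[abs_def])
    qed
    fix x assume x: "x \<in> S"
    have "\<bar>pd (jet i) x b\<bar> \<le> k i b x * jet_size x"
    proof (cases "fst i")
      case None
      have "norm b = 1" "norm (snd i) = 1" using i b by (auto simp: jet_index_def)
      moreover have "pd (jet i) x b = D2 x b (snd i)" using None by (simp add: jet_def[abs_def] D2_def)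
      ultimately show ?thesis using D2_le_jet_size[OF x, of b "snd i"] None by (simp add: k_def n_def)
    next
      case (Some a)
      then have "pd (jet i) x b = D3 x b a (snd i)" by (simp add: jet_def[abs_def] D3_def)
      then show ?thesis
        using D3_eq[OF x, of b a "snd i"] D3_defect_le[OF x, of b a "snd i"] D3_defect_le[OF x, of "snd i" b a]
          D3_defect_le[OF x, of "J x a" "J x b" "snd i"] Some
        unfolding k_def by (simp add: distrib_right)
    qed
    then show "\<bar>pd (jet i) x b\<bar> \<le> k i b x * (\<Sum>j\<in>jet_index. \<bar>jet j x\<bar>)" unfolding jet_size_def .
  qed blast
  show ?thesis
  proof (rule that[OF r(1,2)])
    fix y assume y: "y \<in> ball x0 r"
    then have "y \<in> S" using r by blast
    have b0: "\<theta> y b = 0" if "b \<in> Basis" for b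
      using r(3)[of "(None, b)", OF _ y] that by (simp add: jet_index_def jet_def)
    show "\<theta> y = (\<lambda>_. 0)"
    proof
      fix a
      have "\<theta> y a = (\<Sum>b\<in>Basis. (a \<bullet> b) *\<^sub>R \<theta> y b)" by (rule linear_expand[OF \<theta>_linear[OF \<open>y \<in> S\<close>]])
      also have "\<dots> = 0" by (rule sum.neutral) (simp add: b0)
      finally show "\<theta> y a = 0" .
    qed
  qed
qed

end

section \<open>Complements of common zero sets of two independent functions\<close>

text \<open>The complement is the union of four half balls, each of which meets the next.\<close>

lemma connected_ball_minus_codim_2:
  fixes L1 L2 :: "'e::euclidean_space \<Rightarrow> real"
  assumes l: "linear L1" "linear L2"
    and u: "L1 u1 = 1" "L1 u2 = 0" "L2 u1 = 0" "L2 u2 = 1"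
    and y: "L1 y0 = 0" "L2 y0 = 0" and r: "r > 0"
  shows "connected (ball y0 r - {y. L1 y = 0 \<and> L2 y = 0})"
proof -
  define H where "H l s = ball y0 r \<inter> {y. 0 < s * l y}" for l :: "'e \<Rightarrow> real" and s :: real
  have conv: "connected (H l s)" if "linear l" for l s
  proof (rule convex_connected)
    have "{y. 0 < s * l y} = (\<lambda>y. s * l y) -` {0<..}" by auto
    moreover have "linear (\<lambda>y. s * l y)"
      using that by (auto intro!: linearI simp: linear_add linear_cmul algebra_simps)
    then have "convex ((\<lambda>y. s * l y) -` {0<..})" by (rule convex_linear_vimage) (rule convex_real_interval)
    ultimately have "convex {y. 0 < s * l y}" by simp
    then show "convex (H l s)" unfolding H_def by (intro convex_Int convex_ball)
  qed
  define d where "d = r / (norm u1 + norm u2 + 1)"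
  have np: "norm u1 + norm u2 + 1 > 0" by (simp add: add_nonneg_pos)
  then have d: "d > 0" using r by (simp add: d_def)
  have meet: "H L1 s \<inter> H L2 s' \<noteq> {}" if "\<bar>s\<bar> = 1" "\<bar>s'\<bar> = 1" for s s'
  proof -
    define w where "w = d *\<^sub>R (s *\<^sub>R u1 + s' *\<^sub>R u2)"
    have "norm w \<le> d * (norm u1 + norm u2)"
      unfolding w_def using d that norm_triangle_ineq[of "s *\<^sub>R u1" "s' *\<^sub>R u2"] by simp
    also have "\<dots> < d * (norm u1 + norm u2 + 1)" using d by simp
    also have "\<dots> = r" using np by (simp add: d_def)
    finally have "y0 + w \<in> ball y0 r" by (simp add: dist_norm)
    moreover have "s * s = 1" "s' * s' = 1" using abs_mult_self_eq[of s] abs_mult_self_eq[of s'] that by simp_all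
    then have "s * L1 (y0 + w) = d" "s' * L2 (y0 + w) = d"
      unfolding w_def using u y by (simp_all add: linear_add[OF l(1)] linear_add[OF l(2)] linear_cmul[OF l(1)] linear_cmul[OF l(2)])
    ultimately have "y0 + w \<in> H L1 s \<inter> H L2 s'" using d by (simp add: H_def)
    then show ?thesis by blast
  qed
  have "connected (H L1 1 \<union> H L2 1)" by (rule connected_Un) (simp_all add: conv l meet)
  then have "connected (H L1 1 \<union> H L2 1 \<union> H L1 (-1))"
    by (rule connected_Un) (use meet[of "-1" 1] conv[OF l(1)] in auto)
  then have "connected (H L1 1 \<union> H L2 1 \<union> H L1 (-1) \<union> H L2 (-1))"
    by (rule connected_Un) (use meet[of 1 "-1"] conv[OF l(2)] in auto)
  moreover have "ball y0 r - {y. L1 y = 0 \<and> L2 y = 0} = H L1 1 \<union> H L2 1 \<union> H L1 (-1) \<union> H L2 (-1)"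
    unfolding H_def by auto
  ultimately show ?thesis by simp
qed

text \<open>The map h below has derivative the identity at the base point, and it carries \<open>f1\<close> and \<open>f2\<close> to
  linear functions; the inverse function theorem reduces the claim to a ball without a linear
  subspace of codimension two.\<close>

lemma complement_of_independent_zeros:
  fixes f1 f2 :: "'e::euclidean_space \<Rightarrow> real"
  assumes S: "open S" "x0 \<in> S" and f: "smooth_on S f1" "smooth_on S f2"
    and z: "f1 x0 = 0" "f2 x0 = 0"
    and u: "pd f1 x0 u1 = 1" "pd f1 x0 u2 = 0" "pd f2 x0 u1 = 0" "pd f2 x0 u2 = 1"
  obtains B B0 where "open B" "x0 \<in> B" "B \<subseteq> S" "connected B0" "B0 \<subseteq> B"
    "\<And>x. x \<in> B0 \<Longrightarrow> f1 x \<noteq> 0 \<or> f2 x \<noteq> 0" "\<And>W. open W \<Longrightarrow> W \<inter> B \<noteq> {} \<Longrightarrow> W \<inter> B0 \<noteq> {}"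
proof -
  define L1 L2 where "L1 = pd f1 x0" and "L2 = pd f2 x0"
  have l: "linear L1" "linear L2" unfolding L1_def L2_def using linear_pd[OF f(1) S(2)] linear_pd[OF f(2) S(2)] by auto
  have ul: "L1 u1 = 1" "L1 u2 = 0" "L2 u1 = 0" "L2 u2 = 1" using u by (simp_all add: L1_def L2_def)
  have bl: "bounded_linear L1" "bounded_linear L2" using l linear_conv_bounded_linear by blast+
  define h where "h x = x + (f1 x - L1 x) *\<^sub>R u1 + (f2 x - L2 x) *\<^sub>R u2" for x
  define h' where "h' x v = v + (pd f1 x v - L1 v) *\<^sub>R u1 + (pd f2 x v - L2 v) *\<^sub>R u2" for x v
  have dh: "(h has_derivative h' x) (at x)" if "x \<in> S" for x
    unfolding h_def[abs_def] h'_def[abs_def]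
    by (intro has_derivative_add has_derivative_ident has_derivative_scaleR_left has_derivative_diff
        smooth_on_has_derivative[OF f(1) that] smooth_on_has_derivative[OF f(2) that]
        bounded_linear_imp_has_derivative bl)
  define F where "F x = Blinfun (h' x)" for x
  have F: "blinfun_apply (F x) = h' x" if "x \<in> S" for x
    unfolding F_def by (rule bounded_linear_Blinfun_apply[OF has_derivative_bounded_linear[OF dh[OF that]]])
  have contF: "continuous_on S F"
  proof (rule continuous_on_blinfun_componentwise)
    fix i :: 'e
    have "continuous_on S (\<lambda>x. h' x i)"
      unfolding h'_def
      by (intro continuous_on_add continuous_on_scaleR continuous_on_diff continuous_on_const
          smooth_on_continuous[OF smooth_on_pd] f)
    then show "continuous_on S (\<lambda>x. blinfun_apply (F x) i)"
      by (rule continuous_on_eq) (simp add: F)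
  qed
  have id: "id_blinfun o\<^sub>L F x0 = id_blinfun"
    by (rule blinfun_eqI) (simp add: F[OF S(2)] h'_def L1_def L2_def)
 have der: "(h has_derivative blinfun_apply (F x)) (at x)" if "x \<in> S" for x
    using dh[OF that] F[OF that] by simp
  obtain U V k where U: "open U" "U \<subseteq> S" "x0 \<in> U" and V: "open V" "h x0 \<in> V" and hom: "homeomorphism U V h k"
    by (rule inverse_function_theorem[OF S(1) _ contF S(2) id]) (erule der, rule that)
  obtain r where r: "r > 0" "ball (h x0) r \<subseteq> V" using V open_contains_ball by blast
  have L: "L1 (h x) = f1 x" "L2 (h x) = f2 x" for x
    unfolding h_def
    by (simp_all add: linear_add[OF l(1)] linear_add[OF l(2)] linear_cmul[OF l(1)] linear_cmul[OF l(2)] ul)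
  define K where "K = ball (h x0) r - {y. L1 y = 0 \<and> L2 y = 0}"
  have K: "connected K"
    unfolding K_def by (rule connected_ball_minus_codim_2[OF l ul]) (simp_all add: L z r)
  have kV: "k y \<in> U" "h (k y) = y" if "y \<in> V" for y using hom that by (auto simp: homeomorphism_def)
  have hU: "h x \<in> V" "k (h x) = x" if "x \<in> U" for x using hom that by (auto simp: homeomorphism_def)
  have ck: "continuous_on V k" and ch: "continuous_on U h" using hom by (auto simp: homeomorphism_def)
  have KV: "K \<subseteq> V" using r unfolding K_def by blast
  define B where "B = U \<inter> h -` ball (h x0) r"
  show ?thesis
  proof (rule that[of B "k ` K"])
    show "open B" unfolding B_def by (rule continuous_open_preimage[OF ch U(1)]) simp
    show "x0 \<in> B" "B \<subseteq> S" using U r unfolding B_def by auto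
    show "connected (k ` K)" by (rule connected_continuous_image[OF continuous_on_subset[OF ck KV] K])
    show "k ` K \<subseteq> B" using kV KV unfolding B_def K_def by auto
    show "f1 x \<noteq> 0 \<or> f2 x \<noteq> 0" if "x \<in> k ` K" for x
    proof -
      from that obtain y where y: "y \<in> K" "x = k y" by blast
      then have "h x = y" using kV(2) KV by blast
      then show ?thesis using y(1) L(1)[of x] L(2)[of x] unfolding K_def by auto
    qed
    fix W assume W: "open W" "W \<inter> B \<noteq> {}"
    then obtain x where x: "x \<in> W" "x \<in> B" by blast
    \<comment> \<open>Moving h x in the direction u1 leaves the codimension two set.\<close>
    have "open (ball (h x0) r \<inter> k -` W)"
      by (rule continuous_open_preimage[OF continuous_on_subset[OF ck r(2)] open_ball W(1)])
    moreover have "h x \<in> ball (h x0) r \<inter> k -` W" using x hU unfolding B_def by auto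
    ultimately obtain e where e: "e > 0" "cball (h x) e \<subseteq> ball (h x0) r \<inter> k -` W"
      using open_contains_cball by blast
    define s where "s = e / (norm u1 + 1)"
    have n1: "norm u1 + 1 > 0" by (simp add: add_nonneg_pos)
    have s: "s > 0" "s * norm u1 \<le> e" using e n1 by (auto simp: s_def field_simps)
    have c: "h x + a *\<^sub>R u1 \<in> cball (h x) e" if "0 \<le> a" "a \<le> s" for a
    proof -
      have "a * norm u1 \<le> s * norm u1" using that by (intro mult_right_mono) auto
      then show ?thesis using s that by (simp add: dist_norm)
    qed
    have "L1 (h x + a *\<^sub>R u1) = L1 (h x) + a" for a
      by (simp add: linear_add[OF l(1)] linear_cmul[OF l(1)] ul)
    then have "L1 (h x + 0 *\<^sub>R u1) \<noteq> 0 \<or> L1 (h x + s *\<^sub>R u1) \<noteq> 0" using s by auto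
    then obtain a where a: "0 \<le> a" "a \<le> s" "L1 (h x + a *\<^sub>R u1) \<noteq> 0" using s(1) by (metis less_imp_le order_refl)
    then have "h x + a *\<^sub>R u1 \<in> K" "k (h x + a *\<^sub>R u1) \<in> W" using subsetD[OF e(2) c[OF a(1,2)]] a(3) unfolding K_def by auto
    then show "W \<inter> k ` K \<noteq> {}" by blast
  qed
qed

context einstein_domain
begin

text \<open>A nonzero symmetric form has a vector \<open>u0\<close> with nonzero square. By J-invariance of the Hessian, the
  components of dt along \<open>u0\<close> and \<open>J u0\<close> have independent differentials. The second vector is
  fixed at its value at the critical point, so that both are components along constant fields.\<close>

lemma critical_point_complement:
  assumes x0: "x0 \<in> S" and crit: "x0 \<notin> N" and D2: "D2 x0 u v \<noteq> 0"
  obtains B B0 where "open B" "x0 \<in> B" "B \<subseteq> S" "connected B0" "B0 \<subseteq> B" "B0 \<subseteq> N"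
    "\<And>W. open W \<Longrightarrow> W \<inter> B \<noteq> {} \<Longrightarrow> W \<inter> B0 \<noteq> {}"
proof -
  have \<theta>0: "\<theta> x0 w = 0" for w using crit x0 by (simp add: N_def)
  have hD: "hess x0 a b = D2 x0 a b" for a b unfolding hess_def D2_def \<theta>0 by simp
  note hb = hess_bilinear[OF x0]
  have "\<exists>u0. hess x0 u0 u0 \<noteq> 0"
  proof (rule ccontr)
    assume "\<not> ?thesis"
    then have "hess x0 w w = 0" for w by blast
    from this[of "u + v"] this[of u] this[of v] have "hess x0 u v = 0"
      using hess_sym[OF x0, of u v] by (simp add: bilinear_ladd[OF hb] bilinear_radd[OF hb])
    then show False using D2 hD by simp
  qed
  then obtain u0 where u0: "hess x0 u0 u0 \<noteq> 0" by blast
  define q where "q = hess x0 u0 u0"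
  define u1 where "u1 = J x0 u0"
  have J: "hess x0 u1 u1 = q" unfolding u1_def q_def by (rule hess_J[OF x0])
  have "hess x0 u0 u1 = - hess x0 u1 u0"
    using hess_J[OF x0, of u0 u1] unfolding u1_def by (simp add: J_sq[OF x0] bilinear_rneg[OF hb])
  then have J0: "hess x0 u0 u1 = 0" "hess x0 u1 u0 = 0" using hess_sym[OF x0, of u0 u1] by simp_all
  have p: "pd (\<lambda>x. \<theta> x w / q) x0 a = hess x0 a w / q" for w a
    unfolding hD D2_def
    by (rule pd_linear_comp[OF bounded_linear_divide smooth_on_differentiable[OF \<theta>_smooth x0]])
  have sm: "smooth_on S (\<lambda>x. \<theta> x w / q)" for w
    using u0 unfolding q_def by (intro smooth_on_divide open_S \<theta>_smooth smooth_on_const) auto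
  obtain B B0 where B: "open B" "x0 \<in> B" "B \<subseteq> S" "connected B0" "B0 \<subseteq> B"
    "\<And>x. x \<in> B0 \<Longrightarrow> \<theta> x u0 / q \<noteq> 0 \<or> \<theta> x u1 / q \<noteq> 0"
    "\<And>W. open W \<Longrightarrow> W \<inter> B \<noteq> {} \<Longrightarrow> W \<inter> B0 \<noteq> {}"
    by (rule complement_of_independent_zeros[OF open_S x0 sm[of u0] sm[of u1], of u0 u1])
      (use u0 in \<open>auto simp: p J J0 \<theta>0 q_def[symmetric]\<close>)
  have "B0 \<subseteq> N"
  proof
    fix x assume x: "x \<in> B0"
    then have "x \<in> S" using B(3,5) by blast
    moreover have "\<theta> x \<noteq> (\<lambda>_. 0)" using B(6)[OF x] by auto
    ultimately show "x \<in> N" by (simp add: N_def)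
  qed
  then show ?thesis by (rule that[OF B(1-5) _ B(7)])
qed

end

section \<open>Passing between charts\<close>

locale einstein_manifold =
  fixes \<A> :: "('a::{t2_space, second_countable_topology}, 'e::euclidean_space) chart set"
    and g :: "('a, 'e) bilinear_field" and J :: "('a, 'e) endo_field" and \<tau> \<mu> :: "'a \<Rightarrow> real"
  assumes dim: "DIM('e) \<ge> 4"
    and kaehler: "kaehler_manifold \<A> g J"
    and \<tau>: "smooth_function_on \<A> UNIV \<tau>" and \<mu>: "smooth_function_on \<A> UNIV \<mu>"
    and eq: "\<And>c x u v. c \<in> \<A> \<Longrightarrow> x \<in> snd c ` fst c \<Longrightarrow>
      (real DIM('e) - 2) * nabla_form1 (g c) u (form_dc (J c) (local_rep c \<tau>)) x v =
        - local_rep c \<tau> x * ricci_form (g c) (J c) x u v + local_rep c \<mu> x * kaehler_form (g c) (J c) x u v"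
    and strong_eq: "\<And>c x u v. c \<in> \<A> \<Longrightarrow> x \<in> snd c ` fst c \<Longrightarrow>
      wedge (form_d (local_rep c \<tau>) x) (form_d (local_rep c \<mu>) x) u v = 0"
begin

abbreviation \<tau>c where "\<tau>c c \<equiv> local_rep c \<tau>"
abbreviation \<mu>c where "\<mu>c c \<equiv> local_rep c \<mu>"
abbreviation T where "T c d p \<equiv> pd (transition c d) (snd c p)"

lemma atlas: "smooth_atlas \<A>"
  using kaehler by (simp add: kaehler_manifold_def)

lemma chart:
  assumes "c \<in> \<A>"
  shows "open (fst c)" "open (snd c ` fst c)" "homeomorphism (fst c) (snd c ` fst c) (snd c) (chart_inv c)"
  using atlas assms by (auto simp: smooth_atlas_def)

lemma chart_ex: obtains c where "c \<in> \<A>" "p \<in> fst c"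
  using atlas unfolding smooth_atlas_def by blast

lemma chart_inv_left: "c \<in> \<A> \<Longrightarrow> p \<in> fst c \<Longrightarrow> chart_inv c (snd c p) = p"
  and chart_inv_right: "c \<in> \<A> \<Longrightarrow> x \<in> snd c ` fst c \<Longrightarrow> snd c (chart_inv c x) = x"
  and chart_inv_in: "c \<in> \<A> \<Longrightarrow> x \<in> snd c ` fst c \<Longrightarrow> chart_inv c x \<in> fst c"
  and chart_continuous: "c \<in> \<A> \<Longrightarrow> continuous_on (fst c) (snd c)"
  and chart_inv_continuous: "c \<in> \<A> \<Longrightarrow> continuous_on (snd c ` fst c) (chart_inv c)"
  using chart(3)[of c] by (auto simp: homeomorphism_def)

lemma chart_preimage_open: "c \<in> \<A> \<Longrightarrow> open W \<Longrightarrow> open (fst c \<inter> snd c -` W)"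
  by (rule continuous_open_preimage[OF chart_continuous chart(1)])

lemma chart_image_open:
  assumes "c \<in> \<A>" "open U"
  shows "open (snd c ` (fst c \<inter> U))"
proof -
  have "open (snd c ` fst c \<inter> chart_inv c -` U)"
    by (rule continuous_open_preimage[OF chart_inv_continuous chart(2)]) (use assms in auto)
  moreover have "snd c ` fst c \<inter> chart_inv c -` U = snd c ` (fst c \<inter> U)"
    using chart_inv_left[OF assms(1)] by auto
  ultimately show ?thesis by simp
qed

lemma chart_domain:
  assumes c: "c \<in> \<A>"
  shows "einstein_domain (snd c ` fst c) (g c) (J c) (\<tau>c c) (\<mu>c c)"
proof
  show "open (snd c ` fst c)" by (rule chart(2)[OF c])
  show "bilinear_field (snd c ` fst c) (g c)"
    using kaehler c by (auto simp: kaehler_manifold_def riemannian_metric_def smooth_bilinear_field_on_def bilinear_field_def)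
  show "inner_product_form (g c x)" if "x \<in> snd c ` fst c" for x
    using kaehler c that unfolding kaehler_manifold_def riemannian_metric_def by blast
  show "linear_field (snd c ` fst c) (J c)"
    using kaehler c by (auto simp: kaehler_manifold_def smooth_endo_field_def linear_field_def)
  show "J c x (J c x u) = - u" "g c x (J c x u) (J c x v) = g c x u v" "nabla_endo (g c) u (J c) x v = 0"
    if "x \<in> snd c ` fst c" for x u v
    using kaehler c that unfolding kaehler_manifold_def by blast+
  show "smooth_on (snd c ` fst c) (\<tau>c c)" "smooth_on (snd c ` fst c) (\<mu>c c)"
    using \<tau> \<mu> c by (auto simp: smooth_function_on_def)
qed (fact dim eq[OF c] strong_eq[OF c])+

lemma transition_smooth: "c \<in> \<A> \<Longrightarrow> d \<in> \<A> \<Longrightarrow> smooth_on (snd c ` (fst c \<inter> fst d)) (transition c d)"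
  using atlas by (auto simp: smooth_atlas_def)

lemma transition_point: "c \<in> \<A> \<Longrightarrow> p \<in> fst c \<Longrightarrow> transition c d (snd c p) = snd d p"
  by (simp add: transition_def chart_inv_left)

lemma transition_has_derivative:
  assumes "c \<in> \<A>" "d \<in> \<A>" "p \<in> fst c" "p \<in> fst d"
  shows "(transition c d has_derivative T c d p) (at (snd c p))"
  using transition_smooth[OF assms(1,2)] assms(3,4) by (intro smooth_on_has_derivative) auto

lemma pd_transition:
  fixes F :: "'a \<Rightarrow> real"
  assumes c: "c \<in> \<A>" "d \<in> \<A>" and p: "p \<in> fst c" "p \<in> fst d"
    and F: "local_rep d F differentiable (at (snd d p))"
  shows "pd (local_rep c F) (snd c p) u = pd (local_rep d F) (snd d p) (T c d p u)"
proof -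
  have O: "open (snd c ` (fst c \<inter> fst d))" "snd c p \<in> snd c ` (fst c \<inter> fst d)"
    using chart_image_open[OF c(1) chart(1)[OF c(2)]] p by auto
  have "(local_rep d F has_derivative pd (local_rep d F) (snd d p)) (at (transition c d (snd c p)))"
    using F frechet_derivative_works transition_point[OF c(1) p(1)] by metis
  then have "((\<lambda>y. local_rep d F (transition c d y)) has_derivative
      (\<lambda>u. pd (local_rep d F) (snd d p) (T c d p u))) (at (snd c p))"
    by (rule has_derivative_compose[OF transition_has_derivative[OF c p]])
  then have "(local_rep c F has_derivative (\<lambda>u. pd (local_rep d F) (snd d p) (T c d p u))) (at (snd c p))"
  proof (rule has_derivative_transform_within_open[OF _ O])
    fix y assume "y \<in> snd c ` (fst c \<inter> fst d)"
    then obtain q where "q \<in> fst c" "q \<in> fst d" "y = snd c q" by blast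
    then show "local_rep d F (transition c d y) = local_rep c F y"
      using c by (simp add: local_rep_def transition_point chart_inv_left)
  qed
  then show ?thesis by (simp add: pd_eqI)
qed

lemma T_inverse:
  assumes c: "c \<in> \<A>" "d \<in> \<A>" and p: "p \<in> fst c" "p \<in> fst d"
  shows "T d c p (T c d p u) = u"
proof -
  have O: "open (snd c ` (fst c \<inter> fst d))" "snd c p \<in> snd c ` (fst c \<inter> fst d)"
    using chart_image_open[OF c(1) chart(1)[OF c(2)]] p by auto
  have "(transition d c has_derivative T d c p) (at (transition c d (snd c p)))"
    using transition_has_derivative[OF c(2,1) p(2,1)] transition_point[OF c(1) p(1)] by simp
  then have "((\<lambda>y. transition d c (transition c d y)) has_derivative (\<lambda>u. T d c p (T c d p u))) (at (snd c p))"
    by (rule has_derivative_compose[OF transition_has_derivative[OF c p]])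
  then have "((\<lambda>y. y) has_derivative (\<lambda>u. T d c p (T c d p u))) (at (snd c p))"
  proof (rule has_derivative_transform_within_open[OF _ O])
    fix y assume "y \<in> snd c ` (fst c \<inter> fst d)"
    then obtain q where "q \<in> fst c" "q \<in> fst d" "y = snd c q" by blast
    then show "transition d c (transition c d y) = y" using c by (simp add: transition_point)
  qed
  from has_derivative_unique[OF this has_derivative_ident] show ?thesis by (rule fun_cong)
qed

lemma g_transition:
  assumes "c \<in> \<A>" "d \<in> \<A>" "p \<in> fst c" "p \<in> fst d"
  shows "g c (snd c p) u v = g d (snd d p) (T c d p u) (T c d p v)"
  using kaehler assms
  unfolding kaehler_manifold_def riemannian_metric_def smooth_bilinear_field_on_def Let_def by blast

lemma J_transition:
  assumes "c \<in> \<A>" "d \<in> \<A>" "p \<in> fst c" "p \<in> fst d"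
  shows "T c d p (J c (snd c p) u) = J d (snd d p) (T c d p u)"
  using kaehler assms unfolding kaehler_manifold_def smooth_endo_field_def Let_def by blast

abbreviation N where "N \<equiv> noncritical_set \<A> \<tau>"
abbreviation Nc where "Nc c \<equiv> einstein_domain.N (snd c ` fst c) (\<tau>c c)"
abbreviation Vc where "Vc c \<equiv> einstein_domain.V (g c) (\<tau>c c)"
abbreviation Qc where "Qc c \<equiv> einstein_domain.Q (g c) (\<tau>c c)"
abbreviation fc where "fc c \<equiv> einstein_domain.f (g c) (\<tau>c c) (\<mu>c c)"

context
  fixes c d p
  assumes c: "c \<in> \<A>" and d: "d \<in> \<A>" and p: "p \<in> fst c" "p \<in> fst d"
begin

interpretation C: einstein_domain "snd c ` fst c" "g c" "J c" "\<tau>c c" "\<mu>c c" by (rule chart_domain[OF c])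
interpretation D: einstein_domain "snd d ` fst d" "g d" "J d" "\<tau>c d" "\<mu>c d" by (rule chart_domain[OF d])

lemma x_in: "snd c p \<in> snd c ` fst c" "snd d p \<in> snd d ` fst d"
  using p by auto

lemma form_d_transition: "form_d (\<tau>c c) (snd c p) u = form_d (\<tau>c d) (snd d p) (T c d p u)"
  unfolding form_d_def by (rule pd_transition[OF c d p smooth_on_differentiable[OF D.t_smooth x_in(2)]])

lemma d\<mu>_transition: "pd (\<mu>c c) (snd c p) u = pd (\<mu>c d) (snd d p) (T c d p u)"
  by (rule pd_transition[OF c d p smooth_on_differentiable[OF D.\<mu>_smooth x_in(2)]])

lemma form_dc_transition: "form_dc (J c) (\<tau>c c) (snd c p) u = form_dc (J d) (\<tau>c d) (snd d p) (T c d p u)"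
  unfolding C.\<theta>c_eq D.\<theta>c_eq form_d_transition J_transition[OF c d p] ..

lemma \<tau>_transition: "\<tau>c c (snd c p) = \<tau> p" "\<mu>c c (snd c p) = \<mu> p"
  using c p by (simp_all add: local_rep_def chart_inv_left)

text \<open>Every vector is the image of one in the other chart, so the image of the gradient has the
  defining property of the gradient.\<close>

lemma V_transition: "Vc d (snd d p) = T c d p (Vc c (snd c p))"
  unfolding D.V_def
proof (rule sharp_vector_unique[OF D.g_ip[OF x_in(2)]])
  fix w
  define w' where "w' = T d c p w"
  have w: "w = T c d p w'" unfolding w'_def by (rule T_inverse[OF d c p(2,1), symmetric])
  show "g d (snd d p) (T c d p (Vc c (snd c p))) w = form_d (\<tau>c d) (snd d p) w"
    unfolding w g_transition[OF c d p, symmetric] form_d_transition[symmetric] by (rule C.g_V[OF x_in(1)])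
qed

lemma Q_transition: "Qc c (snd c p) = Qc d (snd d p)"
  unfolding C.Q_eq D.Q_eq V_transition by (rule g_transition[OF c d p])

lemma Nc_transition: "snd c p \<in> Nc c \<longleftrightarrow> snd d p \<in> Nc d"
  unfolding C.N_eq D.N_eq using x_in Q_transition by simp

end

lemma f_transition:
  assumes c: "c \<in> \<A>" "d \<in> \<A>" and p: "p \<in> fst c" "p \<in> fst d"
  shows "fc c (snd c p) = fc d (snd d p)"
proof -
  interpret C: einstein_domain "snd c ` fst c" "g c" "J c" "\<tau>c c" "\<mu>c c" by (rule chart_domain[OF c(1)])
  interpret D: einstein_domain "snd d ` fst d" "g d" "J d" "\<tau>c d" "\<mu>c d" by (rule chart_domain[OF c(2)])
  have "C.\<mu>' (snd c p) = D.\<mu>' (snd d p)"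
    unfolding C.\<mu>'_def D.\<mu>'_def Q_transition[OF c p] V_transition[OF c p] d\<mu>_transition[OF c p] ..
  then show ?thesis
    unfolding C.f_def D.f_def C.\<psi>_def D.\<psi>_def Q_transition[OF c p] \<tau>_transition[OF c(1,1) p(1,1)]
      \<tau>_transition[OF c(2,2) p(2,2)] by simp
qed

lemma N_iff:
  assumes c: "c \<in> \<A>" and p: "p \<in> fst c"
  shows "p \<in> N \<longleftrightarrow> snd c p \<in> Nc c"
proof -
  have 1: "snd d p \<in> Nc d \<longleftrightarrow> form_d (\<tau>c d) (snd d p) \<noteq> (\<lambda>_. 0)" if "d \<in> \<A>" "p \<in> fst d" for d
    unfolding einstein_domain.N_def[OF chart_domain[OF that(1)]] using that(2) by auto
  show ?thesis
  proof
    assume "p \<in> N"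
    then obtain d where d: "d \<in> \<A>" "p \<in> fst d" "form_d (\<tau>c d) (snd d p) \<noteq> (\<lambda>_. 0)"
      unfolding noncritical_set_def by blast
    then show "snd c p \<in> Nc c" using 1[OF d(1,2)] Nc_transition[OF c d(1) p d(2)] by simp
  next
    assume "snd c p \<in> Nc c"
    then show "p \<in> N" unfolding noncritical_set_def using 1[OF c p] c p by blast
  qed
qed

lemma N_chart: "c \<in> \<A> \<Longrightarrow> snd c ` (fst c \<inter> N) = Nc c"
  using N_iff[of c] einstein_domain.N_subset[OF chart_domain[of c]] by fastforce

lemma open_N: "open N"
proof -
  have "N = (\<Union>c\<in>\<A>. fst c \<inter> snd c -` Nc c)"
  proof
    show "N \<subseteq> (\<Union>c\<in>\<A>. fst c \<inter> snd c -` Nc c)"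
    proof
      fix p assume p: "p \<in> N"
      obtain c where "c \<in> \<A>" "p \<in> fst c" by (rule chart_ex)
      then show "p \<in> (\<Union>c\<in>\<A>. fst c \<inter> snd c -` Nc c)" using N_iff p by auto
    qed
    show "(\<Union>c\<in>\<A>. fst c \<inter> snd c -` Nc c) \<subseteq> N" using N_iff by auto
  qed
  moreover have "open (fst c \<inter> snd c -` Nc c)" if "c \<in> \<A>" for c
    by (rule chart_preimage_open[OF that einstein_domain.open_N[OF chart_domain[OF that]]])
  ultimately show ?thesis by auto
qed

section \<open>Connectedness of the set of regular points\<close>

abbreviation D2c where "D2c c \<equiv> einstein_domain.D2 (\<tau>c c)"

lemma zero_jet_imp_locally_critical:
  assumes c: "c \<in> \<A>" and p: "p \<in> fst c" "p \<notin> N" and D2: "\<And>u v. D2c c (snd c p) u v = 0"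
  shows "p \<notin> closure N"
proof -
  interpret C: einstein_domain "snd c ` fst c" "g c" "J c" "\<tau>c c" "\<mu>c c" by (rule chart_domain[OF c])
  have x: "snd c p \<in> snd c ` fst c" using p by simp
  have "form_d (\<tau>c c) (snd c p) u = 0" for u
    using p(2) N_iff[OF c p(1)] x unfolding C.N_def by simp
  from C.unique_continuation[OF x this D2] obtain r
    where r: "r > 0" "\<And>y. y \<in> ball (snd c p) r \<Longrightarrow> form_d (\<tau>c c) y = (\<lambda>_. 0)" by metis
  have "open (fst c \<inter> snd c -` ball (snd c p) r)" by (rule chart_preimage_open[OF c open_ball])
  moreover have "p \<in> fst c \<inter> snd c -` ball (snd c p) r" using p r by simp
  moreover have "(fst c \<inter> snd c -` ball (snd c p) r) \<inter> N = {}"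
  proof -
    have "q \<notin> N" if q: "q \<in> fst c" "snd c q \<in> ball (snd c p) r" for q
      using N_iff[OF c q(1)] r(2)[OF q(2)] unfolding C.N_def by simp
    then show ?thesis by blast
  qed
  ultimately show ?thesis using open_Int_closure_eq_empty by blast
qed

text \<open>A point of the complement's closure inherits the vanishing of the 2-jet of \<open>\<tau>\<close> by continuity, and by
  unique continuation it is then interior to the critical set.\<close>

lemma closure_N_open: "open (closure N)"
proof -
  have "closure (- closure N) \<subseteq> - closure N"
  proof
    fix p assume p: "p \<in> closure (- closure N)"
    show "p \<in> - closure N"
    proof (rule ccontr)
      assume "\<not> ?thesis"
      then have pN: "p \<in> closure N" by simp
      obtain c where c: "c \<in> \<A>" "p \<in> fst c" by (rule chart_ex)
      interpret C: einstein_domain "snd c ` fst c" "g c" "J c" "\<tau>c c" "\<mu>c c" by (rule chart_domain[OF c(1)])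
      \<comment> \<open>Both the differential and its derivative vanish on an open set accumulating at p.\<close>
      have zero: "h (snd c p) = 0"
        if h: "continuous_on (snd c ` fst c) h"
          and z: "\<And>q. q \<in> fst c \<Longrightarrow> q \<notin> closure N \<Longrightarrow> h (snd c q) = 0" for h :: "'e \<Rightarrow> real"
      proof (rule ccontr)
        assume ne: "h (snd c p) \<noteq> 0"
        have o: "open (snd c ` fst c \<inter> h -` (- {0}))"
          by (rule continuous_open_preimage[OF h chart(2)[OF c(1)]]) auto
        have "open (fst c \<inter> snd c -` (snd c ` fst c \<inter> h -` (- {0})))" by (rule chart_preimage_open[OF c(1) o])
        moreover have "p \<in> fst c \<inter> snd c -` (snd c ` fst c \<inter> h -` (- {0}))" using c ne by simp
        ultimately have "(fst c \<inter> snd c -` (snd c ` fst c \<inter> h -` (- {0}))) \<inter> (- closure N) \<noteq> {}"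
          using p open_Int_closure_eq_empty by blast
        then obtain q where "q \<in> fst c" "h (snd c q) \<noteq> 0" "q \<notin> closure N" by auto
        then show False using z by blast
      qed
      have \<theta>0: "form_d (\<tau>c c) (snd c q) u = 0" if q: "q \<in> fst c" "q \<notin> closure N" for q u
      proof -
        have "q \<notin> N" using q(2) closure_subset by blast
        then show ?thesis using N_iff[OF c(1) q(1)] q(1) unfolding C.N_def by auto
      qed
      have D20: "D2c c (snd c q) u v = 0" if q: "q \<in> fst c" "q \<notin> closure N" for q u v
      proof -
        have "open (fst c \<inter> - closure N)" using chart(1)[OF c(1)] by auto
        then have o: "open (snd c ` (fst c \<inter> - closure N))" using chart_image_open[OF c(1), of "- closure N"] by auto
        have "pd (\<lambda>y. form_d (\<tau>c c) y v) (snd c q) = pd (\<lambda>y. 0) (snd c q)"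
          by (rule pd_cong[OF o]) (use q \<theta>0 in auto)
        then show ?thesis unfolding C.D2_def by simp
      qed
      have "form_d (\<tau>c c) (snd c p) u = 0" for u
        by (rule zero[OF smooth_on_continuous[OF C.\<theta>_smooth] \<theta>0])
      moreover have "D2c c (snd c p) u v = 0" for u v
        by (rule zero[OF smooth_on_continuous[OF bilinear_field_smooth[OF C.D2_field]] D20])
      moreover have "p \<notin> N" using N_iff[OF c] calculation(1) unfolding C.N_def by auto
      ultimately show False using zero_jet_imp_locally_critical[OF c] pN by blast
    qed
  qed
  then have "closed (- closure N)" by (simp only: closure_subset_eq)
  then show ?thesis by (simp add: closed_def)
qed

context
  assumes conn: "connected (UNIV :: 'a set)"
begin

lemma N_dense:
  assumes "N \<noteq> {}"
  shows "closure N = UNIV"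
proof -
  have "closure N \<inter> UNIV = {} \<or> - closure N \<inter> UNIV = {}"
    by (rule connectedD[OF conn closure_N_open]) auto
  then show ?thesis using assms closure_subset[of N] by auto
qed

text \<open>If N were the union of two separated parts, their closures would meet, as N is dense and the
  manifold connected. Near a common limit point, necessarily critical, the regular points contain a
  dense connected set, which reaches both parts.\<close>

lemma N_connected: "connected N"
  unfolding connected_def
proof (rule notI, elim exE conjE)
  fix A B :: "'a set"
  assume o: "open A" "open B" and cov: "N \<subseteq> A \<union> B" and dj: "A \<inter> B \<inter> N = {}" and ne: "A \<inter> N \<noteq> {}" "B \<inter> N \<noteq> {}"
  have "UNIV = closure N" using N_dense ne by auto
  also have "N = (A \<inter> N) \<union> (B \<inter> N)" using cov by auto
  finally have cl: "UNIV = closure (A \<inter> N) \<union> closure (B \<inter> N)" by (simp add: closure_Un)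
  have "closure (A \<inter> N) \<inter> closure (B \<inter> N) \<noteq> {}"
  proof
    assume "closure (A \<inter> N) \<inter> closure (B \<inter> N) = {}"
    then have "- closure (A \<inter> N) \<inter> UNIV = {} \<or> - closure (B \<inter> N) \<inter> UNIV = {}"
      using cl by (intro connectedD[OF conn]) auto
    with \<open>closure (A \<inter> N) \<inter> closure (B \<inter> N) = {}\<close> show False
      using ne closure_subset[of "A \<inter> N"] closure_subset[of "B \<inter> N"] by auto
  qed
  then obtain p where p: "p \<in> closure (A \<inter> N)" "p \<in> closure (B \<inter> N)" by blast
  have oN: "open (A \<inter> N)" "open (B \<inter> N)" using o open_N by auto
  have "p \<notin> A \<inter> N" "p \<notin> B \<inter> N"
    using open_Int_closure_eq_empty[OF oN(1), of "B \<inter> N"] open_Int_closure_eq_empty[OF oN(2), of "A \<inter> N"] p dj by blast+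
  then have pN: "p \<notin> N" using cov by blast
  obtain c where c: "c \<in> \<A>" "p \<in> fst c" by (rule chart_ex)
  interpret C: einstein_domain "snd c ` fst c" "g c" "J c" "\<tau>c c" "\<mu>c c" by (rule chart_domain[OF c(1)])
  have x: "snd c p \<in> snd c ` fst c" "snd c p \<notin> C.N" using c pN N_iff[OF c] by auto
  have "p \<in> closure N" using N_dense ne by blast
  then obtain u v where "D2c c (snd c p) u v \<noteq> 0"
    using zero_jet_imp_locally_critical[OF c pN] by blast
  then obtain W W0 where W: "open W" "snd c p \<in> W" "W \<subseteq> snd c ` fst c" "connected W0" "W0 \<subseteq> W" "W0 \<subseteq> C.N"
    and dense: "\<And>U. open U \<Longrightarrow> U \<inter> W \<noteq> {} \<Longrightarrow> U \<inter> W0 \<noteq> {}"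
    using C.critical_point_complement[OF x] by blast
  define K where "K = chart_inv c ` W0"
  have cK: "connected K"
    unfolding K_def using W by (intro connected_continuous_image[OF continuous_on_subset[OF chart_inv_continuous[OF c(1)]]]) auto
  have KN: "K \<subseteq> N"
  proof
    fix q assume "q \<in> K"
    then obtain y where y: "y \<in> W0" "q = chart_inv c y" unfolding K_def by blast
    then have "y \<in> snd c ` fst c" using W by blast
    then have "q \<in> fst c" "snd c q = y" using y c chart_inv_in chart_inv_right by auto
    then show "q \<in> N" using N_iff[OF c(1)] y(1) W(6) by auto
  qed
  \<comment> \<open>The connected set K of regular points comes close to p from both sides.\<close>
  have meet: "U \<inter> K \<noteq> {}" if U: "open U" "p \<in> closure U" for U
  proof -
    have "open (fst c \<inter> snd c -` W)" "p \<in> fst c \<inter> snd c -` W"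
      using chart_preimage_open[OF c(1) W(1)] c W by auto
    then have "(fst c \<inter> snd c -` W) \<inter> U \<noteq> {}" using U(2) open_Int_closure_eq_empty by blast
    then obtain q where q: "q \<in> fst c" "snd c q \<in> W" "q \<in> U" by blast
    then have "snd c ` (fst c \<inter> U) \<inter> W \<noteq> {}" by blast
    then obtain y where y: "y \<in> W0" "y \<in> snd c ` (fst c \<inter> U)" using dense[OF chart_image_open[OF c(1) U(1)]] by blast
    then have "chart_inv c y \<in> U" using chart_inv_left[OF c(1)] by auto
    then show ?thesis using y unfolding K_def by blast
  qed
  have "A \<inter> K = {} \<or> B \<inter> K = {}"
    by (rule connectedD[OF cK o]) (use KN cov dj in blast)+
  then show False using meet[OF oN(1) p(1)] meet[OF oN(2) p(2)] by blast
qed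

section \<open>The constants\<close>

text \<open>With the constants fixed by the value of f at one regular point, the first integral vanishes there;
  the set of its zeros is closed in N by continuity and open by the Gronwall inequality.\<close>

lemma constants_exist:
  obtains a b where "\<not> (a = 0 \<and> b = 0)"
    "\<And>c p. c \<in> \<A> \<Longrightarrow> p \<in> fst c \<Longrightarrow> p \<in> N \<Longrightarrow> 2 * fc c (snd c p) * (a * \<tau> p + b) = a"
proof (cases "N = {}")
  case True
  then show ?thesis using that[of 1 0] by simp
next
  case False
  then obtain p0 where p0: "p0 \<in> N" by blast
  obtain c0 where c0: "c0 \<in> \<A>" "p0 \<in> fst c0" by (rule chart_ex)
  define a where "a = 2 * fc c0 (snd c0 p0)"
  \<comment> \<open>Normalised by \<open>a \<tau> + b = 1\<close> at \<open>p0\<close>, which also covers the case \<open>f = 0\<close>.\<close>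
  define b where "b = 1 - a * \<tau> p0"
  define F where "F c x = 2 * fc c x * (a * \<tau>c c x + b) - a" for c x
  define Z where "Z = {p \<in> N. \<exists>c\<in>\<A>. p \<in> fst c \<and> F c (snd c p) = 0}"
  have F_trans: "F c (snd c p) = F d (snd d p)" if "c \<in> \<A>" "d \<in> \<A>" "p \<in> fst c" "p \<in> fst d" for c d p
    using f_transition[OF that] that by (simp add: F_def local_rep_def chart_inv_left)
  have Z: "p \<in> Z \<longleftrightarrow> p \<in> N \<and> F c (snd c p) = 0" if "c \<in> \<A>" "p \<in> fst c" for c p
  proof
    assume "p \<in> Z"
    then obtain d where "p \<in> N" "d \<in> \<A>" "p \<in> fst d" "F d (snd d p) = 0" unfolding Z_def by blast
    then show "p \<in> N \<and> F c (snd c p) = 0" using F_trans[of c d p] that by simp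
  next
    assume "p \<in> N \<and> F c (snd c p) = 0"
    then show "p \<in> Z" unfolding Z_def using that by blast
  qed
  have F_smooth: "smooth_on (Nc c) (F c)" if c: "c \<in> \<A>" for c
  proof -
    interpret C: einstein_domain "snd c ` fst c" "g c" "J c" "\<tau>c c" "\<mu>c c" by (rule chart_domain[OF c])
    show ?thesis
      unfolding F_def[abs_def]
      by (intro smooth_on_diff smooth_on_mult smooth_on_add smooth_on_const C.open_N C.f_smooth
          C.on_N[OF C.t_smooth])
  qed
  have "open Z"
    unfolding open_subopen[of Z]
  proof
    fix p assume p: "p \<in> Z"
    obtain c where c: "c \<in> \<A>" "p \<in> fst c" by (rule chart_ex)
    interpret C: einstein_domain "snd c ` fst c" "g c" "J c" "\<tau>c c" "\<mu>c c" by (rule chart_domain[OF c(1)])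
    have pN: "snd c p \<in> Nc c" and Fp: "F c (snd c p) = 0" using p Z[OF c] N_iff[OF c] by auto
    obtain r where r: "r > 0" "ball (snd c p) r \<subseteq> Nc c" "\<And>i y. i \<in> {()} \<Longrightarrow> y \<in> ball (snd c p) r \<Longrightarrow> F c y = 0"
    proof (rule common_zeros_spread[of "{()}" "Nc c" "snd c p" "\<lambda>_. F c"
          "\<lambda>_ b x. \<bar>- 2 * fc c x * form_d (\<tau>c c) x b\<bar>"])
      show "F c differentiable (at x)" if "x \<in> Nc c" for x
        by (rule smooth_on_differentiable[OF F_smooth[OF c(1)] that])
      show "continuous_on (Nc c) (\<lambda>x. \<bar>- 2 * fc c x * form_d (\<tau>c c) x b\<bar>)" for b
        by (intro continuous_on_rabs continuous_on_mult continuous_on_const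
            smooth_on_continuous[OF C.f_smooth] smooth_on_continuous[OF C.on_N[OF C.\<theta>_smooth]])
      show "\<bar>pd (F c) x e\<bar> \<le> \<bar>- 2 * fc c x * form_d (\<tau>c c) x e\<bar> * (\<Sum>j\<in>{()}. \<bar>F c x\<bar>)"
        if "x \<in> Nc c" for e x
        using C.first_integral_pd[OF that, of a b] unfolding F_def[abs_def] by (simp add: abs_mult)
    qed (use pN Fp C.open_N in auto)
    show "\<exists>U. open U \<and> p \<in> U \<and> U \<subseteq> Z"
    proof (intro exI conjI)
      show "open (fst c \<inter> snd c -` ball (snd c p) r)" by (rule chart_preimage_open[OF c(1) open_ball])
      show "p \<in> fst c \<inter> snd c -` ball (snd c p) r" using c r by simp
      show "fst c \<inter> snd c -` ball (snd c p) r \<subseteq> Z"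
        using r(2,3) Z[OF c(1)] N_iff[OF c(1)] by auto
    qed
  qed
  moreover have "open (N - Z)"
    unfolding open_subopen[of "N - Z"]
  proof
    fix p assume p: "p \<in> N - Z"
    obtain c where c: "c \<in> \<A>" "p \<in> fst c" by (rule chart_ex)
    interpret C: einstein_domain "snd c ` fst c" "g c" "J c" "\<tau>c c" "\<mu>c c" by (rule chart_domain[OF c(1)])
    have o: "open (Nc c \<inter> F c -` (- {0}))"
      by (rule continuous_open_preimage[OF smooth_on_continuous[OF F_smooth[OF c(1)]] C.open_N]) auto
    show "\<exists>U. open U \<and> p \<in> U \<and> U \<subseteq> N - Z"
    proof (intro exI conjI)
      show "open (fst c \<inter> snd c -` (Nc c \<inter> F c -` (- {0})))" by (rule chart_preimage_open[OF c(1) o])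
      show "p \<in> fst c \<inter> snd c -` (Nc c \<inter> F c -` (- {0}))"
        using p c Z[OF c] N_iff[OF c] by auto
      show "fst c \<inter> snd c -` (Nc c \<inter> F c -` (- {0})) \<subseteq> N - Z"
        using Z[OF c(1)] N_iff[OF c(1)] by auto
    qed
  qed
  ultimately have "Z \<inter> N = {} \<or> (N - Z) \<inter> N = {}"
    by (rule connectedD[OF N_connected]) auto
  moreover have "p0 \<in> Z"
    using Z[OF c0] p0 c0 by (simp add: F_def b_def a_def local_rep_def chart_inv_left)
  ultimately have "N \<subseteq> Z" using p0 by blast
  then have e: "2 * fc c (snd c p) * (a * \<tau> p + b) = a" if "c \<in> \<A>" "p \<in> fst c" "p \<in> N" for c p
    using Z[OF that(1,2)] that by (auto simp: F_def local_rep_def chart_inv_left)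
  have "\<not> (a = 0 \<and> b = 0)" by (auto simp: b_def)
  then show ?thesis by (rule that) (rule e)
qed

end

lemma hamiltonian:
  assumes ab: "\<And>c p. c \<in> \<A> \<Longrightarrow> p \<in> fst c \<Longrightarrow> p \<in> N \<Longrightarrow> 2 * fc c (snd c p) * (a * \<tau> p + b) = a"
  shows "hamiltonian_on \<A> g J N (chi_form g J \<tau> a b)"
  unfolding hamiltonian_on_def two_form_on_def smooth_bilinear_field_on_def
proof (intro conjI ballI allI exI[of _ "\<lambda>p. a * \<tau> p"])
  fix c assume c: "c \<in> \<A>"
  interpret C: einstein_domain "snd c ` fst c" "g c" "J c" "\<tau>c c" "\<mu>c c" by (rule chart_domain[OF c])
  have chi: "chi_form g J \<tau> a b c x u v =
      (a * \<tau>c c x + b) * (C.\<theta> x u * C.\<theta>c x v - C.\<theta> x v * C.\<theta>c x u) / C.Q x" for x u v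
    by (simp add: chi_form_def wedge_def C.Q_def)
  have sigma: "local_rep c (\<lambda>p. a * \<tau> p) = (\<lambda>y. a * \<tau>c c y)" by (simp add: local_rep_def fun_eq_iff)
  show "smooth_on (snd c ` (fst c \<inter> N)) (\<lambda>x. chi_form g J \<tau> a b c x u v)" for u v
    unfolding chi N_chart[OF c] using C.Q_ne_0
    by (intro smooth_on_divide smooth_on_mult smooth_on_diff smooth_on_add smooth_on_const C.open_N
        C.on_N[OF C.t_smooth] C.on_N[OF C.\<theta>_smooth] C.on_N[OF C.\<theta>c_smooth] C.on_N[OF C.Q_smooth]) auto
  fix x assume x: "x \<in> snd c ` (fst c \<inter> N)"
  then have S: "x \<in> snd c ` fst c" and xN: "x \<in> C.N" using N_chart[OF c] by auto
  show "bilinear (chi_form g J \<tau> a b c x)"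
    unfolding bilinear_def chi
    by (intro conjI allI linearI)
      (simp_all add: C.\<theta>_simps[OF S] linear_add[OF C.\<theta>c_linear[OF S]] linear_cmul[OF C.\<theta>c_linear[OF S]]
        algebra_simps add_divide_distrib diff_divide_distrib)
  show "chi_form g J \<tau> a b c x u v = - chi_form g J \<tau> a b c x v u" for u v
    unfolding chi by (simp add: algebra_simps diff_divide_distrib)
  show "chi_form g J \<tau> a b c x (J c x u) (J c x v) = chi_form g J \<tau> a b c x u v" for u v
    unfolding chi C.\<theta>c_J[OF S] by (simp add: C.\<theta>c_eq algebra_simps)
  show "nabla_form2 (g c) u (chi_form g J \<tau> a b c) x v w =
      1 / 2 * (wedge (form_d (local_rep c (\<lambda>p. a * \<tau> p)) x) (flat_form (g c x) (J c x u)) v w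
        - wedge (form_dc (J c) (local_rep c (\<lambda>p. a * \<tau> p)) x) (flat_form (g c x) u) v w)" for u v w
  proof -
    obtain p where p: "p \<in> fst c" "p \<in> N" "x = snd c p" using x by blast
    have "2 * fc c x * (a * \<tau>c c x + b) = a"
      using ab[OF c p(1,2)] p c by (simp add: local_rep_def chart_inv_left)
    from C.nabla_chi[OF xN this] show ?thesis unfolding sigma chi_form_def[abs_def] .
  qed
next
  fix c d p u v
  assume c: "c \<in> \<A>" "d \<in> \<A>" and p: "p \<in> fst c \<inter> fst d \<inter> N"
  then have p': "p \<in> fst c" "p \<in> fst d" by auto
  show "let T = pd (transition c d) (snd c p)
    in chi_form g J \<tau> a b c (snd c p) u v = chi_form g J \<tau> a b d (snd d p) (T u) (T v)"
    using Q_transition[OF c p']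
    unfolding Let_def chi_form_def wedge_def form_d_transition[OF c p'] form_dc_transition[OF c p']
      \<tau>_transition[OF c(1,1) p'(1,1)] \<tau>_transition[OF c(2,2) p'(2,2)]
      einstein_domain.Q_def[OF chart_domain[OF c(1)]] einstein_domain.Q_def[OF chart_domain[OF c(2)]] by simp
next
  show "smooth_function_on \<A> N (\<lambda>p. a * \<tau> p)"
    unfolding smooth_function_on_def
  proof
    fix c assume c: "c \<in> \<A>"
    interpret C: einstein_domain "snd c ` fst c" "g c" "J c" "\<tau>c c" "\<mu>c c" by (rule chart_domain[OF c])
    have "local_rep c (\<lambda>p. a * \<tau> p) = (\<lambda>y. a * \<tau>c c y)" by (simp add: local_rep_def fun_eq_iff)
    then show "smooth_on (snd c ` (fst c \<inter> N)) (local_rep c (\<lambda>p. a * \<tau> p))"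
      unfolding N_chart[OF c] by (auto intro!: smooth_on_mult C.open_N smooth_on_const C.on_N[OF C.t_smooth])
  qed
qed

end

theorem proposition2:
  fixes \<A> :: "('a::{t2_space, second_countable_topology}, 'e::euclidean_space) chart set"
    and g :: "('a, 'e) bilinear_field"
    and J :: "('a, 'e) endo_field"
    and \<tau> :: "'a \<Rightarrow> real"
    and m :: nat
  assumes "DIM('e) = 2 * m" and "2 * m \<ge> 4"
    and "connected (UNIV :: 'a set)"
    and "kaehler_manifold \<A> g J"
    and "strongly_conformally_einstein \<A> g J \<tau>"
  shows "\<exists>a b. \<not> (a = 0 \<and> b = 0) \<and>
           hamiltonian_on \<A> g J (noncritical_set \<A> \<tau>) (chi_form g J \<tau> a b)"
proof -
  from assms(5) obtain \<mu> where \<mu>: "smooth_function_on \<A> UNIV \<tau>" "smooth_function_on \<A> UNIV \<mu>"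
    "\<forall>c\<in>\<A>. \<forall>x\<in>snd c ` fst c. \<forall>u v.
      (real DIM('e) - 2) * nabla_form1 (g c) u (form_dc (J c) (local_rep c \<tau>)) x v =
        - local_rep c \<tau> x * ricci_form (g c) (J c) x u v + local_rep c \<mu> x * kaehler_form (g c) (J c) x u v"
    "\<forall>c\<in>\<A>. \<forall>x\<in>snd c ` fst c. \<forall>u v.
      wedge (form_d (local_rep c \<tau>) x) (form_d (local_rep c \<mu>) x) u v = 0"
    unfolding strongly_conformally_einstein_def conformally_einstein_def by blast
  interpret einstein_manifold \<A> g J \<tau> \<mu>
  proof
    show "DIM('e) \<ge> 4" using assms(1,2) by simp
  qed (use assms(4) \<mu> in auto)
  obtain a b where ab: "\<not> (a = 0 \<and> b = 0)"
    "\<And>c p. c \<in> \<A> \<Longrightarrow> p \<in> fst c \<Longrightarrow> p \<in> N \<Longrightarrow> 2 * fc c (snd c p) * (a * \<tau> p + b) = a"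
    by (rule constants_exist[OF assms(3)]) (rule that; assumption)
  show ?thesis
  proof (intro exI conjI)
    show "\<not> (a = 0 \<and> b = 0)" by (rule ab(1))
    show "hamiltonian_on \<A> g J N (chi_form g J \<tau> a b)" by (rule hamiltonian[OF ab(2)])
  qed
qed

end
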